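(* Let $\Omega$ be a Polish space equipped with a probability measure $\mu$. Consider a reversible, ergodic Markov semigroup $(P_t)_{t\ge0}$ with stationary measure $\mu$, induced by a time-homogeneous Markov process on $\Omega$ and acting on suitable functions $\boldsymbol{f}:\Omega\to\mathbb{H}_d$. Assume that the Bakry--\'Emery criterion holds with a constant $c>0$: $$\Gamma(\boldsymbol{f})\preccurlyeq c\cdot\Gamma_2(\boldsymbol{f})\quad\text{($\mu$-almost everywhere) for all suitable }\boldsymbol{f}:\Omega\to\mathbb{H}_d.$$ Then, for every suitable $\boldsymbol{f}:\Omega\to\mathbb{H}_d$, for $q=1$ and for every real $q\ge1.5$, $$\big[\mathbb{E}_\mu\operatorname{tr}|\boldsymbol{f}-\mathbb{E}_\mu\boldsymbol{f}|^{2q}\big]^{1/(2q)}\le\sqrt{c\,(2q-1)}\,\big[\mathbb{E}_\mu\operatorname{tr}\Gamma(\boldsymbol{f})^q\big]^{1/(2q)}.$$ If moreover the variance proxy $v_{\boldsymbol{f}}:=\big\|\,\|\Gamma(\boldsymbol{f})\|\,\big\|_{L_\infty(\mu)}$ is finite, then for the same values of $q$, $$\big[\mathbb{E}_\mu\operatorname{tr}|\boldsymbol{f}-\mathbb{E}_\mu\boldsymbol{f}|^{2q}\big]^{1/(2q)}\le d^{1/(2q)}\sqrt{c\,(2q-1)\,v_{\boldsymbol{f}}}.$$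
   Context: $\mathbb{M}_d$ is the algebra of $d\times d$ complex matrices, $\mathbb{H}_d$ its real subspace of Hermitian matrices; $\preccurlyeq$ is the positive-semidefinite order; $\|\cdot\|$ is the $\ell_2$ operator norm; $\operatorname{tr}$ is the trace. Scalar functions are applied to Hermitian matrices via the eigenvalue decomposition, and nonlinear functions bind before trace and expectation. $\mathbb{E}_\mu$ acts entrywise. Semigroup: $(Z_t)_{t\ge0}$ is a time-homogeneous Markov process on $\Omega$ with stationary measure $\mu$, and for each $d$ and (bounded) measurable $\boldsymbol{f}:\Omega\to\mathbb{H}_d$, $(P_t\boldsymbol{f})(z)=\mathbb{E}[\boldsymbol{f}(Z_t)\mid Z_0=z]$ (entrywise). It is reversible if $\mathbb{E}_\mu[(P_tf)g]=\mathbb{E}_\mu[f(P_tg)]$ for all $t\ge0$ and real-valued $f,g$, and ergodic if $P_tf\to\mathbb{E}_\mu f$ in $L_2(\mu)$ as $t\to\infty$ for all real-valued (square-integrable) $f$. The infinitesimal generator is $\mathcal{L}\boldsymbol{f}=\lim_{t\downarrow0}(P_t\boldsymbol{f}-\boldsymbol{f})/t$ (entrywise, also for $\mathbb{M}_d$-valued functions). The matrix carr\'e du champ and iterated carr\'e du champ operators are $$\Gamma(\boldsymbol{f},\boldsymbol{g})=\tfrac12[\mathcal{L}(\boldsymbol{f}\boldsymbol{g})-\boldsymbol{f}\mathcal{L}(\boldsymbol{g})-\mathcal{L}(\boldsymbol{f})\boldsymbol{g}],\qquad \Gamma_2(\boldsymbol{f},\boldsymbol{g})=\tfrac12[\mathcal{L}\Gamma(\boldsymbol{f},\boldsymbol{g})-\Gamma(\boldsymbol{f},\mathcal{L}(\boldsymbol{g}))-\Gamma(\mathcal{L}(\boldsymbol{f}),\boldsymbol{g})],$$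 with $\Gamma(\boldsymbol{f})=\Gamma(\boldsymbol{f},\boldsymbol{f})$ and $\Gamma_2(\boldsymbol{f})=\Gamma_2(\boldsymbol{f},\boldsymbol{f})$. Suitable functions: for each $d$, a fixed class of functions $\Omega\to\mathbb{H}_d$ (an algebra of nice functions, e.g. smooth compactly supported ones in concrete cases) on which $\mathcal{L},\Gamma,\Gamma_2$ are defined, which is compatible with the operations used ($P_t$, $\mathcal{L}$, sums, products, constants, standard matrix functions; $\boldsymbol{f}$ is suitable iff the real and imaginary parts of its entries are suitable), and on which all limits, time derivatives and expectations involved exist and may be interchanged; in particular $\frac{d}{dt}P_t=\mathcal{L}P_t=P_t\mathcal{L}$ and $\mathbb{E}_\mu[\mathcal{L}\boldsymbol{f}]=\boldsymbol{0}$. *)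

theory Defs
  imports "HOL-Probability.Probability"
begin

section \<open>Hermitian matrices\<close>

definition ctranspose :: "complex^'n^'m \<Rightarrow> complex^'m^'n" where
  "ctranspose A = (\<chi> i j. cnj (A $ j $ i))"

definition hermitian :: "complex^'n^'n \<Rightarrow> bool" where
  "hermitian A \<longleftrightarrow> ctranspose A = A"

definition unitary :: "complex^'n^'n \<Rightarrow> bool" where
  "unitary U \<longleftrightarrow> ctranspose U ** U = mat 1 \<and> U ** ctranspose U = mat 1"

definition real_diag :: "('n \<Rightarrow> real) \<Rightarrow> complex^'n^'n" where
  "real_diag l = (\<chi> i j. if i = j then complex_of_real (l i) else 0)"

definition pos_semidef :: "complex^'n^'n \<Rightarrow> bool" where
  "pos_semidef A \<longleftrightarrow>
     hermitian A \<and> (\<forall>x. 0 \<le> Re (\<Sum>i\<in>UNIV. \<Sum>j\<in>UNIV. cnj (x $ i) * A $ i $ j * x $ j))"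

definition psd_le :: "complex^'n^'n \<Rightarrow> complex^'n^'n \<Rightarrow> bool" where
  "psd_le A B \<longleftrightarrow> pos_semidef (B - A)"

text \<open>The function \<open>\<phi>\<close> applied to a Hermitian matrix through an eigenvalue decomposition; the result
  does not depend on the decomposition, and it is unspecified for matrices that are not Hermitian.\<close>

definition mat_fun :: "(real \<Rightarrow> real) \<Rightarrow> complex^'n^'n \<Rightarrow> complex^'n^'n" where
  "mat_fun \<phi> A = (SOME B. \<exists>U l. unitary U \<and> A = U ** real_diag l ** ctranspose U \<and>
                                B = U ** real_diag (\<lambda>i. \<phi> (l i)) ** ctranspose U)"

text \<open>The norm on \<open>complex^'n\<close> is the Euclidean one, so this is the \<open>\<ell>\<^sub>2\<close> operator norm.\<close>

definition op_norm :: "complex^'n^'n \<Rightarrow> real" where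
  "op_norm A = onorm (\<lambda>x. A *v x)"


section \<open>Markov processes and their semigroups\<close>

text \<open>A Markov process on \<open>'a\<close> is given by the laws \<open>W z\<close> of the process started at \<open>z\<close>, on a
  common space of outcomes carrying the random variables \<open>Z t\<close> for \<open>t \<ge> 0\<close>. An expectation
  conditioned on \<open>Z 0 = z\<close> is an expectation under \<open>W z\<close>. The operators below apply to functions
  with values in any Banach space; for matrices the integral and the limit are entrywise.\<close>

definition semigroup_op ::
  "('a \<Rightarrow> 'w measure) \<Rightarrow> (real \<Rightarrow> 'w \<Rightarrow> 'a) \<Rightarrow> real \<Rightarrow>
   ('a \<Rightarrow> 'b::{banach, second_countable_topology}) \<Rightarrow> 'a \<Rightarrow> 'b" where
  "semigroup_op W Z t f z = (\<integral>w. f (Z t w) \<partial>W z)"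

definition generator ::
  "('a \<Rightarrow> 'w measure) \<Rightarrow> (real \<Rightarrow> 'w \<Rightarrow> 'a) \<Rightarrow>
   ('a \<Rightarrow> 'b::{banach, second_countable_topology}) \<Rightarrow> 'a \<Rightarrow> 'b" where
  "generator W Z f z = Lim (at_right 0) (\<lambda>t. (semigroup_op W Z t f z - f z) /\<^sub>R t)"

definition carre_du_champ ::
  "('a \<Rightarrow> 'w measure) \<Rightarrow> (real \<Rightarrow> 'w \<Rightarrow> 'a) \<Rightarrow>
   ('a \<Rightarrow> complex^'d^'d) \<Rightarrow> ('a \<Rightarrow> complex^'d^'d) \<Rightarrow> 'a \<Rightarrow> complex^'d^'d" where
  "carre_du_champ W Z f g z = (1/2) *\<^sub>R
     (generator W Z (\<lambda>y. f y ** g y) z - f z ** generator W Z g z - generator W Z f z ** g z)"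

definition carre_du_champ2 ::
  "('a \<Rightarrow> 'w measure) \<Rightarrow> (real \<Rightarrow> 'w \<Rightarrow> 'a) \<Rightarrow>
   ('a \<Rightarrow> complex^'d^'d) \<Rightarrow> ('a \<Rightarrow> complex^'d^'d) \<Rightarrow> 'a \<Rightarrow> complex^'d^'d" where
  "carre_du_champ2 W Z f g z = (1/2) *\<^sub>R
     (generator W Z (carre_du_champ W Z f g) z
      - carre_du_champ W Z f (generator W Z g) z - carre_du_champ W Z (generator W Z f) g z)"

definition natural_filtration ::
  "'w measure \<Rightarrow> (real \<Rightarrow> 'w \<Rightarrow> 'a::topological_space) \<Rightarrow> real \<Rightarrow> 'w measure" where
  "natural_filtration N Z s =
     sigma (space N) (\<Union>u\<in>{0..s}. {Z u -` A \<inter> space N | A. A \<in> sets borel})"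

locale markov_process =
  fixes W :: "'a::polish_space \<Rightarrow> 'w measure" and Z :: "real \<Rightarrow> 'w \<Rightarrow> 'a"
  assumes prob_law: "prob_space (W z)"
    and measurable_process: "t \<ge> 0 \<Longrightarrow> Z t \<in> W z \<rightarrow>\<^sub>M borel"
    and start: "AE w in W z. Z 0 w = z"
    and measurable_start: "t \<ge> 0 \<Longrightarrow> (\<lambda>z. distr (W z) borel (Z t)) \<in> borel \<rightarrow>\<^sub>M prob_algebra borel"
    and markov_property:
      "\<lbrakk>s \<ge> 0; t \<ge> 0; f \<in> borel_measurable borel; bounded (range f)\<rbrakk> \<Longrightarrow>
        AE w in W z. real_cond_exp (W z) (natural_filtration (W z) Z s) (\<lambda>w'. f (Z (s + t) w')) w
                       = semigroup_op W Z t f (Z s w)"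

definition square_integrable :: "'a measure \<Rightarrow> ('a \<Rightarrow> real) \<Rightarrow> bool" where
  "square_integrable M f \<longleftrightarrow> f \<in> borel_measurable M \<and> integrable M (\<lambda>z. (f z)\<^sup>2)"

locale reversible_ergodic_markov_process = markov_process W Z
  for W :: "'a::polish_space \<Rightarrow> 'w measure" and Z :: "real \<Rightarrow> 'w \<Rightarrow> 'a" +
  fixes \<mu> :: "'a measure"
  assumes prob_mu: "prob_space \<mu>"
    and sets_mu: "sets \<mu> = sets borel"
    and stationary: "t \<ge> 0 \<Longrightarrow> \<mu> \<bind> (\<lambda>z. distr (W z) borel (Z t)) = \<mu>"
    and reversible:
      "\<lbrakk>t \<ge> 0; square_integrable \<mu> f; square_integrable \<mu> g\<rbrakk> \<Longrightarrow>
        (\<integral>z. semigroup_op W Z t f z * g z \<partial>\<mu>) = (\<integral>z. f z * semigroup_op W Z t g z \<partial>\<mu>)"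
    and ergodic:
      "square_integrable \<mu> f \<Longrightarrow>
        ((\<lambda>t. \<integral>z. (semigroup_op W Z t f z - (\<integral>y. f y \<partial>\<mu>))\<^sup>2 \<partial>\<mu>) \<longlongrightarrow> 0) at_top"


section \<open>Suitable functions\<close>

definition smooth_bounded_derivs :: "(real \<Rightarrow> real) \<Rightarrow> bool" where
  "smooth_bounded_derivs \<phi> \<longleftrightarrow>
     (\<forall>n. (\<forall>x. (deriv ^^ n) \<phi> field_differentiable at x) \<and> bounded (range ((deriv ^^ n) \<phi>)))"

text \<open>The suitable matrix-valued functions determined by a class \<open>S\<close> of suitable scalar functions.\<close>

definition suitable :: "('a \<Rightarrow> real) set \<Rightarrow> ('a \<Rightarrow> complex^'d^'d) \<Rightarrow> bool" where
  "suitable S f \<longleftrightarrow> (\<forall>z. hermitian (f z)) \<and>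
     (\<forall>i j. (\<lambda>z. Re (f z $ i $ j)) \<in> S \<and> (\<lambda>z. Im (f z $ i $ j)) \<in> S)"

definition closed_under_mat_fun :: "('a \<Rightarrow> real) set \<Rightarrow> 'd::finite itself \<Rightarrow> bool" where
  "closed_under_mat_fun S d_type \<longleftrightarrow>
     (\<forall>(f :: 'a \<Rightarrow> complex^'d^'d) \<phi>. suitable S f \<and> smooth_bounded_derivs \<phi> \<longrightarrow>
        suitable S (\<lambda>z. mat_fun \<phi> (f z)))"

text \<open>Suitable functions need not be bounded. Since \<open>S\<close> is closed under products, they have
  moments of all orders. Convergence of the difference quotients in \<open>L\<^sub>2(\<mu>)\<close> is what allows the
  limit defining the generator to be interchanged with expectations. Standard matrix functions are
  represented by the polynomials, which the algebra operations provide, and the smooth functions with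
  bounded derivatives; the powers in the moment inequalities are not required to preserve \<open>S\<close>.\<close>

locale suitable_functions = reversible_ergodic_markov_process W Z \<mu>
  for W :: "'a::polish_space \<Rightarrow> 'w measure" and Z :: "real \<Rightarrow> 'w \<Rightarrow> 'a" and \<mu> :: "'a measure" +
  fixes S :: "('a \<Rightarrow> real) set" and d_type :: "'d::finite itself"
  assumes suitable_measurable: "f \<in> S \<Longrightarrow> f \<in> borel_measurable borel"
    and suitable_integrable: "f \<in> S \<Longrightarrow> integrable \<mu> f"
    and suitable_integrable_law: "\<lbrakk>f \<in> S; t \<ge> 0\<rbrakk> \<Longrightarrow> integrable (W z) (\<lambda>w. f (Z t w))"
    and suitable_const: "(\<lambda>_. a) \<in> S"
    and suitable_add: "\<lbrakk>f \<in> S; g \<in> S\<rbrakk> \<Longrightarrow> (\<lambda>z. f z + g z) \<in> S"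
    and suitable_mult: "\<lbrakk>f \<in> S; g \<in> S\<rbrakk> \<Longrightarrow> (\<lambda>z. f z * g z) \<in> S"
    and suitable_semigroup: "\<lbrakk>f \<in> S; t \<ge> 0\<rbrakk> \<Longrightarrow> semigroup_op W Z t f \<in> S"
    and suitable_generator: "f \<in> S \<Longrightarrow> generator W Z f \<in> S"
    and suitable_mat_fun: "closed_under_mat_fun S d_type"
    and generator_limit:
      "f \<in> S \<Longrightarrow>
        ((\<lambda>t. (semigroup_op W Z t f z - f z) / t) \<longlongrightarrow> generator W Z f z) (at_right 0)"
    and generator_limit_L2:
      "f \<in> S \<Longrightarrow>
        ((\<lambda>t. \<integral>z. ((semigroup_op W Z t f z - f z) / t - generator W Z f z)\<^sup>2 \<partial>\<mu>) \<longlongrightarrow> 0) (at_right 0)"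
    and semigroup_deriv:
      "\<lbrakk>f \<in> S; t \<ge> 0\<rbrakk> \<Longrightarrow>
        ((\<lambda>s. semigroup_op W Z s f z) has_real_derivative generator W Z (semigroup_op W Z t f) z)
          (at t within {0..})"
    and generator_commute:
      "\<lbrakk>f \<in> S; t \<ge> 0\<rbrakk> \<Longrightarrow>
        generator W Z (semigroup_op W Z t f) z = semigroup_op W Z t (generator W Z f) z"
    and generator_mean_zero: "f \<in> S \<Longrightarrow> (\<integral>z. generator W Z f z \<partial>\<mu>) = 0"


section \<open>Bakry--\'Emery criterion, matrix moments, variance proxy\<close>

definition bakry_emery ::
  "('a \<Rightarrow> 'w measure) \<Rightarrow> (real \<Rightarrow> 'w \<Rightarrow> 'a) \<Rightarrow> 'a measure \<Rightarrow> ('a \<Rightarrow> real) set \<Rightarrow> 'd::finite itself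
     \<Rightarrow> real \<Rightarrow> bool" where
  "bakry_emery W Z \<mu> S d_type c \<longleftrightarrow>
     (\<forall>f :: 'a \<Rightarrow> complex^'d^'d. suitable S f \<longrightarrow>
        (AE z in \<mu>. psd_le (carre_du_champ W Z f f z) (c *\<^sub>R carre_du_champ2 W Z f f z)))"

definition central_moment :: "'a measure \<Rightarrow> real \<Rightarrow> ('a \<Rightarrow> complex^'d^'d) \<Rightarrow> real" where
  "central_moment \<mu> p f =
     (\<integral>z. Re (trace (mat_fun (\<lambda>x. \<bar>x\<bar> powr p) (f z - (\<integral>y. f y \<partial>\<mu>)))) \<partial>\<mu>)"

definition carre_du_champ_moment ::
  "('a \<Rightarrow> 'w measure) \<Rightarrow> (real \<Rightarrow> 'w \<Rightarrow> 'a) \<Rightarrow> 'a measure \<Rightarrow> real \<Rightarrow>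
   ('a \<Rightarrow> complex^'d^'d) \<Rightarrow> real" where
  "carre_du_champ_moment W Z \<mu> q f =
     (\<integral>z. Re (trace (mat_fun (\<lambda>x. x powr q) (carre_du_champ W Z f f z))) \<partial>\<mu>)"

definition variance_proxy ::
  "('a \<Rightarrow> 'w measure) \<Rightarrow> (real \<Rightarrow> 'w \<Rightarrow> 'a) \<Rightarrow> 'a measure \<Rightarrow> ('a \<Rightarrow> complex^'d^'d) \<Rightarrow> ereal" where
  "variance_proxy W Z \<mu> f = esssup \<mu> (\<lambda>z. ereal (op_norm (carre_du_champ W Z f f z)))"

end

theory Submission
  imports Defs
begin

text \<open>
  Write \<open>P\<^sub>t\<close> for the semigroup, \<open>L\<close> for its generator, \<open>E\<close> for the mean under \<open>\<mu>\<close>,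
  \<open>\<langle>X, Y\<rangle> = Re (tr (X Y))\<close>, and put \<open>f\<^sub>0 = f - E f\<close>, \<open>g(x) = |x|\<^bsup>2q-2\<^esup>\<close> (the constant 1 if \<open>q = 1\<close>)
  and \<open>M = E tr |f\<^sub>0|\<^bsup>2q\<^esup>\<close>. The proof follows \<open>F(t) = E \<langle>P\<^sub>t f\<^sub>0, f\<^sub>0 g(f\<^sub>0)\<rangle>\<close> along the semigroup: \<open>F(0) = M\<close>,
  ergodicity gives \<open>F(t) \<longlongrightarrow> 0\<close>, and \<open>F'(t) = E \<langle>L P\<^sub>t f\<^sub>0, f\<^sub>0 g(f\<^sub>0)\<rangle>\<close>. Three estimates bound the loss \<open>- F'(t)\<close>.

  Chain rule (\<open>chain_rule_inequality\<close>). By reversibility, \<open>- E \<langle>L u, \<phi>(f)\<rangle>\<close> is the limit of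
  \<open>E \<langle>u(Z\<^sub>t) - u(Z\<^sub>0), \<phi>(f(Z\<^sub>t)) - \<phi>(f(Z\<^sub>0))\<rangle> / 2t\<close> for the stationary process. A mean value inequality for traces
  (\<open>trace_mean_value_inequality\<close>), proved by comparing the eigenbases of the two matrices, bounds this by
  \<open>E \<langle>s \<Gamma>(f) + \<Gamma>(u) / s, \<psi>(f)\<rangle> / 2\<close> for every \<open>s > 0\<close>, whenever
  \<open>|\<phi>(x) - \<phi>(y)| \<le> |x - y| (\<psi>(x) + \<psi>(y)) / 2\<close>. For \<open>\<phi>(x) = x g(x)\<close> and \<open>\<psi> = (2q - 1) g\<close> this scalar condition is the
  trapezoidal estimate for a convex derivative, which is where \<open>q \<ge> 3/2\<close> or \<open>q = 1\<close> is used. The matrix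
  \<open>\<phi>(f)\<close> enters only as a square-integrable test function.

  Gradient decay (\<open>gradient_decay\<close>). For a suitable positive semidefinite \<open>h\<close>, the function
  \<open>r \<mapsto> E \<langle>\<Gamma>(P\<^bsub>t-r\<^esub> f), P\<^sub>r h\<rangle>\<close> has derivative \<open>2 E \<langle>\<Gamma>\<^sub>2(P\<^bsub>t-r\<^esub> f), P\<^sub>r h\<rangle>\<close>, which by the Bakry-Emery criterion is
  at least \<open>2/c\<close> times the function itself. Hence \<open>E \<langle>\<Gamma>(P\<^sub>t f), h\<rangle> \<le> exp(-2t/c) E \<langle>P\<^sub>t \<Gamma>(f), h\<rangle>\<close>.
  Approximating \<open>g\<close> by trigonometric polynomials extends this to \<open>h = g(f\<^sub>0)\<close>.

  Young's inequality (\<open>trace_form_le_of_scalar\<close>, \<open>integral_trace_form_P_le\<close>). Applied to the eigenvalues of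
  \<open>\<Gamma>(f)(Z\<^sub>t)\<close> and \<open>f\<^sub>0(Z\<^sub>0)\<close>, it gives \<open>c (2q-1) E \<langle>P\<^sub>t \<Gamma>(f), g(f\<^sub>0)\<rangle> \<le> a/q + (1 - 1/q) M\<close> with
  \<open>a = (c (2q-1))\<^sup>q E tr \<Gamma>(f)\<^sup>q\<close>, uniformly in \<open>t\<close>.

  With \<open>s = exp(-t/c)\<close> the three estimates combine to \<open>- F'(t) \<le> (a/q + (1 - 1/q) M) exp(-t/c) / c\<close>; integrating over
  \<open>t\<close> gives \<open>M \<le> a/q + (1 - 1/q) M\<close>, that is \<open>M \<le> a\<close>.

  Differentiating such expectations needs some care, since suitable functions are unbounded. The class of
  functions dominated in norm by a suitable function is an algebra preserved by \<open>P\<^sub>t\<close>, with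
  moments of all orders; on it, mean-square convergence of difference quotients together with bounded sixth moments
  is enough to differentiate expectations of threefold products.\<close>

section \<open>Complex matrices and the trace form\<close>

lemma ctranspose_nth [simp]: "ctranspose A $ i $ j = cnj (A $ j $ i)"
  by (simp add: ctranspose_def)

lemma ctranspose_ctranspose [simp]: "ctranspose (ctranspose A) = A"
  by (simp add: vec_eq_iff)

lemma ctranspose_add: "ctranspose (A + B) = ctranspose A + ctranspose B"
  by (simp add: vec_eq_iff)

lemma ctranspose_diff: "ctranspose (A - B) = ctranspose A - ctranspose B"
  by (simp add: vec_eq_iff)

lemma ctranspose_scaleR: "ctranspose (r *\<^sub>R A) = r *\<^sub>R ctranspose A"
  by (simp add: vec_eq_iff)

lemma ctranspose_mult: "ctranspose (A ** B) = ctranspose B ** ctranspose A"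
  by (simp add: vec_eq_iff matrix_matrix_mult_def mult.commute)

lemma linear_ctranspose: "linear (ctranspose :: complex^'n^'m \<Rightarrow> complex^'m^'n)"
  by (intro linearI) (simp_all add: ctranspose_add ctranspose_scaleR)

lemma bounded_bilinear_matrix_mult:
  "bounded_bilinear ((**) :: complex^'n^'m \<Rightarrow> complex^'k^'n \<Rightarrow> complex^'k^'m)"
  unfolding bilinear_conv_bounded_bilinear[symmetric] bilinear_def
  by (auto intro!: linearI simp: vec_eq_iff matrix_matrix_mult_def sum.distrib algebra_simps scaleR_sum_right)

interpretation matrix_mult: bounded_bilinear "(**) :: complex^'n^'m \<Rightarrow> complex^'k^'n \<Rightarrow> complex^'k^'m"
  by (rule bounded_bilinear_matrix_mult)

definition trace_form :: "complex^'n^'n \<Rightarrow> complex^'n^'n \<Rightarrow> real" where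
  "trace_form A B = Re (trace (A ** B))"

lemma linear_Re_trace: "linear (\<lambda>A::complex^'n^'n. Re (trace A))"
  by (intro linearI) (simp_all add: trace_def sum.distrib sum_distrib_left)

lemma bounded_bilinear_trace_form: "bounded_bilinear (trace_form :: complex^'n^'n \<Rightarrow> _)"
  unfolding bilinear_conv_bounded_bilinear[symmetric] bilinear_def trace_form_def
  by (auto intro!: linearI simp: trace_def matrix_mult.add_left matrix_mult.add_right
      matrix_mult.scaleR_left matrix_mult.scaleR_right sum.distrib sum_distrib_left)

interpretation trace_form: bounded_bilinear "trace_form :: complex^'n^'n \<Rightarrow> _"
  by (rule bounded_bilinear_trace_form)

lemma trace_form_commute: "trace_form A B = trace_form B A"
  unfolding trace_form_def by (subst trace_mul_sym) (rule refl)

lemma trace_form_assoc: "trace_form (A ** B) C = trace_form A (B ** C)"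
  by (simp add: trace_form_def matrix_mul_assoc)

lemma trace_form_cyclic: "trace_form A (B ** C) = trace_form B (C ** A)"
  by (metis trace_form_assoc trace_form_commute)

section \<open>The spectral theorem\<close>

definition cinner :: "complex^'n \<Rightarrow> complex^'n \<Rightarrow> complex" where
  "cinner x y = (\<Sum>k\<in>UNIV. cnj (x $ k) * y $ k)"

lemma cinner_add_right: "cinner x (y + z) = cinner x y + cinner x z"
  by (simp add: cinner_def sum.distrib algebra_simps)
lemma cinner_add_left: "cinner (x + y) z = cinner x z + cinner y z"
  by (simp add: cinner_def sum.distrib algebra_simps)
lemma cinner_diff_right: "cinner x (y - z) = cinner x y - cinner x z"
  by (simp add: cinner_def sum_subtractf algebra_simps)
lemma cinner_diff_left: "cinner (x - y) z = cinner x z - cinner y z"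
  by (simp add: cinner_def sum_subtractf algebra_simps)
lemma cinner_smult_right: "cinner x (a *s y) = a * cinner x y"
  by (simp add: cinner_def sum_distrib_left algebra_simps)
lemma cinner_smult_left: "cinner (a *s x) y = cnj a * cinner x y"
  by (simp add: cinner_def sum_distrib_left algebra_simps)

lemma cinner_axis_left: "cinner (axis i 1) y = y $ i"
proof -
  have "cinner (axis i 1) y = (\<Sum>k\<in>UNIV. if k = i then y $ k else 0)"
    unfolding cinner_def by (intro sum.cong) (auto simp: axis_def)
  then show ?thesis by simp
qed

lemma cinner_self: "cinner x x = of_real ((norm x)\<^sup>2)"
  by (simp add: cinner_def norm_vec_def L2_set_def sum_nonneg real_sqrt_pow2 mult.commute
      complex_norm_square[symmetric])

text \<open>The entries of \<open>U\<^sup>* A V\<close> are matrix elements of \<open>A\<close> between columns. Orthonormality of columns and the effect of a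
  change of basis are both read off from this.\<close>

lemma congruence_entry: "(ctranspose U ** A ** V) $ i $ j = cinner (column i U) (A *v column j V)"
proof -
  have "(ctranspose U ** A ** V) $ i $ j = (ctranspose U ** (A ** V)) $ i $ j"
    by (simp add: matrix_mul_assoc)
  also have "\<dots> = cinner (column i U) (A *v column j V)"
    by (simp add: cinner_def matrix_matrix_mult_def matrix_vector_mult_def column_def)
  finally show ?thesis .
qed

lemma unitaryI: "ctranspose U ** U = mat 1 \<Longrightarrow> unitary U"
  using matrix_left_right_inverse by (auto simp: unitary_def)

lemma norm_column_unitary:
  assumes "ctranspose U ** U = mat 1"
  shows "norm (column i U) = 1"
proof -
  have "cinner (column i U) (column i U) = (ctranspose U ** mat 1 ** U) $ i $ i"
    unfolding congruence_entry by simp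
  then have "cinner (column i U) (column i U) = 1"
    using assms by simp (simp add: mat_def)
  then have "(norm (column i U))\<^sup>2 = 1"
    by (simp add: cinner_self flip: of_real_power)
  then show ?thesis using norm_ge_zero[of "column i U"] by (smt (verit) power2_eq_1_iff)
qed

lemma compact_unitary: "compact {U :: complex^'n^'n. ctranspose U ** U = mat 1}"
  unfolding compact_eq_bounded_closed
proof
  have "norm U \<le> real CARD('n)" if "ctranspose U ** U = mat 1" for U :: "complex^'n^'n"
  proof -
    have col: "norm (U $ k $ i) \<le> 1" for i k
      using Finite_Cartesian_Product.norm_nth_le[of "column i U" k] norm_column_unitary[OF that, of i]
      by (simp add: column_def)
    have "(norm U)\<^sup>2 = (\<Sum>k\<in>UNIV. \<Sum>i\<in>UNIV. (norm (U $ k $ i))\<^sup>2)"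
      by (simp add: norm_vec_def L2_set_def sum_nonneg)
    also have "\<dots> \<le> (\<Sum>k\<in>(UNIV::'n set). \<Sum>i\<in>(UNIV::'n set). 1)"
      using col by (intro sum_mono) (simp add: power_le_one)
    finally have "(norm U)\<^sup>2 \<le> (real CARD('n))\<^sup>2" by (simp add: power2_eq_square)
    then show ?thesis by (rule power2_le_imp_le) simp
  qed
  then show "bounded {U :: complex^'n^'n. ctranspose U ** U = mat 1}"
    by (auto simp: bounded_iff)
  have "continuous_on UNIV (\<lambda>U::complex^'n^'n. ctranspose U ** U)"
    by (intro matrix_mult.continuous_on continuous_on_id linear_continuous_on)
       (simp add: linear_ctranspose linear_linear)
  then have "closed ((\<lambda>U::complex^'n^'n. ctranspose U ** U) -` {mat 1})"
    by (intro closed_vimage) auto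
  then show "closed {U :: complex^'n^'n. ctranspose U ** U = mat 1}"
    by (simp add: vimage_def)
qed

text \<open>The gain of a plane rotation is linear in the angle while its cost is quadratic, so a small angle
  in the right direction always improves.\<close>

lemma exists_improving_angle:
  fixes a b d :: real
  assumes "b > 0"
  obtains c s where "c\<^sup>2 + s\<^sup>2 = 1" "s\<^sup>2 * d + 2 * c * s * b > 0"
proof -
  define e where "e = min 1 (b / (\<bar>d\<bar> + 1))"
  have e: "0 < e" "e \<le> 1" using assms by (auto simp: e_def)
  have "e * \<bar>d\<bar> < b"
  proof -
    have "e * (\<bar>d\<bar> + 1) \<le> b"
      using min.cobounded2[of 1 "b / (\<bar>d\<bar> + 1)"] unfolding e_def[symmetric]
      by (simp add: field_simps)
    then show ?thesis using e by (simp add: algebra_simps)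
  qed
  moreover have "- (e * d) \<le> e * \<bar>d\<bar>" using e by (metis abs_ge_minus_self abs_mult abs_of_pos)
  ultimately have "e * d + 2 * b > 0" using assms by linarith
  define n where "n = 1 / sqrt (1 + e\<^sup>2)"
  have n: "n > 0" "n\<^sup>2 * (1 + e\<^sup>2) = 1"
    using add_pos_nonneg[of 1 "e\<^sup>2"] by (auto simp: n_def power_divide)
  have "n\<^sup>2 + (n * e)\<^sup>2 = 1" using n(2) by (simp add: power_mult_distrib algebra_simps)
  moreover have "(n * e)\<^sup>2 * d + 2 * n * (n * e) * b = n\<^sup>2 * e * (e * d + 2 * b)"
    by (simp add: power2_eq_square algebra_simps)
  moreover have "\<dots> > 0" using n e \<open>e * d + 2 * b > 0\<close> by simp
  ultimately show ?thesis using that[of n "n * e"] by metis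
qed

lemma hermitian_nth: "hermitian A \<Longrightarrow> cnj (A $ i $ j) = A $ j $ i"
  unfolding hermitian_def by (metis ctranspose_nth)

lemma matrix_vector_axis: "((B::complex^'n^'m) *v axis j 1) $ i = B $ i $ j"
proof -
  have "(B *v axis j 1) $ i = (\<Sum>k\<in>UNIV. if k = j then B $ i $ k else 0)"
    unfolding matrix_vector_mult_def vec_lambda_beta by (intro sum.cong) (auto simp: axis_def)
  then show ?thesis by simp
qed

lemma cinner_two_axes:
  "cinner (a *s axis p 1 + b *s axis q 1) (B *v (a *s axis p 1 + b *s axis q 1)) =
     (cnj a * a) * B $ p $ p + cnj a * (b * B $ p $ q) + a * (cnj b * B $ q $ p) + (cnj b * b) * B $ q $ q"
proof -
  have "cinner (a *s axis p 1 + b *s axis q 1) (B *v (a *s axis p 1 + b *s axis q 1)) =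
     cnj a * (a * B $ p $ p + b * B $ p $ q) + cnj b * (a * B $ q $ p + b * B $ q $ q)"
    by (simp only: cinner_add_left cinner_smult_left cinner_axis_left
       matrix_vector_right_distrib vector_scalar_commute matrix_vector_axis vector_add_component vector_smult_component)
  then show ?thesis by (simp only: ring_distribs mult_ac add_ac)
qed

text \<open>Fix distinct weights \<open>w\<^sub>i\<close> and maximise \<open>\<Sum>i. w\<^sub>i (U\<^sup>* A U)\<^sub>i\<^sub>i\<close> over the compact set of unitary matrices. If
  \<open>(U\<^sup>* A U)\<^sub>p\<^sub>q \<noteq> 0\<close> with \<open>w\<^sub>p > w\<^sub>q\<close>, rotating the columns \<open>p\<close> and \<open>q\<close> moves diagonal mass from \<open>q\<close> to \<open>p\<close> and
  increases the objective; so at a maximiser the matrix is diagonal.\<close>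

theorem spectral_decomposition:
  fixes A :: "complex^'n^'n"
  assumes "hermitian A"
  obtains U l where "unitary U" "A = U ** real_diag l ** ctranspose U"
proof -
  obtain w0 :: "'n \<Rightarrow> nat" where w0: "inj w0"
    using finite_imp_inj_to_nat_seg[of "UNIV :: 'n set"] by auto
  define w where "w i = real (w0 i)" for i
  have w: "w i = w j \<longleftrightarrow> i = j" for i j using w0 by (auto simp: w_def inj_eq)
  define obj where "obj U = (\<Sum>i\<in>UNIV. w i * Re ((ctranspose U ** A ** U) $ i $ i))" for U :: "complex^'n^'n"
  let ?Un = "{U :: complex^'n^'n. ctranspose U ** U = mat 1}"
  have "ctranspose (mat 1) = (mat 1 :: complex^'n^'n)"
    by (auto simp: vec_eq_iff mat_def)
  then have "mat 1 \<in> ?Un" by simp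
  moreover have "continuous_on ?Un obj"
    unfolding obj_def
    by (intro continuous_intros matrix_mult.continuous_on linear_continuous_on
          bounded_linear.continuous_on[OF bounded_linear_vec_nth] continuous_on_id)
       (simp add: linear_ctranspose linear_linear)
  ultimately obtain U where U: "ctranspose U ** U = mat 1"
    and max: "\<And>V. ctranspose V ** V = mat 1 \<Longrightarrow> obj V \<le> obj U"
    using continuous_attains_sup[OF compact_unitary, of obj] by blast
  define B where "B = ctranspose U ** A ** U"
  have B_herm: "hermitian B"
    using assms by (simp add: B_def hermitian_def ctranspose_mult matrix_mul_assoc)
  have off: "B $ p $ q = 0" if "w p > w q" for p q
  proof (rule ccontr)
    assume "B $ p $ q \<noteq> 0"
    define b where "b = norm (B $ p $ q)"
    \<comment> \<open>This phase makes the coupling of the two columns real and positive.\<close>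
    define \<omega> where "\<omega> = cnj (B $ p $ q) / b"
    have b: "b > 0" using \<open>B $ p $ q \<noteq> 0\<close> by (simp add: b_def)
    have bb: "B $ p $ q * cnj (B $ p $ q) = of_real b * of_real b"
      unfolding complex_norm_square[symmetric] b_def by (simp add: power2_eq_square)
    have qp: "B $ q $ p = cnj (B $ p $ q)"
      using hermitian_nth[OF B_herm, of p q] by simp
    have om: "\<omega> * B $ p $ q = b" "cnj \<omega> * B $ q $ p = b" "cnj \<omega> * \<omega> = 1" "\<omega> * cnj \<omega> = 1"
      using b bb unfolding \<omega>_def qp
      by (simp_all add: divide_simps) (simp_all add: mult.commute)
    obtain c s where cs: "c\<^sup>2 + s\<^sup>2 = 1" "s\<^sup>2 * (Re (B $ q $ q) - Re (B $ p $ p)) + 2 * c * s * b > 0"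
      using exists_improving_angle[OF b] by blast
    have pq: "p \<noteq> q" using that by auto
    define r where "r j = (if j = p then of_real c *s axis p 1 + (of_real s * \<omega>) *s axis q 1
        else if j = q then (- of_real s * cnj \<omega>) *s axis p 1 + of_real c *s axis q 1
        else axis j 1 :: complex^'n)" for j
    define R where "R = (\<chi> i j. r j $ i)"
    have colR: "column j R = r j" for j by (simp add: column_def R_def vec_eq_iff)
    have ax: "axis p (1::complex) $ q = 0" "axis q (1::complex) $ p = 0"
      using pq by (auto simp: axis_def)
    have cs': "of_real c * of_real c + of_real s * of_real s = (1::complex)"
      using cs(1) by (metis of_real_1 of_real_add of_real_mult power2_eq_square)
    have rp: "r p = of_real c *s axis p 1 + (of_real s * \<omega>) *s axis q 1"
      and rq: "r q = (- of_real s * cnj \<omega>) *s axis p 1 + of_real c *s axis q 1"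
      and rj: "\<And>j. j \<noteq> p \<Longrightarrow> j \<noteq> q \<Longrightarrow> r j = axis j 1"
      using pq by (simp_all add: r_def)
    have RR: "ctranspose R ** R = mat 1"
    proof -
      have ax': "axis j (1::complex) $ i = (if i = j then 1 else 0)" for i j
        by (simp add: axis_def)
      note cinner_simps = cinner_diff_left cinner_diff_right cinner_add_left cinner_add_right cinner_smult_left cinner_smult_right cinner_axis_left
      have "cinner (r p) (r p) = of_real c * of_real c + of_real s * of_real s * (cnj \<omega> * \<omega>)"
        using pq by (simp add: rp cinner_simps ax')
      then have pp: "cinner (r p) (r p) = 1" by (simp only: om cs' mult_1_right)
      have "cinner (r q) (r q) = of_real c * of_real c + of_real s * of_real s * (\<omega> * cnj \<omega>)"
        using pq by (simp add: rq cinner_simps ax')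
      then have qq: "cinner (r q) (r q) = 1" by (simp only: om cs' mult_1_right)
      have p_q: "cinner (r p) (r q) = 0" "cinner (r q) (r p) = 0"
        using pq by (simp_all add: rp rq cinner_simps ax')
      have "cinner (r i) (r j) = (if i = j then 1 else 0)" for i j
      proof (cases "i = p \<or> i = q")
        case True
        show ?thesis
        proof (cases "j = p \<or> j = q")
          case False
          then have "cinner (r i) (r j) = 0" using True
            by (auto simp: rp rq rj cinner_simps ax')
          with True False show ?thesis by auto
        qed (use True pp qq p_q pq in auto)
      next
        case False
        show ?thesis
        proof (cases "j = p \<or> j = q")
          case True
          then have "cinner (r i) (r j) = 0" using False
            by (auto simp: rp rq rj cinner_simps ax')
          with True False show ?thesis by auto
        qed (use False in \<open>simp add: rj cinner_simps ax'\<close>)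
      qed
      then have "(ctranspose R ** mat 1 ** R) = mat 1"
        unfolding vec_eq_iff congruence_entry colR by simp (simp add: mat_def)
      then show ?thesis by simp
    qed
    define D where "D = ctranspose R ** B ** R"
    have D: "D $ i $ i = cinner (r i) (B *v r i)" for i
      unfolding D_def congruence_entry colR ..
    have Di: "D $ i $ i = B $ i $ i" if "i \<noteq> p" "i \<noteq> q" for i
      using that by (simp add: D rj cinner_axis_left matrix_vector_axis)
    let ?g = "s\<^sup>2 * (Re (B $ q $ q) - Re (B $ p $ p)) + 2 * c * s * b"
    have Dp: "Re (D $ p $ p) = Re (B $ p $ p) + ?g"
    proof -
      have "D $ p $ p = c * c * B$p$p + c * s *(\<omega> * B $ p $ q) + c * s *(cnj \<omega> * B $ q $ p) + s * s *(cnj \<omega> * \<omega>) * B$q$q"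
        unfolding D rp cinner_two_axes by (simp add: mult_ac)
      then have "Re (D $ p $ p) = c * c * Re (B$p$p) + 2*c * s *b + s * s *Re (B$q$q)"
        by (simp add: om)
      moreover have "c * c = 1 - s * s" using cs(1) by (simp add: power2_eq_square)
      ultimately show ?thesis by (simp add: algebra_simps power2_eq_square)
    qed
    have Dq: "Re (D $ q $ q) = Re (B $ q $ q) - ?g"
    proof -
      have "D $ q $ q = c * c * B$q$q - c * s *(\<omega> * B $ p $ q) - c * s *(cnj \<omega> * B $ q $ p) + s * s *(\<omega> * cnj \<omega>) * B$p$p"
        unfolding D rq cinner_two_axes by (simp add: mult_ac)
      then have "Re (D $ q $ q) = c * c * Re (B$q$q) - 2*c * s *b + s * s *Re (B$p$p)"
        by (simp add: om)
      moreover have "c * c = 1 - s * s" using cs(1) by (simp add: power2_eq_square)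
      ultimately show ?thesis by (simp add: algebra_simps power2_eq_square)
    qed
    have "obj (U ** R) - obj U = (\<Sum>i\<in>UNIV. w i * (Re (D $ i $ i) - Re (B $ i $ i)))"
      by (simp add: obj_def D_def B_def ctranspose_mult matrix_mul_assoc algebra_simps sum_subtractf)
    also have "\<dots> = (\<Sum>i\<in>{p,q}. w i * (Re (D $ i $ i) - Re (B $ i $ i)))"
      by (rule sum.mono_neutral_right) (auto simp: Di)
    also have "\<dots> = (w p - w q) * ?g" using pq by (simp add: Dp Dq algebra_simps)
    also have "\<dots> > 0" using that cs(2) by (intro mult_pos_pos) auto
    finally have "obj (U ** R) > obj U" by simp
    moreover have "ctranspose (U ** R) ** (U ** R) = ctranspose R ** (ctranspose U ** U) ** R"
      by (simp add: ctranspose_mult matrix_mul_assoc)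
    then have "ctranspose (U ** R) ** (U ** R) = mat 1" by (simp add: U RR)
    ultimately show False using max by fastforce
  qed
  have "B $ p $ q = 0" if "p \<noteq> q" for p q
    using that off[of p q] off[of q p] w[of p q] hermitian_nth[OF B_herm, of q p]
    by (metis complex_cnj_zero linorder_neqE)
  moreover have "B $ p $ p = of_real (Re (B $ p $ p))" for p
    using hermitian_nth[OF B_herm, of p p] by (metis Reals_cnj_iff of_real_Re)
  ultimately have "B = real_diag (\<lambda>i. Re (B $ i $ i))"
    by (auto simp: vec_eq_iff real_diag_def)
  moreover have "U ** B ** ctranspose U = (U ** ctranspose U) ** A ** (U ** ctranspose U)"
    by (simp add: B_def matrix_mul_assoc)
  ultimately show ?thesis
    using that[of U "\<lambda>i. Re (B $ i $ i)"] unitaryI[OF U] by (simp add: unitary_def)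
qed

section \<open>Functions of Hermitian matrices\<close>

abbreviation diagonalize :: "complex^'n^'n \<Rightarrow> ('n \<Rightarrow> real) \<Rightarrow> complex^'n^'n" where
  "diagonalize U l \<equiv> U ** real_diag l ** ctranspose U"

lemma real_diag_mult_left: "(real_diag l ** A) $ i $ j = of_real (l i) * A $ i $ j"
proof -
  have "(real_diag l ** A) $ i $ j = (\<Sum>k\<in>UNIV. if k = i then of_real (l i) * A $ i $ j else 0)"
    unfolding matrix_matrix_mult_def vec_lambda_beta real_diag_def by (intro sum.cong) auto
  then show ?thesis by simp
qed

lemma real_diag_mult_right: "(A ** real_diag l) $ i $ j = A $ i $ j * of_real (l j)"
proof -
  have "(A ** real_diag l) $ i $ j = (\<Sum>k\<in>UNIV. if k = j then A $ i $ j * of_real (l j) else 0)"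
    unfolding matrix_matrix_mult_def vec_lambda_beta real_diag_def by (intro sum.cong) auto
  then show ?thesis by simp
qed

lemma ctranspose_real_diag [simp]: "ctranspose (real_diag l) = real_diag l"
  by (auto simp: vec_eq_iff real_diag_def)

lemma unitary_cancel:
  assumes "unitary U"
  shows "ctranspose U ** U = mat 1" "U ** ctranspose U = mat 1"
    "ctranspose U ** (U ** A) = A" "U ** (ctranspose U ** A) = A"
    "A ** U ** ctranspose U = A" "A ** ctranspose U ** U = A"
  using assms by (simp_all add: unitary_def matrix_mul_assoc) (simp_all add: unitary_def flip: matrix_mul_assoc)

text \<open>Two eigenbases \<open>U\<close>, \<open>V\<close> of the same matrix are related by \<open>V\<^sup>* U\<close>, whose entries vanish unless the
  corresponding eigenvalues agree. It therefore intertwines the diagonal matrices of \<open>\<phi>\<close>-values as well, and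
  the choice made in the definition of a matrix function does not matter.\<close>

lemma mat_fun_diagonalize:
  assumes U: "unitary U"
  shows "mat_fun \<phi> (diagonalize U l) = diagonalize U (\<lambda>i. \<phi> (l i))"
proof -
  have uniq: "B = diagonalize U (\<lambda>i. \<phi> (l i))"
    if "\<exists>V m. unitary V \<and> diagonalize U l = diagonalize V m \<and> B = diagonalize V (\<lambda>i. \<phi> (m i))" for B
  proof -
    from that obtain V m where V: "unitary V" "diagonalize U l = diagonalize V m"
      and B: "B = diagonalize V (\<lambda>i. \<phi> (m i))" by auto
    define M where "M = ctranspose V ** U"
    have "M ** real_diag l = ctranspose V ** (diagonalize U l) ** U"
      using U by (simp add: M_def matrix_mul_assoc unitary_cancel)
    also have "\<dots> = ctranspose V ** (diagonalize V m) ** U"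
      by (simp only: V)
    also have "\<dots> = real_diag m ** M"
      using V(1) by (simp add: M_def matrix_mul_assoc unitary_cancel)
    finally have eq: "M ** real_diag l = real_diag m ** M" .
    have "M $ i $ j * of_real (l j) = of_real (m i) * M $ i $ j" for i j
      by (metis eq real_diag_mult_left real_diag_mult_right)
    then have "M $ i $ j = 0 \<or> l j = m i" for i j by (simp add: mult.commute)
    then have "M $ i $ j * of_real (\<phi> (l j)) = of_real (\<phi> (m i)) * M $ i $ j" for i j
      by (metis mult.commute mult_zero_left)
    then have "M ** real_diag (\<lambda>i. \<phi> (l i)) = real_diag (\<lambda>i. \<phi> (m i)) ** M"
      by (simp add: vec_eq_iff real_diag_mult_left real_diag_mult_right)
    then have "V ** (M ** real_diag (\<lambda>i. \<phi> (l i))) ** ctranspose U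
             = V ** (real_diag (\<lambda>i. \<phi> (m i)) ** M) ** ctranspose U" by simp
    then show ?thesis using U V(1) by (simp add: M_def B matrix_mul_assoc unitary_cancel)
  qed
  show ?thesis unfolding mat_fun_def
    by (rule some_equality) (use U uniq in blast)+
qed

lemma spectral_cases:
  assumes "hermitian A"
  obtains U l where "unitary U" "A = diagonalize U l" "\<And>\<phi>. mat_fun \<phi> A = diagonalize U (\<lambda>i. \<phi> (l i))"
proof -
  obtain U l where "unitary U" "A = diagonalize U l"
    using spectral_decomposition[OF assms] .
  then show ?thesis using that[of U l] by (simp add: mat_fun_diagonalize)
qed

lemma hermitian_diagonalize [simp]: "hermitian (diagonalize U l)"
  by (simp add: hermitian_def ctranspose_mult matrix_mul_assoc)

lemma diagonalize_mult:
  "unitary U \<Longrightarrow> diagonalize U l ** diagonalize U m = diagonalize U (\<lambda>i. l i * m i)"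
proof -
  assume U: "unitary U"
  have "real_diag l ** real_diag m = real_diag (\<lambda>i. l i * m i)"
    by (auto simp: vec_eq_iff real_diag_mult_left) (auto simp: real_diag_def)
  then show ?thesis using U
    by (simp add: matrix_mul_assoc unitary_cancel) (simp flip: matrix_mul_assoc)
qed

lemma mat_fun_mult: "hermitian A \<Longrightarrow> mat_fun \<phi> A ** mat_fun \<psi> A = mat_fun (\<lambda>x. \<phi> x * \<psi> x) A"
  by (erule spectral_cases[where A=A]) (simp add: diagonalize_mult)

lemma mat_fun_id: "hermitian A \<Longrightarrow> mat_fun (\<lambda>x. x) A = A"
  by (erule spectral_cases[where A=A]) simp

lemma mat_fun_const: "hermitian A \<Longrightarrow> mat_fun (\<lambda>x. a) A = a *\<^sub>R mat 1"
proof (erule spectral_cases[where A=A])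
  fix U l assume U: "unitary U" and m: "\<And>\<phi>. mat_fun \<phi> A = diagonalize U (\<lambda>i. \<phi> (l i))"
  have "real_diag (\<lambda>i. a) = a *\<^sub>R (mat 1 :: complex^'a^'a)"
    by (auto simp: vec_eq_iff real_diag_def mat_def) (simp add: scaleR_conv_of_real)
  then show ?thesis using U
    by (simp add: m matrix_mult.scaleR_left matrix_mult.scaleR_right unitary_cancel)
qed

lemma mat_fun_scale: "hermitian A \<Longrightarrow> mat_fun (\<lambda>x. k * \<phi> x) A = k *\<^sub>R mat_fun \<phi> A"
  using mat_fun_mult[of A "\<lambda>x. k" \<phi>] by (simp add: mat_fun_const matrix_mult.scaleR_left)

lemma trace_diagonalize: "unitary U \<Longrightarrow> Re (trace (diagonalize U l)) = (\<Sum>i\<in>UNIV. l i)"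
proof -
  assume U: "unitary U"
  have "trace (diagonalize U l) = trace (ctranspose U ** (U ** real_diag l))"
    by (rule trace_mul_sym)
  also have "\<dots> = trace (real_diag l :: complex^'a^'a)" using U by (simp add: unitary_cancel)
  finally show ?thesis by (simp add: trace_def real_diag_def)
qed

lemma tendsto_real_diag:
  assumes "\<And>i. ((\<lambda>n. l n i) \<longlongrightarrow> m i) F"
  shows "((\<lambda>n. real_diag (l n)) \<longlongrightarrow> real_diag m) F"
  unfolding real_diag_def by (intro tendsto_vec_lambda) (auto intro!: tendsto_of_real assms)

lemma tendsto_mat_fun:
  assumes "hermitian A" "\<And>x. ((\<lambda>n. \<phi> n x) \<longlongrightarrow> \<psi> x) F"
  shows "((\<lambda>n. mat_fun (\<phi> n) A) \<longlongrightarrow> mat_fun \<psi> A) F"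
proof -
  obtain U l where m: "\<And>\<phi>. mat_fun \<phi> A = diagonalize U (\<lambda>i. \<phi> (l i))"
    using spectral_cases[OF assms(1)] by metis
  show ?thesis unfolding m
    by (intro matrix_mult.tendsto tendsto_real_diag assms(2) tendsto_const)
qed

section \<open>Trace inequalities\<close>

lemma diag_self_product: "(X ** ctranspose X) $ i $ i = of_real (\<Sum>j\<in>UNIV. (norm (X $ i $ j))\<^sup>2)"
  by (simp add: matrix_matrix_mult_def flip: complex_norm_square)

lemma trace_form_diagonalize:
  "trace_form X (diagonalize U l) = (\<Sum>i\<in>UNIV. l i * Re ((ctranspose U ** X ** U) $ i $ i))"
proof -
  have "trace_form X (diagonalize U l) = trace_form (ctranspose U ** X ** U) (real_diag l)"
    by (metis matrix_mul_assoc trace_form_assoc trace_form_commute)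
  then show ?thesis
    by (simp add: trace_form_def trace_def real_diag_mult_right mult.commute)
qed

lemma trace_form_square_diagonalize:
  assumes "hermitian C" "unitary V"
  shows "trace_form (C ** C) (diagonalize U w)
    = (\<Sum>i\<in>UNIV. \<Sum>j\<in>UNIV. w i * (norm ((ctranspose U ** C ** V) $ i $ j))\<^sup>2)"
proof -
  have "ctranspose U ** (C ** C) ** U = (ctranspose U ** C ** V) ** ctranspose (ctranspose U ** C ** V)"
    using assms by (simp add: ctranspose_mult matrix_mul_assoc unitary_cancel hermitian_def)
  then show ?thesis
    by (simp add: trace_form_diagonalize diag_self_product sum_distrib_left)
qed

text \<open>Spectral form of the trace of a product: the squared overlaps of the two eigenbases act as weights on
  pairs of eigenvalues.\<close>

lemma trace_form_diagonalize_two: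
  "trace_form (diagonalize U a) (diagonalize V b)
    = (\<Sum>i\<in>UNIV. \<Sum>j\<in>UNIV. b i * a j * (norm ((ctranspose V ** U) $ i $ j))\<^sup>2)"
proof -
  let ?W = "ctranspose V ** U"
  have "ctranspose V ** diagonalize U a ** V = (?W ** real_diag a) ** ctranspose ?W"
    by (simp add: ctranspose_mult matrix_mul_assoc)
  moreover have "Re (((?W ** real_diag a) ** ctranspose ?W) $ i $ i)
      = (\<Sum>j\<in>UNIV. a j * (norm (?W $ i $ j))\<^sup>2)" for i
  proof -
    have "((?W ** real_diag a) ** ctranspose ?W) $ i $ i
        = (\<Sum>j\<in>UNIV. (?W ** real_diag a) $ i $ j * cnj (?W $ i $ j))"
      by (simp add: matrix_matrix_mult_def[of "?W ** real_diag a"])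
    also have "\<dots> = (\<Sum>j\<in>UNIV. of_real (a j * (norm (?W $ i $ j))\<^sup>2))"
      by (intro sum.cong) (simp_all add: real_diag_mult_right complex_norm_square del: of_real_power)
    finally show ?thesis by simp
  qed
  ultimately show ?thesis
    by (simp add: trace_form_diagonalize sum_distrib_left mult.assoc)
qed

text \<open>In the eigenbases \<open>U\<close> of \<open>A\<close> and \<open>V\<close> of \<open>B\<close>, passing from \<open>A - B\<close> to \<open>\<phi>(A) - \<phi>(B)\<close> multiplies the \<open>(i, j)\<close>
  entry \<open>(a\<^sub>i - b\<^sub>j) W\<^sub>i\<^sub>j\<close> by a divided difference of \<open>\<phi>\<close>. So the scalar hypothesis on \<open>\<phi>\<close> applies entry by entry, and
  the product with the entries of \<open>C\<close> is split by the arithmetic-geometric mean inequality.\<close>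

lemma trace_mean_value_inequality:
  fixes A B C :: "complex^'n^'n"
  assumes A: "hermitian A" and B: "hermitian B" and C: "hermitian C" and s: "s > 0"
    and \<psi>: "\<And>x. 0 \<le> \<psi> x"
    and \<phi>: "\<And>x y. \<bar>\<phi> x - \<phi> y\<bar> \<le> \<bar>x - y\<bar> * ((\<psi> x + \<psi> y) / 2)"
  shows "trace_form C (mat_fun \<phi> A - mat_fun \<phi> B)
    \<le> trace_form (s *\<^sub>R ((A - B) ** (A - B)) + (1/s) *\<^sub>R (C ** C)) (mat_fun \<psi> A + mat_fun \<psi> B) / 4"
proof -
  obtain U a where U: "unitary U" and Aeq: "A = diagonalize U a"
    and fA: "\<And>\<phi>. mat_fun \<phi> A = diagonalize U (\<lambda>i. \<phi> (a i))" using spectral_cases[OF A] by metis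
  obtain V b where V: "unitary V" and Beq: "B = diagonalize V b"
    and fB: "\<And>\<phi>. mat_fun \<phi> B = diagonalize V (\<lambda>i. \<phi> (b i))" using spectral_cases[OF B] by metis
  define W where "W = ctranspose U ** V"
  define X where "X = ctranspose U ** C ** V"
  define D where "D = ctranspose U ** (A - B) ** V"
  have intertwine: "(ctranspose U ** (diagonalize U l - diagonalize V m) ** V) $ i $ j
      = of_real (l i - m j) * W $ i $ j" for l m i j
  proof -
    have "ctranspose U ** (diagonalize U l - diagonalize V m) ** V = real_diag l ** W - W ** real_diag m"
      using U V by (simp add: matrix_mult.diff_left matrix_mult.diff_right W_def matrix_mul_assoc unitary_cancel)
    then show ?thesis
      by (simp only: vector_minus_component real_diag_mult_left real_diag_mult_right of_real_diff
          left_diff_distrib mult.commute[of "W $ i $ j"])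
  qed
  have D: "D $ i $ j = of_real (a i - b j) * W $ i $ j" for i j
    unfolding D_def using intertwine[of a b] by (simp only: Aeq Beq)
  have square: "trace_form (E ** E) (mat_fun \<psi> A + mat_fun \<psi> B)
      = (\<Sum>i\<in>UNIV. \<Sum>j\<in>UNIV. (\<psi> (a i) + \<psi> (b j)) * (norm ((ctranspose U ** E ** V) $ i $ j))\<^sup>2)"
    if E: "hermitian E" for E
  proof -
    have "norm ((ctranspose V ** E ** U) $ j $ i) = norm ((ctranspose U ** E ** V) $ i $ j)" for i j
    proof -
      have "ctranspose V ** E ** U = ctranspose (ctranspose U ** E ** V)"
        using E by (simp add: ctranspose_mult matrix_mul_assoc hermitian_def)
      then show ?thesis by simp
    qed
    then have "trace_form (E ** E) (mat_fun \<psi> B)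
      = (\<Sum>j\<in>UNIV. \<Sum>i\<in>UNIV. \<psi> (b j) * (norm ((ctranspose U ** E ** V) $ i $ j))\<^sup>2)"
      by (simp add: fB trace_form_square_diagonalize[OF E U])
    also have "\<dots> = (\<Sum>i\<in>UNIV. \<Sum>j\<in>UNIV. \<psi> (b j) * (norm ((ctranspose U ** E ** V) $ i $ j))\<^sup>2)"
      by (rule sum.swap)
    finally show ?thesis
      by (simp add: trace_form.add_right fA trace_form_square_diagonalize[OF E V] sum.distrib
          flip: sum.distrib add: distrib_right)
  qed
  define N where "N = ctranspose U ** (mat_fun \<phi> A - mat_fun \<phi> B) ** V"
  have N: "N $ i $ j = of_real (\<phi> (a i) - \<phi> (b j)) * W $ i $ j" for i j
    by (simp only: N_def fA fB intertwine)
  have "trace_form C (mat_fun \<phi> A - mat_fun \<phi> B) = Re (trace (ctranspose X ** N))"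
  proof -
    have "trace (ctranspose X ** N) = trace (ctranspose V ** (C ** (mat_fun \<phi> A - mat_fun \<phi> B) ** V))"
      using C U by (simp add: X_def N_def ctranspose_mult matrix_mul_assoc unitary_cancel hermitian_def)
    also have "\<dots> = trace (C ** (mat_fun \<phi> A - mat_fun \<phi> B) ** V ** ctranspose V)"
      by (rule trace_mul_sym)
    finally show ?thesis using V by (simp add: trace_form_def unitary_cancel)
  qed
  also have "\<dots> = (\<Sum>j\<in>UNIV. \<Sum>i\<in>UNIV. Re (cnj (X $ i $ j) * N $ i $ j))"
    by (simp add: trace_def matrix_matrix_mult_def)
  also have "\<dots> = (\<Sum>i\<in>UNIV. \<Sum>j\<in>UNIV. Re (cnj (X $ i $ j) * N $ i $ j))"
    by (rule sum.swap)
  also have "\<dots> \<le> (\<Sum>i\<in>UNIV. \<Sum>j\<in>UNIV. (\<psi> (a i) + \<psi> (b j)) *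
      (s * (norm (D $ i $ j))\<^sup>2 + (1/s) * (norm (X $ i $ j))\<^sup>2) / 4)"
  proof (intro sum_mono)
    fix i j
    have "Re (cnj (X $ i $ j) * N $ i $ j) \<le> norm (X $ i $ j) * norm (N $ i $ j)"
      by (metis complex_Re_le_cmod complex_mod_cnj norm_mult)
    also have "norm (N $ i $ j) = \<bar>\<phi> (a i) - \<phi> (b j)\<bar> * norm (W $ i $ j)"
      by (simp add: N norm_mult del: of_real_diff)
    also have "norm (X $ i $ j) * \<dots> \<le> norm (X $ i $ j) * ((\<bar>a i - b j\<bar> * ((\<psi> (a i) + \<psi> (b j)) / 2)) * norm (W $ i $ j))"
      by (intro mult_left_mono mult_right_mono \<phi>) auto
    also have "\<dots> = (\<psi> (a i) + \<psi> (b j)) / 2 * (norm (X $ i $ j) * norm (D $ i $ j))"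
      by (simp add: D norm_mult del: of_real_diff)
    also have "\<dots> \<le> (\<psi> (a i) + \<psi> (b j)) / 2 * ((s * (norm (D $ i $ j))\<^sup>2 + (1/s) * (norm (X $ i $ j))\<^sup>2) / 2)"
    proof (rule mult_left_mono)
      let ?x = "norm (X $ i $ j)" and ?d = "norm (D $ i $ j)"
      have "0 \<le> (s * ?d - ?x)\<^sup>2 / s" using s by simp
      also have "\<dots> = s * ?d\<^sup>2 + (1/s) * ?x\<^sup>2 - 2 * (?x * ?d)"
        using s by (simp add: field_simps power2_eq_square)
      finally show "?x * ?d \<le> (s * ?d\<^sup>2 + (1/s) * ?x\<^sup>2) / 2" by simp
    qed (use \<psi> in \<open>simp add: add_nonneg_nonneg\<close>)
    finally show "Re (cnj (X $ i $ j) * N $ i $ j) \<le> (\<psi> (a i) + \<psi> (b j)) *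
      (s * (norm (D $ i $ j))\<^sup>2 + (1/s) * (norm (X $ i $ j))\<^sup>2) / 4" by simp
  qed
  also have "\<dots> = trace_form (s *\<^sub>R ((A - B) ** (A - B)) + (1/s) *\<^sub>R (C ** C)) (mat_fun \<psi> A + mat_fun \<psi> B) / 4"
  proof -
    have AB: "hermitian (A - B)" using A B by (simp add: hermitian_def ctranspose_diff)
    show ?thesis
      unfolding trace_form.add_left trace_form.scaleR_left square[OF AB] square[OF C]
        D_def[symmetric] X_def[symmetric]
      by (simp add: sum_distrib_left sum_divide_distrib flip: sum.distrib)
         (simp add: algebra_simps)
  qed
  finally show ?thesis .
qed

section \<open>Positive semidefinite matrices\<close>

lemma quadratic_form_eq:
  "Re (\<Sum>i\<in>UNIV. \<Sum>j\<in>UNIV. cnj (x $ i) * A $ i $ j * x $ j) = Re (cinner x (A *v x))"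
  by (simp add: cinner_def matrix_vector_mult_def sum_distrib_left mult.assoc)

lemma linear_quadratic_form: "linear (\<lambda>A::complex^'n^'n. Re (cinner x (A *v x)))"
  unfolding quadratic_form_eq[symmetric]
  by (intro linearI)
     (simp_all add: sum.distrib algebra_simps sum_distrib_left)

lemma pos_semidef_iff: "pos_semidef A \<longleftrightarrow> hermitian A \<and> (\<forall>x. 0 \<le> Re (cinner x (A *v x)))"
  unfolding pos_semidef_def quadratic_form_eq ..

lemma eigenvalue_eq:
  assumes "unitary U"
  shows "diagonalize U l *v column i U = of_real (l i) *s column i U"
proof -
  have "diagonalize U l ** U = U ** real_diag l"
    using assms by (simp add: unitary_cancel)
  then have "column i (diagonalize U l ** U) = column i (U ** real_diag l)" by simp
  moreover have "column i (diagonalize U l ** U) = diagonalize U l *v column i U"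
    by (simp add: vec_eq_iff column_def matrix_matrix_mult_def[of _ U] matrix_vector_mult_def)
  moreover have "column i (U ** real_diag l) = of_real (l i) *s column i U"
    by (simp add: vec_eq_iff column_def real_diag_mult_right mult.commute)
  ultimately show ?thesis by simp
qed

lemma eigenvalue_nonneg:
  assumes "pos_semidef (diagonalize U l)" "unitary U"
  shows "0 \<le> l i"
proof -
  have "0 \<le> Re (cinner (column i U) (diagonalize U l *v column i U))"
    using assms by (simp add: pos_semidef_iff)
  also have "\<dots> = l i"
    using norm_column_unitary[of U i] assms(2)
    by (simp add: eigenvalue_eq cinner_smult_right cinner_self unitary_def)
  finally show ?thesis .
qed

lemma eigenvalue_le_op_norm:
  assumes "unitary U"
  shows "\<bar>l i\<bar> \<le> op_norm (diagonalize U l)"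
proof -
  have one: "norm (column i U) = 1"
    using norm_column_unitary[of U i] assms by (simp add: unitary_def)
  have "norm (diagonalize U l *v column i U) \<le> op_norm (diagonalize U l) * norm (column i U)"
    unfolding op_norm_def by (rule onorm[OF matrix_vector_mul_bounded_linear])
  moreover have "norm (complex_of_real (l i) *s column i U) = \<bar>l i\<bar>"
  proof -
    have "complex_of_real (l i) *s column i U = l i *\<^sub>R column i U"
      by (simp add: vec_eq_iff) (simp add: scaleR_conv_of_real)
    then show ?thesis using one by simp
  qed
  ultimately show ?thesis using assms one by (simp add: eigenvalue_eq)
qed

lemma cinner_adjoint: "cinner x (A *v y) = cinner (ctranspose A *v x) y"
proof -
  have "cinner x (A *v y) = (\<Sum>i\<in>UNIV. \<Sum>j\<in>UNIV. cnj (x $ i) * A $ i $ j * y $ j)"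
    by (simp add: cinner_def matrix_vector_mult_def sum_distrib_left mult.assoc)
  also have "\<dots> = (\<Sum>j\<in>UNIV. \<Sum>i\<in>UNIV. cnj (x $ i) * A $ i $ j * y $ j)"
    by (rule sum.swap)
  also have "\<dots> = cinner (ctranspose A *v x) y"
    by (simp add: cinner_def matrix_vector_mult_def sum_distrib_right sum_distrib_left mult_ac)
  finally show ?thesis .
qed

lemma pos_semidef_diagonalize:
  assumes "\<And>i. 0 \<le> l i"
  shows "pos_semidef (diagonalize U l)"
  unfolding pos_semidef_iff
proof safe
  fix x
  define y where "y = ctranspose U *v x"
  have "cinner x (diagonalize U l *v x) = cinner y (real_diag l *v y)"
    by (simp add: y_def cinner_adjoint flip: matrix_vector_mul_assoc)
  also have "\<dots> = (\<Sum>i\<in>UNIV. cnj (y $ i) * (of_real (l i) * y $ i))"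
  proof -
    have "(real_diag l *v y) $ i = of_real (l i) * y $ i" for i
    proof -
      have "(real_diag l *v y) $ i = (\<Sum>k\<in>UNIV. if k = i then of_real (l i) * y $ i else 0)"
        unfolding matrix_vector_mult_def vec_lambda_beta real_diag_def by (intro sum.cong) auto
      then show ?thesis by simp
    qed
    then show ?thesis by (simp add: cinner_def)
  qed
  also have "Re \<dots> = (\<Sum>i\<in>UNIV. l i * (norm (y $ i))\<^sup>2)"
    unfolding Re_sum
  proof (intro sum.cong refl)
    fix i
    have "cnj (y $ i) * (of_real (l i) * y $ i) = of_real (l i * (norm (y $ i))\<^sup>2)"
      by (simp add: complex_norm_square mult_ac del: of_real_power)
    then show "Re (cnj (y $ i) * (of_real (l i) * y $ i)) = l i * (norm (y $ i))\<^sup>2"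
      by (simp only: Re_complex_of_real)
  qed
  also have "\<dots> \<ge> 0" using assms by (intro sum_nonneg mult_nonneg_nonneg) auto
  finally show "0 \<le> Re (cinner x (diagonalize U l *v x))" .
qed (rule hermitian_diagonalize)

lemma pos_semidef_mat_fun:
  "hermitian A \<Longrightarrow> (\<And>x. 0 \<le> \<phi> x) \<Longrightarrow> pos_semidef (mat_fun \<phi> A)"
  by (erule spectral_cases[where A=A]) (simp add: pos_semidef_diagonalize)

lemma pos_semidef_hermitian: "pos_semidef A \<Longrightarrow> hermitian A"
  by (simp add: pos_semidef_iff)

lemma unitary_adjoint_mult:
  assumes "unitary U" "unitary V"
  shows "ctranspose (ctranspose V ** U) ** (ctranspose V ** U) = mat 1"
    "(ctranspose V ** U) ** ctranspose (ctranspose V ** U) = mat 1"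
  using assms by (simp_all add: ctranspose_mult matrix_mul_assoc unitary_cancel)

text \<open>Orthonormality of two eigenbases, in the form that lets a sum over pairs of eigenvalues collapse to a plain trace
  when the summand depends on one eigenvalue only.\<close>

lemma doubly_stochastic:
  assumes U: "unitary U" and V: "unitary V"
  shows "(\<Sum>j\<in>UNIV. (norm ((ctranspose V ** U) $ i $ j))\<^sup>2) = 1"
    "(\<Sum>i\<in>UNIV. (norm ((ctranspose V ** U) $ i $ j))\<^sup>2) = 1"
proof -
  let ?W = "ctranspose V ** U"
  have row: "(\<Sum>j\<in>UNIV. (norm (X $ i $ j))\<^sup>2) = 1" if "X ** ctranspose X = mat 1" for X :: "complex^'n^'n" and i
  proof -
    have "complex_of_real (\<Sum>j\<in>UNIV. (norm (X $ i $ j))\<^sup>2) = (X ** ctranspose X) $ i $ i"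
      by (rule diag_self_product[symmetric])
    also have "\<dots> = 1" unfolding that by (simp add: mat_def)
    finally show ?thesis by (simp only: of_real_eq_1_iff)
  qed
  show "(\<Sum>j\<in>UNIV. (norm (?W $ i $ j))\<^sup>2) = 1"
    by (rule row) (rule unitary_adjoint_mult[OF U V])
  have "(\<Sum>i\<in>UNIV. (norm (ctranspose ?W $ j $ i))\<^sup>2) = 1"
    by (rule row) (simp only: ctranspose_ctranspose unitary_adjoint_mult[OF U V])
  then show "(\<Sum>i\<in>UNIV. (norm (?W $ i $ j))\<^sup>2) = 1"
    by simp
qed

text \<open>A scalar inequality between a product and a sum of one-variable functions passes to traces: write
  \<open>tr (A g(B))\<close> with the overlap weights, apply the inequality to each pair of eigenvalues, and sum the
  weights out.\<close>

lemma trace_form_le_of_scalar: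
  fixes A B :: "complex^'n^'n"
  assumes A: "pos_semidef A" and B: "hermitian B"
    and le: "\<And>x y. 0 \<le> x \<Longrightarrow> x * g y \<le> \<alpha> x + \<beta> y"
  shows "trace_form A (mat_fun g B) \<le> Re (trace (mat_fun \<alpha> A)) + Re (trace (mat_fun \<beta> B))"
proof -
  obtain U a where U: "unitary U" and Aeq: "A = diagonalize U a"
    and fA: "\<And>\<phi>. mat_fun \<phi> A = diagonalize U (\<lambda>i. \<phi> (a i))"
    using spectral_cases[OF pos_semidef_hermitian[OF A]] by metis
  obtain V b where V: "unitary V"
    and fB: "\<And>\<phi>. mat_fun \<phi> B = diagonalize V (\<lambda>i. \<phi> (b i))" using spectral_cases[OF B] by metis
  have a: "0 \<le> a i" for i using A eigenvalue_nonneg U unfolding Aeq by blast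
  let ?w = "\<lambda>i j. (norm ((ctranspose V ** U) $ i $ j))\<^sup>2"
  have "trace_form A (mat_fun g B) = (\<Sum>i\<in>UNIV. \<Sum>j\<in>UNIV. g (b i) * a j * ?w i j)"
    by (simp only: Aeq fB trace_form_diagonalize_two)
  also have "\<dots> \<le> (\<Sum>i\<in>UNIV. \<Sum>j\<in>UNIV. (\<alpha> (a j) + \<beta> (b i)) * ?w i j)"
    using le[OF a] by (intro sum_mono mult_right_mono) (simp_all add: mult.commute)
  also have "\<dots> = (\<Sum>i\<in>UNIV. \<Sum>j\<in>UNIV. \<alpha> (a j) * ?w i j) + (\<Sum>i\<in>UNIV. \<beta> (b i) * (\<Sum>j\<in>UNIV. ?w i j))"
    by (simp only: distrib_right sum.distrib sum_distrib_left)
  also have "(\<Sum>i\<in>UNIV. \<Sum>j\<in>UNIV. \<alpha> (a j) * ?w i j) = (\<Sum>j\<in>UNIV. \<alpha> (a j) * (\<Sum>i\<in>UNIV. ?w i j))"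
    by (subst sum.swap) (simp only: sum_distrib_left)
  finally show ?thesis
    by (simp only: doubly_stochastic[OF U V] fA fB trace_diagonalize[OF U] trace_diagonalize[OF V] mult_1_right)
qed

lemma trace_form_nonneg:
  assumes "pos_semidef A" "pos_semidef B"
  shows "0 \<le> trace_form A B"
proof -
  obtain U a where U: "unitary U" and Aeq: "A = diagonalize U a"
    using spectral_cases[OF pos_semidef_hermitian[OF assms(1)]] by metis
  obtain V b where V: "unitary V" and Beq: "B = diagonalize V b"
    using spectral_cases[OF pos_semidef_hermitian[OF assms(2)]] by metis
  have "0 \<le> a i" "0 \<le> b i" for i
    using assms eigenvalue_nonneg U V unfolding Aeq Beq by blast+
  then show ?thesis
    unfolding Aeq Beq trace_form_diagonalize_two by (intro sum_nonneg mult_nonneg_nonneg) auto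
qed

lemma norm_diagonalize:
  assumes U: "unitary U"
  shows "(norm (diagonalize U l))\<^sup>2 = (\<Sum>i\<in>UNIV. (l i)\<^sup>2)"
proof -
  let ?A = "diagonalize U l"
  have "(norm ?A)\<^sup>2 = (\<Sum>i\<in>UNIV. \<Sum>j\<in>UNIV. (norm (?A $ i $ j))\<^sup>2)"
    by (simp only: norm_vec_def L2_set_def real_sqrt_pow2 sum_nonneg zero_le_power2)
  also have "\<dots> = Re (trace (?A ** ctranspose ?A))"
    by (simp only: trace_def diag_self_product Re_sum Re_complex_of_real)
  also have "ctranspose ?A = ?A" using hermitian_diagonalize by (simp add: hermitian_def)
  also have "Re (trace (?A ** ?A)) = (\<Sum>i\<in>UNIV. (l i)\<^sup>2)"
    using U by (simp only: diagonalize_mult trace_diagonalize power2_eq_square)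
  finally show ?thesis .
qed

lemma norm_mat_fun_le:
  fixes A :: "complex^'n^'n"
  assumes "hermitian A" and le: "\<And>x. \<bar>x\<bar> \<le> norm A \<Longrightarrow> \<bar>\<phi> x\<bar> \<le> b"
  shows "norm (mat_fun \<phi> A) \<le> real CARD('n) * b"
proof -
  obtain U l where U: "unitary U" "A = diagonalize U l" and f: "mat_fun \<phi> A = diagonalize U (\<lambda>i. \<phi> (l i))"
    using spectral_cases[OF assms(1)] by metis
  have "\<bar>l i\<bar> \<le> norm A" for i
  proof -
    have "(l i)\<^sup>2 \<le> (\<Sum>i\<in>UNIV. (l i)\<^sup>2)" by (rule member_le_sum) auto
    then have "\<bar>l i\<bar>\<^sup>2 \<le> (norm A)\<^sup>2" using norm_diagonalize[OF U(1), of l] U(2) by simp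
    then show ?thesis by (rule power2_le_imp_le) simp
  qed
  then have b: "\<bar>\<phi> (l i)\<bar> \<le> b" for i using le by blast
  then have b0: "0 \<le> b" using abs_ge_zero order_trans by blast
  have "(norm (mat_fun \<phi> A))\<^sup>2 = (\<Sum>i\<in>UNIV. (\<phi> (l i))\<^sup>2)"
    by (simp only: f norm_diagonalize[OF U(1)])
  also have "\<dots> \<le> (\<Sum>i\<in>(UNIV::'n set). b\<^sup>2)"
    using b by (intro sum_mono) (meson abs_le_square_iff order_trans abs_ge_self b0 abs_of_nonneg)
  also have "\<dots> \<le> (real CARD('n) * b)\<^sup>2"
  proof -
    have "1 \<le> real CARD('n)" by (simp add: Suc_leI)
    then have "real CARD('n) \<le> (real CARD('n))\<^sup>2" by (simp add: power2_eq_square)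
    then show ?thesis by (simp add: power_mult_distrib mult_right_mono)
  qed
  finally show ?thesis using b0 by (auto intro: power2_le_imp_le)
qed

lemma trace_powr_le_op_norm:
  fixes A :: "complex^'n^'n"
  assumes "pos_semidef A" "0 \<le> q"
  shows "Re (trace (mat_fun (\<lambda>x. x powr q) A)) \<le> real CARD('n) * op_norm A powr q"
proof -
  obtain U l where U: "unitary U" and A: "A = diagonalize U l"
    and f: "\<And>\<phi>. mat_fun \<phi> A = diagonalize U (\<lambda>i. \<phi> (l i))"
    using spectral_cases[OF pos_semidef_hermitian[OF assms(1)]] by metis
  have "0 \<le> l i" for i using assms eigenvalue_nonneg U unfolding A by blast
  then have "l i powr q \<le> op_norm A powr q" for i
    using eigenvalue_le_op_norm[OF U, of l i] assms(2) unfolding A by (intro powr_mono2) auto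
  then have "(\<Sum>i\<in>UNIV. l i powr q) \<le> (\<Sum>i\<in>(UNIV::'n set). op_norm A powr q)"
    by (intro sum_mono)
  then show ?thesis by (simp add: f trace_diagonalize[OF U])
qed

lemma trace_mat_fun_nonneg:
  assumes "hermitian A" "\<And>x. 0 \<le> \<phi> x"
  shows "0 \<le> Re (trace (mat_fun \<phi> A))"
proof (rule spectral_cases[OF assms(1)])
  fix U l assume "unitary U" "\<And>\<phi>. mat_fun \<phi> A = diagonalize U (\<lambda>i. \<phi> (l i))"
  then show ?thesis using assms(2) by (simp add: trace_diagonalize sum_nonneg)
qed

lemma mat_fun_cong_nonneg:
  assumes "pos_semidef A" "\<And>x. 0 \<le> x \<Longrightarrow> \<phi> x = \<psi> x"
  shows "mat_fun \<phi> A = mat_fun \<psi> A"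
proof -
  obtain U l where U: "unitary U" and A: "A = diagonalize U l"
    and f: "\<And>\<phi>. mat_fun \<phi> A = diagonalize U (\<lambda>i. \<phi> (l i))"
    using spectral_cases[OF pos_semidef_hermitian[OF assms(1)]] by metis
  have "0 \<le> l i" for i using assms eigenvalue_nonneg U unfolding A by blast
  then show ?thesis by (simp add: f assms(2))
qed

section \<open>Smooth approximation of monotone functions\<close>

text \<open>A source of smooth functions all of whose derivatives are bounded: the class is closed under
  differentiation and consists of bounded functions.\<close>

inductive trig_poly :: "(real \<Rightarrow> real) \<Rightarrow> bool" where
  trig_const: "trig_poly (\<lambda>x. a)"
| trig_sin: "trig_poly (\<lambda>x. sin (k * x))"
| trig_cos: "trig_poly (\<lambda>x. cos (k * x))"
| trig_add: "trig_poly f \<Longrightarrow> trig_poly g \<Longrightarrow> trig_poly (\<lambda>x. f x + g x)"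
| trig_mult: "trig_poly f \<Longrightarrow> trig_poly g \<Longrightarrow> trig_poly (\<lambda>x. f x * g x)"

lemma trig_poly_deriv:
  "trig_poly f \<Longrightarrow> \<exists>f'. trig_poly f' \<and> (\<forall>x. (f has_field_derivative f' x) (at x))"
proof (induction rule: trig_poly.induct)
  case (trig_const a)
  show ?case by (rule exI[of _ "\<lambda>x. 0"]) (auto intro: trig_poly.intros)
next
  case (trig_sin k)
  show ?case
    by (rule exI[of _ "\<lambda>x. k * cos (k * x)"]) (auto intro!: trig_poly.intros derivative_eq_intros)
next
  case (trig_cos k)
  have "trig_poly (\<lambda>x. (- k) * sin (k * x))" by (intro trig_poly.intros)
  moreover have "((\<lambda>x. cos (k * x)) has_field_derivative (- k) * sin (k * x)) (at x)" for x
    by (auto intro!: derivative_eq_intros)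
  ultimately show ?case by blast
next
  case (trig_add f g)
  then obtain f' g' where "trig_poly f'" "trig_poly g'" "\<forall>x. (f has_field_derivative f' x) (at x)"
    "\<forall>x. (g has_field_derivative g' x) (at x)" by blast
  then show ?case
    by (intro exI[of _ "\<lambda>x. f' x + g' x"]) (auto intro!: trig_poly.intros derivative_eq_intros)
next
  case (trig_mult f g)
  then obtain f' g' where "trig_poly f'" "trig_poly g'" "\<forall>x. (f has_field_derivative f' x) (at x)"
    "\<forall>x. (g has_field_derivative g' x) (at x)" by blast
  then show ?case using trig_mult.hyps
    by (intro exI[of _ "\<lambda>x. f' x * g x + g' x * f x"]) (auto intro!: trig_poly.intros DERIV_mult)
qed

lemma trig_poly_bounded: "trig_poly f \<Longrightarrow> \<exists>b. \<forall>x. \<bar>f x\<bar> \<le> b"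
proof (induction rule: trig_poly.induct)
  case (trig_add f g)
  then obtain a b where "\<forall>x. \<bar>f x\<bar> \<le> a" "\<forall>x. \<bar>g x\<bar> \<le> b" by blast
  then show ?case by (intro exI[of _ "a + b"]) (metis abs_triangle_ineq add_mono order_trans)
next
  case (trig_mult f g)
  then obtain a b where "\<forall>x. \<bar>f x\<bar> \<le> a" "\<forall>x. \<bar>g x\<bar> \<le> b" by blast
  then show ?case
    by (intro exI[of _ "a * b"]) (metis abs_ge_zero abs_mult mult_mono order_trans)
qed (auto intro: exI[of _ 1])

lemma smooth_bounded_derivs_trig_poly: "trig_poly f \<Longrightarrow> smooth_bounded_derivs f"
proof -
  assume f: "trig_poly f"
  have step: "trig_poly (deriv g)" if "trig_poly g" for g
    using trig_poly_deriv[OF that] DERIV_imp_deriv by (metis ext)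
  have iter: "trig_poly ((deriv ^^ n) f)" for n
    by (induction n) (auto simp: f step)
  show ?thesis unfolding smooth_bounded_derivs_def
  proof safe
    fix n x
    show "(deriv ^^ n) f field_differentiable at x"
      using trig_poly_deriv[OF iter] field_differentiable_def by blast
    show "bounded (range ((deriv ^^ n) f))"
      using trig_poly_bounded[OF iter] by (auto simp: bounded_iff)
  qed
qed

lemma trig_poly_polynomial_cos:
  "real_polynomial_function p \<Longrightarrow> trig_poly (\<lambda>x. p (cos (k * x)))"
proof (induction rule: real_polynomial_function.induct)
  case (linear f)
  have "f y = f 1 * y" for y
    using linear_cmul[OF bounded_linear.linear[OF linear], of y 1]
    by (simp only: real_scaleR_def mult_1_right mult.commute[of y])
  then have "(\<lambda>x. f (cos (k * x))) = (\<lambda>x. f 1 * cos (k * x))" by (intro ext)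
  moreover have "trig_poly (\<lambda>x. f 1 * cos (k * x))" by (intro trig_poly.intros)
  ultimately show ?case by simp
qed (auto intro: trig_poly.intros)

text \<open>The function \<open>x \<mapsto> N arccos (cos (x/N))\<close> is a sawtooth that agrees with \<open>|x|\<close> on \<open>[- \<pi> N, \<pi> N]\<close> and never exceeds
  it. Since \<open>g (N arccos y)\<close> is continuous on \<open>[-1, 1]\<close>, the Weierstrass theorem replaces it by a polynomial in
  \<open>y = cos (x/N)\<close>, a trigonometric polynomial in \<open>x\<close>. Monotonicity of \<open>g\<close> gives a bound uniform in \<open>N\<close>.\<close>

lemma smooth_approximation:
  fixes g :: "real \<Rightarrow> real"
  assumes cont: "continuous_on {0..} g" and mono: "mono_on {0..} g" and g0: "0 \<le> g 0"
  obtains \<phi> :: "nat \<Rightarrow> real \<Rightarrow> real" where "\<And>n. smooth_bounded_derivs (\<phi> n)" "\<And>n x. 0 \<le> \<phi> n x"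
    "\<And>n x. \<phi> n x \<le> g \<bar>x\<bar> + 2" "\<And>x. (\<lambda>n. \<phi> n x) \<longlonglongrightarrow> g \<bar>x\<bar>"
proof -
  have "\<exists>p. real_polynomial_function p \<and>
     (\<forall>y\<in>{-1..1}. \<bar>g (real (Suc n) * arccos y) - p y\<bar> < 1 / Suc n)" for n
  proof -
    have "continuous_on {-1..1} (\<lambda>y. g (real (Suc n) * arccos y))"
      by (rule continuous_on_compose2[OF cont])
         (auto intro!: continuous_intros continuous_on_arccos arccos_lbound mult_nonneg_nonneg)
    then show ?thesis
      using Stone_Weierstrass_real_polynomial_function[of "{-1..1::real}" "\<lambda>y. g (real (Suc n) * arccos y)" "1 / Suc n"]
      by (metis compact_Icc of_nat_0_less_iff zero_less_Suc zero_less_divide_1_iff)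
  qed
  then obtain p where p: "\<And>n. real_polynomial_function (p n)"
    and close: "\<And>n y. y \<in> {-1..1} \<Longrightarrow> \<bar>g (real (Suc n) * arccos y) - p n y\<bar> < 1 / Suc n"
    by metis
  define \<theta> where "\<theta> n x = real (Suc n) * arccos (cos (x / Suc n))" for n x
  \<comment> \<open>Adding the approximation error keeps the approximants nonnegative.\<close>
  define \<phi> where "\<phi> n x = p n (cos ((1 / Suc n) * x)) + 1 / Suc n" for n x
  have \<theta>: "0 \<le> \<theta> n x" "\<theta> n x \<le> \<bar>x\<bar>" "\<bar>x\<bar> \<le> pi * Suc n \<Longrightarrow> \<theta> n x = \<bar>x\<bar>" for n x
  proof -
    show "0 \<le> \<theta> n x" unfolding \<theta>_def by (intro mult_nonneg_nonneg arccos_lbound) auto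
    show eq: "\<theta> n x = \<bar>x\<bar>" if "\<bar>x\<bar> \<le> pi * Suc n"
    proof -
      have "\<bar>x / Suc n\<bar> \<le> pi" using that by (simp add: field_simps)
      then show ?thesis unfolding \<theta>_def by (simp only: arccos_cos_eq_abs) simp
    qed
    show "\<theta> n x \<le> \<bar>x\<bar>"
    proof (cases "\<bar>x\<bar> \<le> pi * Suc n")
      case False
      have "\<theta> n x \<le> real (Suc n) * pi" unfolding \<theta>_def by (intro mult_left_mono arccos_ubound) auto
      then show ?thesis using False by (simp add: mult.commute)
    qed (use eq in simp)
  qed
  have g_mono: "g a \<le> g b" if "0 \<le> a" "a \<le> b" for a b
    using mono that by (auto simp: mono_on_def)
  have \<phi>: "\<bar>\<phi> n x - g (\<theta> n x) - 1 / Suc n\<bar> < 1 / Suc n" for n x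
    using close[of "cos (x / Suc n)" n] by (simp add: \<phi>_def \<theta>_def abs_minus_commute)
  show ?thesis
  proof (rule that[of \<phi>])
    fix n x
    have "trig_poly (\<phi> n)" unfolding \<phi>_def
      by (intro trig_poly.intros trig_poly_polynomial_cos p)
    then show "smooth_bounded_derivs (\<phi> n)" by (rule smooth_bounded_derivs_trig_poly)
    have "0 \<le> g (\<theta> n x)" using g0 g_mono[of 0 "\<theta> n x"] \<theta>(1) by fastforce
    then show "0 \<le> \<phi> n x" using \<phi>[of n x] by linarith
    have "1 / real (Suc n) \<le> 1" by simp
    moreover have "g (\<theta> n x) \<le> g \<bar>x\<bar>" by (intro g_mono \<theta>)
    ultimately show "\<phi> n x \<le> g \<bar>x\<bar> + 2" using \<phi>[of n x] by linarith
  next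
    fix x
    obtain m where m: "\<bar>x\<bar> \<le> real m" using real_arch_simple by blast
    have *: "eventually (\<lambda>n. norm (\<phi> n x - g \<bar>x\<bar>) \<le> 2 * (1 / Suc n)) sequentially"
      unfolding eventually_sequentially real_norm_def
    proof (intro exI allI impI)
      fix n assume "m \<le> n"
      have "real m \<le> 1 * real (Suc n)" using \<open>m \<le> n\<close> by simp
      also have "\<dots> \<le> pi * real (Suc n)" using pi_gt3 by (intro mult_right_mono) auto
      finally have "\<theta> n x = \<bar>x\<bar>" using m by (intro \<theta>) auto
      then show "\<bar>\<phi> n x - g \<bar>x\<bar>\<bar> \<le> 2 * (1 / Suc n)" using \<phi>[of n x] by auto
    qed
    have "(\<lambda>n. 2 * (1 / real (Suc n))) \<longlonglongrightarrow> 0"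
      using tendsto_mult[OF tendsto_const[of 2] LIMSEQ_inverse_real_of_nat] by (simp add: inverse_eq_divide)
    from Lim_null_comparison[OF * this] show "(\<lambda>n. \<phi> n x) \<longlonglongrightarrow> g \<bar>x\<bar>"
      by (simp only: LIM_zero_iff)
  qed
qed

section \<open>A mean value inequality for signed powers\<close>

lemma powr_tangent:
  fixes x b r :: real
  assumes "1 \<le> r" "0 < x" "0 < b"
  shows "x powr r + r * x powr (r - 1) * (b - x) \<le> b powr r"
proof -
  have "connected {0::real<..}" "x \<in> interior {0<..}" "b \<in> {0<..}"
    using assms by (auto simp: interior_open convex_connected)
  moreover have "((\<lambda>x. x powr r) has_field_derivative r * x powr (r - 1)) (at x within {0<..})"
    using assms by (auto intro!: derivative_eq_intros)
  ultimately have "b powr r - x powr r \<ge> (r * x powr (r - 1)) * (b - x)"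
    by (intro convex_on_imp_above_tangent[OF powr_convex[OF assms(1)]])
  then show ?thesis by simp
qed

text \<open>The trapezoidal rule overestimates the integral of the convex function \<open>(r + 1) x\<^sup>r\<close>. As a function of the
  right end point, the error has a nonnegative derivative by the tangent inequality.\<close>

lemma powr_Suc_diff_le:
  fixes a b r :: real
  assumes r: "1 \<le> r" and ab: "0 \<le> b" "b \<le> a"
  shows "a * a powr r - b * b powr r \<le> (a - b) * ((r + 1) * ((a powr r + b powr r) / 2))"
proof (cases "b = 0")
  case True
  have "1 * (a * a powr r) \<le> ((r + 1) / 2) * (a * a powr r)"
    using r ab by (intro mult_right_mono) auto
  then show ?thesis using True by (simp add: algebra_simps)
next
  case False
  then have b: "0 < b" using ab by simp
  define h where "h x = (x - b) * ((r + 1) * ((x powr r + b powr r) / 2)) - x * x powr r" for x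
  define h' where "h' x = (r + 1) * ((x powr r + b powr r) / 2)
     + (x - b) * ((r + 1) * (r * x powr (r - 1) / 2)) - (x powr r + x * (r * x powr (r - 1)))" for x
  have "h b \<le> h a"
  proof (rule DERIV_nonneg_imp_nondecreasing[OF ab(2)])
    fix x assume x: "b \<le> x" "x \<le> a"
    then have x0: "0 < x" using b by simp
    have "(h has_real_derivative h' x) (at x)"
      unfolding h_def h'_def using x0 by (auto intro!: derivative_eq_intros)
    moreover have "0 \<le> h' x"
    proof -
      have xx: "x * x powr (r - 1) = x powr r" using x0 by (simp add: powr_diff)
      have "h' x = (r + 1) / 2 * (b powr r - (x powr r + r * x powr (r - 1) * (b - x)))"
        unfolding h'_def xx[symmetric] by (simp add: field_simps)
      also have "\<dots> \<ge> 0" using powr_tangent[OF r x0 b] r by (intro mult_nonneg_nonneg) auto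
      finally show ?thesis .
    qed
    ultimately show "\<exists>y. (h has_real_derivative y) (at x) \<and> 0 \<le> y" by blast
  qed
  then show ?thesis by (simp add: h_def)
qed

text \<open>For \<open>r \<ge> 1\<close>, arguments of equal sign are covered by the trapezoidal estimate, and for opposite signs a cruder
  bound suffices. The exponent \<open>r = 0\<close> is represented by the constant 1 because \<open>0 powr 0 = 0\<close>.\<close>

lemma signed_powr_diff_le:
  fixes x y r :: real
  assumes "r = 0 \<and> g = (\<lambda>_. 1) \<or> 1 \<le> r \<and> g = (\<lambda>x. \<bar>x\<bar> powr r)"
  shows "\<bar>x * g x - y * g y\<bar> \<le> \<bar>x - y\<bar> * (((r + 1) * g x + (r + 1) * g y) / 2)"
proof (cases "r = 0")
  case True
  then show ?thesis using assms by auto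
next
  case False
  then have r: "1 \<le> r" and g: "g = (\<lambda>x. \<bar>x\<bar> powr r)" using assms by auto
  have main: "\<bar>x * g x - y * g y\<bar> \<le> \<bar>x - y\<bar> * ((r + 1) * ((g x + g y) / 2))" if "\<bar>y\<bar> \<le> x" for x y
  proof (cases "0 \<le> y")
    case True
    then have "y * y powr r \<le> x * x powr r" using that r by (intro mult_mono powr_mono2) auto
    then show ?thesis using powr_Suc_diff_le[OF r True, of x] that True by (simp add: g)
  next
    case False
    define z where "z = - y"
    have z: "0 < z" "z \<le> x" using False that by (auto simp: z_def)
    have "x * x powr r + z * z powr r \<le> (x + z) * (x powr r + z powr r)"
      using z by (simp add: algebra_simps)
    also have "\<dots> \<le> (x + z) * ((r + 1) * ((x powr r + z powr r) / 2))"
    proof (rule mult_left_mono)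
      have "1 * (x powr r + z powr r) \<le> ((r + 1) / 2) * (x powr r + z powr r)"
        using r by (intro mult_right_mono) auto
      then show "x powr r + z powr r \<le> (r + 1) * ((x powr r + z powr r) / 2)" by simp
    qed (use z in auto)
    finally have "x * x powr r + z * z powr r \<le> (x + z) * ((r + 1) * ((x powr r + z powr r) / 2))" .
    moreover have "0 \<le> x * x powr r + z * z powr r" using z by simp
    moreover have "y = - z" by (simp add: z_def)
    ultimately show ?thesis using z by (simp add: g)
  qed
  have neg: "g (- x) = g x" for x by (simp add: g)
  consider "\<bar>y\<bar> \<le> x" | "\<bar>y\<bar> \<le> - x" | "\<bar>x\<bar> \<le> y" | "\<bar>x\<bar> \<le> - y" by linarith
  then have "\<bar>x * g x - y * g y\<bar> \<le> \<bar>x - y\<bar> * ((r + 1) * ((g x + g y) / 2))"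
  proof cases
    case 1 then show ?thesis by (rule main)
  next
    case 2
    then show ?thesis using main[of "- y" "- x"] by (simp add: neg abs_minus_commute)
  next
    case 3
    then show ?thesis using main[of x y] by (simp add: abs_minus_commute add.commute)
  next
    case 4
    then show ?thesis using main[of "- x" "- y"] by (simp add: neg abs_minus_commute add.commute)
  qed
  then show ?thesis by (simp add: algebra_simps)
qed

section \<open>The semigroup on dominated functions\<close>

text \<open>Functions such as \<open>|f|\<^sup>r\<close> for real \<open>r\<close> may fail to be suitable, but they are dominated by suitable functions.
  Products of dominated functions are dominated again, so dominated functions have moments of all orders.\<close>

definition dominated :: "('a::topological_space \<Rightarrow> real) set \<Rightarrow> ('a \<Rightarrow> 'b::euclidean_space) \<Rightarrow> bool" where
  "dominated S F \<longleftrightarrow> F \<in> borel_measurable borel \<and> (\<exists>s\<in>S. \<forall>z. norm (F z) \<le> s z)"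

text \<open>The vector-valued counterpart of suitability, without a Hermitian condition: products of Hermitian matrices
  need not be Hermitian, and the generator is applied to them.\<close>

definition components_in :: "('a \<Rightarrow> real) set \<Rightarrow> ('a \<Rightarrow> 'b::euclidean_space) \<Rightarrow> bool" where
  "components_in S F \<longleftrightarrow> (\<forall>b\<in>Basis. (\<lambda>z. F z \<bullet> b) \<in> S)"

context suitable_functions
begin

abbreviation P :: "real \<Rightarrow> ('a \<Rightarrow> 'b::{banach, second_countable_topology}) \<Rightarrow> 'a \<Rightarrow> 'b" where
  "P t F \<equiv> semigroup_op W Z t F"

abbreviation L :: "('a \<Rightarrow> 'b::{banach, second_countable_topology}) \<Rightarrow> 'a \<Rightarrow> 'b" where
  "L F \<equiv> generator W Z F"

sublocale mu: prob_space \<mu> by (rule prob_mu)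

lemma sets_mu_cong [measurable_cong]: "sets \<mu> = sets borel" by (rule sets_mu)

lemma measurable_mu: "F \<in> borel_measurable borel \<Longrightarrow> F \<in> borel_measurable \<mu>"
  by simp

lemma suitable_scale: "f \<in> S \<Longrightarrow> (\<lambda>z. a * f z) \<in> S"
  using suitable_mult[OF suitable_const] by simp

lemma suitable_diff: "f \<in> S \<Longrightarrow> g \<in> S \<Longrightarrow> (\<lambda>z. f z - g z) \<in> S"
  using suitable_add[of f "\<lambda>z. (-1) * g z"] suitable_scale[of g "-1"] by simp

lemma suitable_sum: "(\<And>i. i \<in> I \<Longrightarrow> f i \<in> S) \<Longrightarrow> (\<lambda>z. \<Sum>i\<in>I. f i z) \<in> S"
proof (induction I rule: infinite_finite_induct)
  case (insert x F)
  then show ?case using suitable_add[of "f x" "\<lambda>z. \<Sum>i\<in>F. f i z"] by simp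
qed (simp_all add: suitable_const)

lemma dominatedI:
  "F \<in> borel_measurable borel \<Longrightarrow> s \<in> S \<Longrightarrow> (\<And>z. norm (F z) \<le> s z) \<Longrightarrow> dominated S F"
  by (auto simp: dominated_def)

lemma dominated_measurable [measurable_dest]: "dominated S F \<Longrightarrow> F \<in> borel_measurable borel"
  by (simp add: dominated_def)

lemma dominated_mono:
  assumes "dominated S G" "F \<in> borel_measurable borel" "\<And>z. norm (F z) \<le> norm (G z)"
  shows "dominated S F"
  using assms unfolding dominated_def by (meson order_trans)

lemma dominated_const: "dominated S (\<lambda>z. a)"
  by (rule dominatedI[OF _ suitable_const[of "norm a"]]) auto

lemma dominated_norm: "dominated S F \<Longrightarrow> dominated S (\<lambda>z. norm (F z))"
  by (rule dominated_mono) auto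

lemma dominated_add: "dominated S F \<Longrightarrow> dominated S G \<Longrightarrow> dominated S (\<lambda>z. F z + G z)"
proof -
  assume F: "dominated S F" and G: "dominated S G"
  then obtain s t where "s \<in> S" "t \<in> S" "\<And>z. norm (F z) \<le> s z" "\<And>z. norm (G z) \<le> t z"
    unfolding dominated_def by metis
  then show ?thesis using F G
    by (intro dominatedI[OF _ suitable_add[of s t]]) (auto intro: norm_triangle_mono)
qed

lemma dominated_bounded_linear:
  assumes T: "bounded_linear T" and F: "dominated S F"
  shows "dominated S (\<lambda>z. T (F z))"
proof -
  obtain s where s: "s \<in> S" "\<And>z. norm (F z) \<le> s z" using F by (auto simp: dominated_def)
  obtain K where K: "K \<ge> 0" "\<And>x. norm (T x) \<le> norm x * K" using bounded_linear.nonneg_bounded[OF T] by metis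
  have "norm (T (F z)) \<le> K * s z" for z
    using K(2)[of "F z"] mult_left_mono[OF s(2)[of z] K(1)] by (simp add: mult.commute)
  moreover have "(\<lambda>z. T (F z)) \<in> borel_measurable borel"
    using F borel_measurable_continuous_onI[OF linear_continuous_on[OF T]] by measurable
  ultimately show ?thesis by (intro dominatedI[OF _ suitable_scale[OF s(1)]])
qed

lemma dominated_bounded_bilinear:
  assumes B: "bounded_bilinear B" and F: "dominated S F" and G: "dominated S G"
  shows "dominated S (\<lambda>z. B (F z) (G z))"
proof -
  obtain s where s: "s \<in> S" "\<And>z. norm (F z) \<le> s z" using F by (auto simp: dominated_def)
  obtain t where t: "t \<in> S" "\<And>z. norm (G z) \<le> t z" using G by (auto simp: dominated_def)
  obtain K where K: "K \<ge> 0" "\<And>x y. norm (B x y) \<le> norm x * norm y * K"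
    using bounded_bilinear.nonneg_bounded[OF B] by metis
  have "norm (B (F z) (G z)) \<le> K * (s z * t z)" for z
  proof -
    have "norm (F z) * norm (G z) \<le> s z * t z"
      using s(2)[of z] t(2)[of z] by (intro mult_mono) (auto intro: order_trans[OF norm_ge_zero])
    then show ?thesis using K(2)[of "F z" "G z"] mult_left_mono[OF _ K(1)] by (fastforce simp: mult.commute)
  qed
  moreover have "(\<lambda>z. B (F z) (G z)) \<in> borel_measurable borel"
    by (rule borel_measurable_continuous_Pair[OF dominated_measurable[OF F] dominated_measurable[OF G]])
       (intro bounded_bilinear.continuous_on[OF B] continuous_intros)
  ultimately show ?thesis by (intro dominatedI[OF _ suitable_scale[OF suitable_mult[OF s(1) t(1)]]])
qed

lemma dominated_inner: "dominated S F \<Longrightarrow> dominated S (\<lambda>z. F z \<bullet> b)"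
  by (rule dominated_bounded_linear[OF bounded_linear_inner_left])

lemma dominated_scaleR: "dominated S F \<Longrightarrow> dominated S (\<lambda>z. a *\<^sub>R F z)"
  by (rule dominated_bounded_linear[OF bounded_linear_scaleR_right])

lemma dominated_diff: "dominated S F \<Longrightarrow> dominated S G \<Longrightarrow> dominated S (\<lambda>z. F z - G z)"
  using dominated_add[of F "\<lambda>z. (-1) *\<^sub>R G z"] dominated_scaleR[of G "-1"] by simp

lemma dominated_mult:
  fixes f g :: "'a \<Rightarrow> real" shows "dominated S f \<Longrightarrow> dominated S g \<Longrightarrow> dominated S (\<lambda>z. f z * g z)"
  by (rule dominated_bounded_bilinear[OF bounded_bilinear_mult])

lemma dominated_power:
  fixes f :: "'a \<Rightarrow> real" shows "dominated S f \<Longrightarrow> dominated S (\<lambda>z. f z ^ n)"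
  by (induction n) (simp_all add: dominated_const dominated_mult)

lemma dominated_sum: "(\<And>i. i \<in> I \<Longrightarrow> dominated S (F i)) \<Longrightarrow> dominated S (\<lambda>z. \<Sum>i\<in>I. F i z)"
  by (induction I rule: infinite_finite_induct) (simp_all add: dominated_const dominated_add)

text \<open>The dominating function must itself be suitable, which \<open>|f|\<close> need not be; but \<open>1 + f\<^sup>2\<close> is.\<close>

lemma dominated_suitable:
  fixes f :: "'a \<Rightarrow> real" assumes "f \<in> S" shows "dominated S f"
proof (rule dominatedI)
  show "(\<lambda>z. 1 + f z * f z) \<in> S" by (intro suitable_add suitable_const suitable_mult assms)
  fix z
  have "0 \<le> (\<bar>f z\<bar> - 1)\<^sup>2" "0 \<le> \<bar>f z\<bar>" by simp_all
  then show "norm (f z) \<le> 1 + f z * f z" by (simp add: power2_eq_square algebra_simps)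
qed (rule suitable_measurable[OF assms])

lemma components_in_dominated: assumes "components_in S F" shows "dominated S F"
proof -
  have "dominated S (\<lambda>z. \<Sum>b\<in>Basis. (F z \<bullet> b) *\<^sub>R b)"
    using assms unfolding components_in_def
    by (intro dominated_sum dominated_bounded_linear[OF bounded_linear_scaleR_left] dominated_suitable) auto
  then show ?thesis by (simp add: euclidean_representation)
qed

lemma dominated_integrable: assumes "dominated S F" shows "integrable \<mu> F"
proof -
  obtain s where s: "s \<in> S" "\<And>z. norm (F z) \<le> s z" using assms by (auto simp: dominated_def)
  show ?thesis
    by (rule Bochner_Integration.integrable_bound[OF suitable_integrable[OF s(1)]])
       (use s(2) dominated_measurable[OF assms] in \<open>auto intro!: AE_I2 intro: order_trans[OF _ abs_ge_self]\<close>)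
qed

lemma dominated_integrable_law:
  assumes "dominated S F" "0 \<le> t" shows "integrable (W z) (\<lambda>w. F (Z t w))"
proof -
  obtain s where s: "s \<in> S" "\<And>z. norm (F z) \<le> s z" using assms by (auto simp: dominated_def)
  have "(\<lambda>w. F (Z t w)) \<in> borel_measurable (W z)"
    using measurable_compose[OF measurable_process[OF assms(2)] dominated_measurable[OF assms(1)]] .
  then show ?thesis
    by (intro Bochner_Integration.integrable_bound[OF suitable_integrable_law[OF s(1) assms(2), of z]])
       (use s(2) in \<open>auto intro!: AE_I2 intro: order_trans[OF _ abs_ge_self]\<close>)
qed

lemma P_add: "dominated S F \<Longrightarrow> dominated S G \<Longrightarrow> 0 \<le> t \<Longrightarrow> P t (\<lambda>z. F z + G z) z = P t F z + P t G z"
  by (simp add: semigroup_op_def dominated_integrable_law)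

lemma P_diff: "dominated S F \<Longrightarrow> dominated S G \<Longrightarrow> 0 \<le> t \<Longrightarrow> P t (\<lambda>z. F z - G z) z = P t F z - P t G z"
  by (simp add: semigroup_op_def dominated_integrable_law)

lemma P_bounded_linear:
  "bounded_linear T \<Longrightarrow> dominated S F \<Longrightarrow> 0 \<le> t \<Longrightarrow> P t (\<lambda>z. T (F z)) z = T (P t F z)"
  unfolding semigroup_op_def by (rule integral_bounded_linear[OF _ dominated_integrable_law])

lemma P_const: "P t (\<lambda>z. a) z = a"
proof -
  interpret prob_space "W z" by (rule prob_law)
  show ?thesis by (simp add: semigroup_op_def prob_space)
qed

lemma P_mono:
  fixes f g :: "'a \<Rightarrow> real"
  shows "dominated S f \<Longrightarrow> dominated S g \<Longrightarrow> 0 \<le> t \<Longrightarrow> (\<And>y. f y \<le> g y) \<Longrightarrow> P t f z \<le> P t g z"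
  unfolding semigroup_op_def by (intro integral_mono dominated_integrable_law)

lemma norm_P_le: "0 \<le> t \<Longrightarrow> norm (P t F z) \<le> P t (\<lambda>z. norm (F z)) z"
  unfolding semigroup_op_def by (rule integral_norm_bound)

lemma P_measurable:
  assumes "F \<in> borel_measurable borel" "0 \<le> t" shows "P t F \<in> borel_measurable borel"
proof -
  have eq: "P t F = (\<lambda>z. integral\<^sup>L (distr (W z) borel (Z t)) F)"
    unfolding semigroup_op_def using assms measurable_process by (simp add: integral_distr fun_eq_iff)
  show ?thesis unfolding eq
    by (rule measurable_compose[OF measurable_prob_algebraD[OF measurable_start[OF assms(2)]]
          integral_measurable_subprob_algebra[OF assms(1)]])
qed

lemma dominated_P: assumes "dominated S F" "0 \<le> t" shows "dominated S (P t F)"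
proof -
  obtain s where s: "s \<in> S" "\<And>z. norm (F z) \<le> s z" using assms by (auto simp: dominated_def)
  show ?thesis
  proof (rule dominatedI[OF P_measurable[OF dominated_measurable[OF assms(1)] assms(2)] suitable_semigroup[OF s(1) assms(2)]])
    show "norm (P t F z) \<le> P t s z" for z
      using norm_P_le[OF assms(2)] P_mono[OF dominated_norm[OF assms(1)] dominated_suitable[OF s(1)] assms(2) s(2)]
      by (rule order_trans)
  qed
qed

lemma P_zero: assumes "F \<in> borel_measurable borel" shows "P 0 F = F"
proof
  fix z
  interpret prob_space "W z" by (rule prob_law)
  have [measurable]: "Z 0 \<in> W z \<rightarrow>\<^sub>M borel" by (rule measurable_process) simp
  have "P 0 F z = (\<integral>w. F z \<partial>W z)"
    unfolding semigroup_op_def using assms start[of z] by (intro integral_cong_AE) auto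
  then show "P 0 F z = F z" by (simp add: prob_space)
qed

lemma subalgebra_natural_filtration: "subalgebra (W z) (natural_filtration (W z) Z s)"
proof -
  have "(\<Union>u\<in>{0..s}. {Z u -` A \<inter> space (W z) |A. A \<in> sets borel}) \<subseteq> sets (W z)"
    using measurable_process[of _ z] by (auto intro: measurable_sets)
  then show ?thesis
    unfolding subalgebra_def natural_filtration_def
    by (auto simp: space_measure_of_conv sets_measure_of_conv sets.sigma_sets_subset split: if_splits dest: in_mono)
qed

text \<open>Take expectations in the Markov property.\<close>

lemma P_semigroup_bounded:
  fixes f :: "'a \<Rightarrow> real"
  assumes "f \<in> borel_measurable borel" "bounded (range f)" "0 \<le> s" "0 \<le> t"
  shows "P (s + t) f z = P s (P t f) z"
proof -
  interpret prob_space "W z" by (rule prob_law)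
  let ?F = "natural_filtration (W z) Z s"
  interpret finite_measure_subalgebra "W z" ?F
    by unfold_locales (rule subalgebra_natural_filtration)
  have Z: "Z u \<in> W z \<rightarrow>\<^sub>M borel" if "0 \<le> u" for u by (rule measurable_process[OF that])
  obtain b where b: "\<And>y. norm (f y) \<le> b" using assms(2) by (auto simp: bounded_iff)
  have fZ: "(\<lambda>w. f (Z (s + t) w)) \<in> borel_measurable (W z)"
    using measurable_compose[OF Z assms(1)] assms by simp
  have int: "integrable (W z) (\<lambda>w. f (Z (s + t) w))"
    by (rule integrable_const_bound[of _ b]) (use b fZ in auto)
  have "P (s + t) f z = (\<integral>w. real_cond_exp (W z) ?F (\<lambda>w'. f (Z (s + t) w')) w \<partial>W z)"
    unfolding semigroup_op_def using real_cond_exp_int(2)[OF int] by simp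
  also have "\<dots> = (\<integral>w. P t f (Z s w) \<partial>W z)"
    using markov_property[OF assms(3,4,1,2)] measurable_compose[OF Z[OF assms(3)] P_measurable[OF assms(1,4)]]
    by (intro integral_cong_AE) auto
  finally show ?thesis by (simp add: semigroup_op_def)
qed

text \<open>Truncation reduces to the bounded case. Dominated convergence applies because \<open>P\<^sub>t |f|\<close> is again dominated.\<close>

lemma P_semigroup_real:
  fixes f :: "'a \<Rightarrow> real"
  assumes f: "dominated S f" and s: "0 \<le> s" and t: "0 \<le> t"
  shows "P (s + t) f z = P s (P t f) z"
proof -
  define g where "g n y = max (- real n) (min (real n) (f y))" for n y
  have [measurable]: "f \<in> borel_measurable borel" by (rule dominated_measurable[OF f])
  have Z: "Z u \<in> W z \<rightarrow>\<^sub>M borel" if "0 \<le> u" for u z by (rule measurable_process[OF that])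
  have g_meas: "g n \<in> borel_measurable borel" for n unfolding g_def by measurable
  have g_bd: "bounded (range (g n))" for n
    unfolding bounded_iff by (rule exI[of _ "real n"]) (auto simp: g_def)
  have g_le: "norm (g n y) \<le> norm (f y)" for n y by (auto simp: g_def)
  have g_lim: "(\<lambda>n. g n y) \<longlonglongrightarrow> f y" for y
  proof (rule tendsto_eventually)
    obtain m where "\<bar>f y\<bar> \<le> real m" using real_arch_simple by blast
    then show "eventually (\<lambda>n. g n y = f y) sequentially"
      unfolding eventually_sequentially g_def by (intro exI[of _ m]) (auto simp: max_def min_def)
  qed
  have g_dom: "dominated S (g n)" for n by (rule dominated_mono[OF f g_meas g_le])
  have lim: "(\<lambda>n. P u (g n) y) \<longlonglongrightarrow> P u f y" if "0 \<le> u" for u y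
    unfolding semigroup_op_def
  proof (rule integral_dominated_convergence[where w = "\<lambda>w. norm (f (Z u w))"])
    show "integrable (W y) (\<lambda>w. norm (f (Z u w)))"
      using dominated_integrable_law[OF f that] by simp
  qed (use g_lim g_le measurable_compose[OF Z[OF that] g_meas] measurable_compose[OF Z[OF that] dominated_measurable[OF f]] in auto)
  have "(\<lambda>n. P s (P t (g n)) z) \<longlonglongrightarrow> P s (P t f) z"
    unfolding semigroup_op_def[of W Z s]
  proof (rule integral_dominated_convergence[where w = "\<lambda>w. P t (\<lambda>y. norm (f y)) (Z s w)"])
    show "integrable (W z) (\<lambda>w. P t (\<lambda>y. norm (f y)) (Z s w))"
      by (intro dominated_integrable_law dominated_P dominated_norm f s t)
    show "AE w in W z. norm (P t (g n) (Z s w)) \<le> P t (\<lambda>y. norm (f y)) (Z s w)" for n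
      using norm_P_le[OF t] P_mono[OF dominated_norm[OF g_dom] dominated_norm[OF f] t g_le]
      by (intro AE_I2) (rule order_trans)
  qed (use lim[OF t] measurable_compose[OF Z[OF s] dominated_measurable[OF dominated_P[OF f t]]]
        measurable_compose[OF Z[OF s] dominated_measurable[OF dominated_P[OF g_dom t]]] in auto)
  moreover have "P (s + t) (g n) z = P s (P t (g n)) z" for n
    by (rule P_semigroup_bounded[OF g_meas g_bd s t])
  ultimately have "(\<lambda>n. P (s + t) (g n) z) \<longlonglongrightarrow> P s (P t f) z" by (simp only:)
  moreover have "(\<lambda>n. P (s + t) (g n) z) \<longlonglongrightarrow> P (s + t) f z"
    using s t by (intro lim) auto
  ultimately show ?thesis by (rule LIMSEQ_unique[rotated])
qed

lemma P_inner: "dominated S F \<Longrightarrow> 0 \<le> t \<Longrightarrow> P t F z \<bullet> b = P t (\<lambda>z. F z \<bullet> b) z"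
  by (rule P_bounded_linear[OF bounded_linear_inner_left, symmetric])

lemma P_semigroup:
  fixes F :: "'a \<Rightarrow> 'b::euclidean_space"
  assumes F: "dominated S F" and s: "0 \<le> s" and t: "0 \<le> t"
  shows "P (s + t) F z = P s (P t F) z"
proof (rule euclidean_eqI)
  fix b :: 'b
  have "P (s + t) F z \<bullet> b = P s (P t (\<lambda>z. F z \<bullet> b)) z"
    using P_semigroup_real[OF dominated_inner[OF F] s t] F s t by (simp add: P_inner)
  also have "P t (\<lambda>z. F z \<bullet> b) = (\<lambda>z. P t F z \<bullet> b)" by (simp add: P_inner[OF F t])
  also have "P s (\<lambda>z. P t F z \<bullet> b) z = P s (P t F) z \<bullet> b" by (simp add: P_inner[OF dominated_P[OF F t] s])
  finally show "P (s + t) F z \<bullet> b = P s (P t F) z \<bullet> b" .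
qed

lemma square_integrable_dominated: "dominated S f \<Longrightarrow> square_integrable \<mu> f"
  unfolding square_integrable_def
  using dominated_integrable[OF dominated_power[of f 2]] dominated_measurable[of f] by simp

text \<open>Reversibility is a statement about real functions; expanding the form in coordinates gives it for vector-valued
  functions and any bilinear form.\<close>

lemma reversible_bilinear:
  fixes F :: "'a \<Rightarrow> 'b::euclidean_space" and G :: "'a \<Rightarrow> 'c::euclidean_space" and B :: "'b \<Rightarrow> 'c \<Rightarrow> real"
  assumes B: "bounded_bilinear B" and F: "dominated S F" and G: "dominated S G" and t: "0 \<le> t"
  shows "(\<integral>z. B (P t F z) (G z) \<partial>\<mu>) = (\<integral>z. B (F z) (P t G z) \<partial>\<mu>)"
proof -
  have expand: "(\<integral>z. B (X z) (Y z) \<partial>\<mu>) = (\<Sum>i\<in>Basis. \<Sum>j\<in>Basis. (\<integral>z. (X z \<bullet> i) * (Y z \<bullet> j) \<partial>\<mu>) * B i j)"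
    if X: "dominated S X" and Y: "dominated S Y" for X :: "'a \<Rightarrow> 'b" and Y :: "'a \<Rightarrow> 'c"
  proof -
    have "B x y = (\<Sum>i\<in>Basis. \<Sum>j\<in>Basis. ((x \<bullet> i) * (y \<bullet> j)) * B i j)" for x y
    proof -
      have "B x y = B (\<Sum>i\<in>Basis. (x \<bullet> i) *\<^sub>R i) (\<Sum>j\<in>Basis. (y \<bullet> j) *\<^sub>R j)"
        by (simp add: euclidean_representation)
      then show ?thesis
        by (simp add: bounded_bilinear.sum_left[OF B] bounded_bilinear.sum_right[OF B]
            bounded_bilinear.scaleR_left[OF B] bounded_bilinear.scaleR_right[OF B] sum_distrib_left mult.assoc)
           (subst sum.swap, simp add: mult.left_commute)
    qed
    then have "(\<integral>z. B (X z) (Y z) \<partial>\<mu>)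
        = (\<integral>z. (\<Sum>i\<in>Basis. \<Sum>j\<in>Basis. ((X z \<bullet> i) * (Y z \<bullet> j)) * B i j) \<partial>\<mu>)"
      by (intro Bochner_Integration.integral_cong refl)
    also have "\<dots> = (\<Sum>i\<in>Basis. \<Sum>j\<in>Basis. (\<integral>z. (X z \<bullet> i) * (Y z \<bullet> j) \<partial>\<mu>) * B i j)"
    proof -
      have "integrable \<mu> (\<lambda>z. (X z \<bullet> i) * (Y z \<bullet> j))" for i j
        by (intro dominated_integrable dominated_mult dominated_inner X Y)
      then show ?thesis by (simp add: Bochner_Integration.integral_sum)
    qed
    finally show ?thesis .
  qed
  have "(\<integral>z. (P t F z \<bullet> i) * (G z \<bullet> j) \<partial>\<mu>) = (\<integral>z. (F z \<bullet> i) * (P t G z \<bullet> j) \<partial>\<mu>)" for i j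
    using reversible[OF t square_integrable_dominated square_integrable_dominated, OF dominated_inner[OF F, of i] dominated_inner[OF G, of j]]
    by (simp add: P_inner[OF F t] P_inner[OF G t])
  then show ?thesis using F G t by (simp add: expand dominated_P)
qed

lemma expectation_P:
  fixes f :: "'a \<Rightarrow> real"
  assumes "dominated S f" "0 \<le> t" shows "(\<integral>z. P t f z \<partial>\<mu>) = (\<integral>z. f z \<partial>\<mu>)"
  using reversible_bilinear[OF bounded_bilinear_mult assms(1) dominated_const[of "1::real"] assms(2)]
  by (simp add: P_const)

end

context suitable_functions
begin

section \<open>The generator on vector-valued functions\<close>

lemma components_in_inner: "components_in S F \<Longrightarrow> (\<lambda>z. F z \<bullet> v) \<in> S"
proof -
  assume F: "components_in S F"
  have "(\<lambda>z. F z \<bullet> v) = (\<lambda>z. \<Sum>b\<in>Basis. (v \<bullet> b) * (F z \<bullet> b))"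
    by (subst euclidean_inner) (simp add: mult.commute)
  also have "\<dots> \<in> S" using F by (intro suitable_sum suitable_scale) (simp add: components_in_def)
  finally show ?thesis .
qed

lemma components_in_const: "components_in S (\<lambda>z. a)"
  by (simp add: components_in_def suitable_const)

lemma components_in_add: "components_in S F \<Longrightarrow> components_in S G \<Longrightarrow> components_in S (\<lambda>z. F z + G z)"
  by (simp add: components_in_def inner_add_left suitable_add)

lemma components_in_diff: "components_in S F \<Longrightarrow> components_in S G \<Longrightarrow> components_in S (\<lambda>z. F z - G z)"
  by (simp add: components_in_def inner_diff_left suitable_diff)

lemma components_in_scaleR: "components_in S F \<Longrightarrow> components_in S (\<lambda>z. a *\<^sub>R F z)"
  by (simp add: components_in_def suitable_scale)

lemma components_in_bounded_bilinear:
  fixes B :: "'b::euclidean_space \<Rightarrow> 'c::euclidean_space \<Rightarrow> 'e::euclidean_space"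
  assumes B: "bounded_bilinear B" and F: "components_in S F" and G: "components_in S G"
  shows "components_in S (\<lambda>z. B (F z) (G z))"
  unfolding components_in_def
proof
  fix b :: 'e assume "b \<in> Basis"
  have "B x y \<bullet> b = (\<Sum>i\<in>Basis. \<Sum>j\<in>Basis. (B i j \<bullet> b) * ((x \<bullet> i) * (y \<bullet> j)))" for x y
  proof -
    have "B x y = B (\<Sum>i\<in>Basis. (x \<bullet> i) *\<^sub>R i) (\<Sum>j\<in>Basis. (y \<bullet> j) *\<^sub>R j)"
      by (simp add: euclidean_representation)
    also have "\<dots> = (\<Sum>i\<in>Basis. \<Sum>j\<in>Basis. ((x \<bullet> i) * (y \<bullet> j)) *\<^sub>R B i j)"
      by (subst sum.swap) (simp only: bounded_bilinear.sum_left[OF B] bounded_bilinear.sum_right[OF B]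
          bounded_bilinear.scaleR_left[OF B] bounded_bilinear.scaleR_right[OF B] scaleR_scaleR scaleR_sum_right mult.commute)
    finally show ?thesis by (simp add: inner_sum_left mult.commute)
  qed
  then have "(\<lambda>z. B (F z) (G z) \<bullet> b)
      = (\<lambda>z. \<Sum>i\<in>Basis. \<Sum>j\<in>Basis. (B i j \<bullet> b) * ((F z \<bullet> i) * (G z \<bullet> j)))" by (intro ext)
  also have "\<dots> \<in> S"
    by (intro suitable_sum suitable_scale suitable_mult components_in_inner F G)
  finally show "(\<lambda>z. B (F z) (G z) \<bullet> b) \<in> S" .
qed

lemma components_in_P: "components_in S F \<Longrightarrow> 0 \<le> t \<Longrightarrow> components_in S (P t F)"
  unfolding components_in_def
  using P_inner[OF components_in_dominated[of F]] suitable_semigroup components_in_def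
  by (metis (no_types, lifting) ext)

lemma generator_tendsto_inner:
  assumes F: "components_in S F"
  shows "((\<lambda>t. (P t F z - F z) /\<^sub>R t) \<longlongrightarrow> (\<Sum>b\<in>Basis. L (\<lambda>z. F z \<bullet> b) z *\<^sub>R b)) (at_right 0)"
proof -
  have "((\<lambda>t. \<Sum>b\<in>Basis. ((P t (\<lambda>z. F z \<bullet> b) z - F z \<bullet> b) / t) *\<^sub>R b)
      \<longlongrightarrow> (\<Sum>b\<in>Basis. L (\<lambda>z. F z \<bullet> b) z *\<^sub>R b)) (at_right 0)"
    by (intro tendsto_sum tendsto_scaleR tendsto_const generator_limit components_in_inner F)
  moreover
  have "(\<Sum>b\<in>Basis. ((P t (\<lambda>z. F z \<bullet> b) z - F z \<bullet> b) / t) *\<^sub>R b) = (P t F z - F z) /\<^sub>R t"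
    if "0 < t" for t
  proof -
    have "(P t (\<lambda>z. F z \<bullet> b) z - F z \<bullet> b) / t = ((P t F z - F z) /\<^sub>R t) \<bullet> b" for b
      using that by (simp add: P_inner[OF components_in_dominated[OF F]] inner_diff_left divide_inverse mult.commute)
    then show ?thesis by (simp only: euclidean_representation)
  qed
  then have "eventually (\<lambda>t. (\<Sum>b\<in>Basis. ((P t (\<lambda>z. F z \<bullet> b) z - F z \<bullet> b) / t) *\<^sub>R b) = (P t F z - F z) /\<^sub>R t) (at_right 0)"
    by (auto simp: eventually_at_filter)
  ultimately show ?thesis by (rule Lim_transform_eventually)
qed

lemma generator_inner: "components_in S F \<Longrightarrow> L F z \<bullet> b = L (\<lambda>z. F z \<bullet> b) z" if "b \<in> Basis"
proof -
  assume F: "components_in S F"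
  have "L F z = (\<Sum>b\<in>Basis. L (\<lambda>z. F z \<bullet> b) z *\<^sub>R b)"
    unfolding generator_def[of W Z F] by (rule tendsto_Lim[OF _ generator_tendsto_inner[OF F]]) simp
  then show ?thesis using that by simp
qed

lemma generator_tendsto:
  assumes F: "components_in S F"
  shows "((\<lambda>t. (P t F z - F z) /\<^sub>R t) \<longlongrightarrow> L F z) (at_right 0)"
  unfolding generator_def[of W Z F] using generator_tendsto_inner[OF F, of z]
  by (subst tendsto_Lim[OF _ generator_tendsto_inner[OF F]]) auto

lemma components_in_L:
  fixes F :: "'a \<Rightarrow> 'b::euclidean_space"
  shows "components_in S F \<Longrightarrow> components_in S (L F)"
  unfolding components_in_def
proof
  fix b :: 'b assume F: "\<forall>b\<in>Basis. (\<lambda>z. F z \<bullet> b) \<in> S" and b: "b \<in> Basis"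
  have "(\<lambda>z. L F z \<bullet> b) = L (\<lambda>z. F z \<bullet> b)"
    using F b by (intro ext generator_inner) (simp_all add: components_in_def)
  then show "(\<lambda>z. L F z \<bullet> b) \<in> S" using F b by (simp add: suitable_generator)
qed

lemma L_P_commute:
  fixes F :: "'a \<Rightarrow> 'b::euclidean_space"
  shows "components_in S F \<Longrightarrow> 0 \<le> t \<Longrightarrow> L (P t F) = P t (L F)"
proof (rule ext, rule euclidean_eqI)
  fix z and b :: 'b assume F: "components_in S F" and t: "0 \<le> t" and b: "b \<in> Basis"
  have "L (P t F) z \<bullet> b = L (\<lambda>z. P t F z \<bullet> b) z"
    by (rule generator_inner[OF b components_in_P[OF F t]])
  also have "(\<lambda>z. P t F z \<bullet> b) = P t (\<lambda>z. F z \<bullet> b)"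
    by (intro ext P_inner components_in_dominated F t)
  also have "L (P t (\<lambda>z. F z \<bullet> b)) z = P t (L (\<lambda>z. F z \<bullet> b)) z"
    by (rule generator_commute[OF components_in_inner[OF F] t])
  also have "L (\<lambda>z. F z \<bullet> b) = (\<lambda>z. L F z \<bullet> b)" by (intro ext generator_inner[symmetric] b F)
  also have "P t (\<lambda>z. L F z \<bullet> b) z = P t (L F) z \<bullet> b"
    by (rule P_inner[symmetric, OF components_in_dominated[OF components_in_L[OF F]] t])
  finally show "L (P t F) z \<bullet> b = P t (L F) z \<bullet> b" .
qed

lemma L_unique:
  assumes "((\<lambda>t. (P t F z - F z) /\<^sub>R t) \<longlongrightarrow> l) (at_right 0)"
  shows "L F z = l"
  unfolding generator_def by (rule tendsto_Lim[OF _ assms]) simp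

lemma L_bounded_linear:
  assumes T: "bounded_linear T" and F: "components_in S F"
  shows "L (\<lambda>z. T (F z)) z = T (L F z)"
proof (rule L_unique)
  have "((\<lambda>t. T ((P t F z - F z) /\<^sub>R t)) \<longlongrightarrow> T (L F z)) (at_right 0)"
    by (rule bounded_linear.tendsto[OF T generator_tendsto[OF F]])
  then show "((\<lambda>t. (P t (\<lambda>z. T (F z)) z - T (F z)) /\<^sub>R t) \<longlongrightarrow> T (L F z)) (at_right 0)"
  proof (rule Lim_transform_eventually)
    show "eventually (\<lambda>t. T ((P t F z - F z) /\<^sub>R t) = (P t (\<lambda>z. T (F z)) z - T (F z)) /\<^sub>R t) (at_right 0)"
      unfolding eventually_at_filter
    proof (intro always_eventually allI impI)
      fix t :: real assume "t \<in> {0<..}"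
      then have "P t (\<lambda>z. T (F z)) z = T (P t F z)"
        by (intro P_bounded_linear T components_in_dominated F) auto
      then show "T ((P t F z - F z) /\<^sub>R t) = (P t (\<lambda>z. T (F z)) z - T (F z)) /\<^sub>R t"
        by (simp only: linear_scale[OF bounded_linear.linear[OF T]] linear_diff[OF bounded_linear.linear[OF T]])
    qed
  qed
qed

lemma L_add:
  assumes F: "components_in S F" and G: "components_in S G"
  shows "L (\<lambda>z. F z + G z) z = L F z + L G z"
proof (rule L_unique)
  have "((\<lambda>t. (P t F z - F z) /\<^sub>R t + (P t G z - G z) /\<^sub>R t) \<longlongrightarrow> L F z + L G z) (at_right 0)"
    by (intro tendsto_add generator_tendsto F G)
  then show "((\<lambda>t. (P t (\<lambda>z. F z + G z) z - (F z + G z)) /\<^sub>R t) \<longlongrightarrow> L F z + L G z) (at_right 0)"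
  proof (rule Lim_transform_eventually)
    show "eventually (\<lambda>t. (P t F z - F z) /\<^sub>R t + (P t G z - G z) /\<^sub>R t
        = (P t (\<lambda>z. F z + G z) z - (F z + G z)) /\<^sub>R t) (at_right 0)"
      unfolding eventually_at_filter
    proof (intro always_eventually allI impI)
      fix t :: real assume "t \<in> {0<..}"
      then have "P t (\<lambda>z. F z + G z) z = P t F z + P t G z"
        by (intro P_add components_in_dominated F G) auto
      then show "(P t F z - F z) /\<^sub>R t + (P t G z - G z) /\<^sub>R t = (P t (\<lambda>z. F z + G z) z - (F z + G z)) /\<^sub>R t"
        by (simp only: scaleR_add_right[symmetric] add_diff_add)
    qed
  qed
qed

lemma L_const: "L (\<lambda>z. a) z = 0"
  by (rule L_unique) (simp add: P_const)

lemma L_scaleR: "components_in S F \<Longrightarrow> L (\<lambda>z. a *\<^sub>R F z) z = a *\<^sub>R L F z"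
  by (rule L_bounded_linear[OF bounded_linear_scaleR_right])

lemma L_diff:
  assumes F: "components_in S F" and G: "components_in S G"
  shows "L (\<lambda>z. F z - G z) z = L F z - L G z"
  using L_add[OF F components_in_scaleR[OF G, of "-1"]] L_scaleR[OF G, of "-1"] by simp

section \<open>Mean-square calculus\<close>

definition L2norm :: "('a \<Rightarrow> 'b::euclidean_space) \<Rightarrow> real" where
  "L2norm F = sqrt (\<integral>z. (norm (F z))\<^sup>2 \<partial>\<mu>)"

lemma dominated_norm_power: "dominated S F \<Longrightarrow> dominated S (\<lambda>z. norm (F z) ^ n)"
  by (intro dominated_power dominated_norm)

lemma L2norm_nonneg: "0 \<le> L2norm F"
  by (simp add: L2norm_def)

lemma L2norm_square: "(L2norm F)\<^sup>2 = (\<integral>z. (norm (F z))\<^sup>2 \<partial>\<mu>)"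
  by (simp add: L2norm_def)

lemma expectation_mono:
  fixes f g :: "'a \<Rightarrow> real"
  shows "dominated S f \<Longrightarrow> dominated S g \<Longrightarrow> (\<And>z. f z \<le> g z) \<Longrightarrow> (\<integral>z. f z \<partial>\<mu>) \<le> (\<integral>z. g z \<partial>\<mu>)"
  by (intro integral_mono dominated_integrable)

lemma L2norm_mono:
  assumes "dominated S F" "dominated S G" "\<And>z. norm (F z) \<le> norm (G z)"
  shows "L2norm F \<le> L2norm G"
  unfolding L2norm_def
  by (intro real_sqrt_le_mono expectation_mono dominated_norm_power assms power_mono) auto

lemma L2norm_scaleR: "L2norm (\<lambda>z. a *\<^sub>R F z) = \<bar>a\<bar> * L2norm F"
  by (simp add: L2norm_def power_mult_distrib real_sqrt_mult)

lemma integral_norm_mult_le: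
  assumes F: "dominated S F" and G: "dominated S G"
  shows "(\<integral>z. norm (F z) * norm (G z) \<partial>\<mu>) \<le> L2norm F * L2norm G"
proof -
  define A where "A = (\<integral>z. (norm (F z))\<^sup>2 \<partial>\<mu>)"
  define B where "B = (\<integral>z. (norm (G z))\<^sup>2 \<partial>\<mu>)"
  define C where "C = (\<integral>z. norm (F z) * norm (G z) \<partial>\<mu>)"
  have int: "integrable \<mu> (\<lambda>z. (norm (F z))\<^sup>2)" "integrable \<mu> (\<lambda>z. (norm (G z))\<^sup>2)"
    "integrable \<mu> (\<lambda>z. norm (F z) * norm (G z))"
    by (intro dominated_integrable dominated_norm_power dominated_mult dominated_norm F G)+
  have quad: "0 \<le> A + t\<^sup>2 * B - 2 * t * C" for t
  proof -
    have "0 \<le> (\<integral>z. (norm (F z) - t * norm (G z))\<^sup>2 \<partial>\<mu>)" by simp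
    also have "(\<lambda>z. (norm (F z) - t * norm (G z))\<^sup>2)
        = (\<lambda>z. (norm (F z))\<^sup>2 + t\<^sup>2 * (norm (G z))\<^sup>2 - (2 * t) * (norm (F z) * norm (G z)))"
      by (auto simp: power2_eq_square algebra_simps)
    also have "(\<integral>z. (norm (F z))\<^sup>2 + t\<^sup>2 * (norm (G z))\<^sup>2 - (2 * t) * (norm (F z) * norm (G z)) \<partial>\<mu>)
        = A + t\<^sup>2 * B - 2 * t * C"
      using int by (simp add: A_def B_def C_def)
    finally show ?thesis .
  qed
  have B0: "0 \<le> B" by (simp add: B_def)
  have "C\<^sup>2 \<le> A * B"
  proof (cases "B = 0")
    case True
    have "C = 0"
    proof (rule ccontr)
      assume "C \<noteq> 0"
      then have "2 * ((A + 1) / (2 * C)) * C = A + 1" by simp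
      then show False using quad[of "(A + 1) / (2 * C)"] True by simp
    qed
    then show ?thesis using True by simp
  next
    case False
    then have "0 \<le> A - C\<^sup>2 / B" using quad[of "C / B"] by (simp add: power2_eq_square)
    then show ?thesis using B0 False by (simp add: field_simps)
  qed
  then have "C \<le> sqrt (A * B)" by (rule real_le_rsqrt)
  then show ?thesis by (simp add: L2norm_def A_def B_def C_def real_sqrt_mult)
qed

lemma L2norm_triangle:
  assumes F: "dominated S F" and G: "dominated S G"
  shows "L2norm (\<lambda>z. F z + G z) \<le> L2norm F + L2norm G"
proof -
  have int: "integrable \<mu> (\<lambda>z. (norm (F z))\<^sup>2)" "integrable \<mu> (\<lambda>z. (norm (G z))\<^sup>2)"
    "integrable \<mu> (\<lambda>z. norm (F z) * norm (G z))"
    by (intro dominated_integrable dominated_norm_power dominated_mult dominated_norm F G)+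
  have "(\<integral>z. (norm (F z + G z))\<^sup>2 \<partial>\<mu>) \<le> (\<integral>z. (norm (F z))\<^sup>2 + (norm (G z))\<^sup>2 + 2 * (norm (F z) * norm (G z)) \<partial>\<mu>)"
  proof (intro integral_mono)
    show "(norm (F z + G z))\<^sup>2 \<le> (norm (F z))\<^sup>2 + (norm (G z))\<^sup>2 + 2 * (norm (F z) * norm (G z))" for z
      using power_mono[OF norm_triangle_ineq[of "F z" "G z"] norm_ge_zero, of 2]
      by (simp add: power2_eq_square algebra_simps)
  qed (use int in \<open>auto intro!: dominated_integrable dominated_norm_power dominated_add F G\<close>)
  also have "\<dots> = (L2norm F)\<^sup>2 + (L2norm G)\<^sup>2 + 2 * (\<integral>z. norm (F z) * norm (G z) \<partial>\<mu>)"
    using int by (simp add: L2norm_square)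
  also have "\<dots> \<le> (L2norm F + L2norm G)\<^sup>2"
    using integral_norm_mult_le[OF F G] by (simp add: power2_eq_square algebra_simps)
  finally show ?thesis
    unfolding L2norm_def[of "\<lambda>z. F z + G z"] by (rule real_le_lsqrt[OF add_nonneg_nonneg[OF L2norm_nonneg L2norm_nonneg]])
qed

lemma abs_integral_bilinear_le:
  fixes B :: "'b::euclidean_space \<Rightarrow> 'c::euclidean_space \<Rightarrow> real"
  assumes B: "bounded_bilinear B"
  obtains K where "0 \<le> K"
    "\<And>F G. dominated S F \<Longrightarrow> dominated S G \<Longrightarrow> \<bar>\<integral>z. B (F z) (G z) \<partial>\<mu>\<bar> \<le> K * (L2norm F * L2norm G)"
proof -
  obtain K where K: "K \<ge> 0" "\<And>x y. norm (B x y) \<le> norm x * norm y * K"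
    using bounded_bilinear.nonneg_bounded[OF B] by metis
  show ?thesis
  proof (rule that[OF K(1)])
    fix F :: "'a \<Rightarrow> 'b" and G :: "'a \<Rightarrow> 'c" assume F: "dominated S F" and G: "dominated S G"
    have "\<bar>\<integral>z. B (F z) (G z) \<partial>\<mu>\<bar> \<le> (\<integral>z. \<bar>B (F z) (G z)\<bar> \<partial>\<mu>)"
      by (rule integral_abs_bound)
    also have "\<dots> \<le> (\<integral>z. K * (norm (F z) * norm (G z)) \<partial>\<mu>)"
    proof (rule expectation_mono)
      show "dominated S (\<lambda>z. \<bar>B (F z) (G z)\<bar>)"
        using dominated_norm[OF dominated_bounded_bilinear[OF B F G]] by simp
      show "dominated S (\<lambda>z. K * (norm (F z) * norm (G z)))"
        by (intro dominated_mult dominated_const dominated_norm F G)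
    qed (use K(2) in \<open>simp add: mult_ac\<close>)
    also have "\<dots> \<le> K * (L2norm F * L2norm G)"
      using integral_norm_mult_le[OF F G] K(1) by (simp add: mult_left_mono)
    finally show "\<bar>\<integral>z. B (F z) (G z) \<partial>\<mu>\<bar> \<le> K * (L2norm F * L2norm G)" .
  qed
qed

definition L2_tendsto :: "('i \<Rightarrow> 'a \<Rightarrow> 'b::euclidean_space) \<Rightarrow> ('a \<Rightarrow> 'b) \<Rightarrow> 'i filter \<Rightarrow> bool" where
  "L2_tendsto X Y \<F> \<longleftrightarrow> dominated S Y \<and> (\<forall>\<^sub>F i in \<F>. dominated S (X i)) \<and>
     ((\<lambda>i. L2norm (\<lambda>z. X i z - Y z)) \<longlongrightarrow> 0) \<F>"

lemma L2_tendsto_const: "dominated S Y \<Longrightarrow> L2_tendsto (\<lambda>i. Y) Y \<F>"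
  by (simp add: L2_tendsto_def L2norm_def)

lemma bilinear_diff_expand:
  "bounded_bilinear B \<Longrightarrow> B x y - B x0 y0 = B (x - x0) (y - y0) + B (x - x0) y0 + B x0 (y - y0)"
  by (simp add: bounded_bilinear.diff_left bounded_bilinear.diff_right)

lemma L2_tendsto_dominated: "L2_tendsto X Y \<F> \<Longrightarrow> \<forall>\<^sub>F i in \<F>. dominated S (X i)"
  by (simp add: L2_tendsto_def)

lemma tendsto_integral_bilinear:
  fixes B :: "'b::euclidean_space \<Rightarrow> 'c::euclidean_space \<Rightarrow> real"
  assumes B: "bounded_bilinear B" and X: "L2_tendsto X X0 \<F>" and Y: "L2_tendsto Y Y0 \<F>"
  shows "((\<lambda>i. \<integral>z. B (X i z) (Y i z) \<partial>\<mu>) \<longlongrightarrow> (\<integral>z. B (X0 z) (Y0 z) \<partial>\<mu>)) \<F>"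
proof -
  obtain K where K: "0 \<le> K"
    "\<And>F G. dominated S F \<Longrightarrow> dominated S G \<Longrightarrow> \<bar>\<integral>z. B (F z) (G z) \<partial>\<mu>\<bar> \<le> K * (L2norm F * L2norm G)"
    using abs_integral_bilinear_le[OF B] by blast
  have X0: "dominated S X0" and Y0: "dominated S Y0" using X Y by (auto simp: L2_tendsto_def)
  let ?dX = "\<lambda>i z. X i z - X0 z" and ?dY = "\<lambda>i z. Y i z - Y0 z"
  let ?b = "\<lambda>i. K * (L2norm (?dX i) * L2norm (?dY i) + L2norm (?dX i) * L2norm Y0 + L2norm X0 * L2norm (?dY i))"
  have ev: "eventually (\<lambda>i. norm ((\<integral>z. B (X i z) (Y i z) \<partial>\<mu>) - (\<integral>z. B (X0 z) (Y0 z) \<partial>\<mu>))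
     \<le> ?b i) \<F>"
    using L2_tendsto_dominated[OF X] L2_tendsto_dominated[OF Y]
  proof eventually_elim
    case (elim i)
    have dX: "dominated S (?dX i)" and dY: "dominated S (?dY i)"
      using elim X0 Y0 by (auto intro: dominated_diff)
    note int = dominated_integrable[OF dominated_bounded_bilinear[OF B]]
    have "(\<integral>z. B (X i z) (Y i z) \<partial>\<mu>) - (\<integral>z. B (X0 z) (Y0 z) \<partial>\<mu>)
        = (\<integral>z. B (?dX i z) (?dY i z) + B (?dX i z) (Y0 z) + B (X0 z) (?dY i z) \<partial>\<mu>)"
      using int[OF elim(1,2)] int[OF X0 Y0]
      by (simp only: Bochner_Integration.integral_diff[symmetric] bilinear_diff_expand[OF B])
    also have "\<dots> = (\<integral>z. B (?dX i z) (?dY i z) \<partial>\<mu>) + (\<integral>z. B (?dX i z) (Y0 z) \<partial>\<mu>) + (\<integral>z. B (X0 z) (?dY i z) \<partial>\<mu>)"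
      using int[OF dX dY] int[OF dX Y0] int[OF X0 dY] by simp
    finally show ?case
      using K(2)[OF dX dY] K(2)[OF dX Y0] K(2)[OF X0 dY] by (simp add: distrib_left)
  qed
  have "(?b
      \<longlongrightarrow> K * (0 * 0 + 0 * L2norm Y0 + L2norm X0 * 0)) \<F>"
    using X Y unfolding L2_tendsto_def by (intro tendsto_intros) auto
  then have "(?b \<longlongrightarrow> 0) \<F>"
    by (simp only: mult_zero_left mult_zero_right add_0_left real_sqrt_zero)
  from Lim_null_comparison[OF ev this] show ?thesis by (simp only: LIM_zero_iff)
qed

lemma L2_tendsto_subst:
  "L2_tendsto X Y \<F> \<Longrightarrow> filterlim h \<F> \<G> \<Longrightarrow> L2_tendsto (\<lambda>i. X (h i)) Y \<G>"
  unfolding L2_tendsto_def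
  by (auto intro: filterlim_compose eventually_compose_filterlim)

text \<open>Mean-square convergence does not survive products. A bound on sixth moments upgrades it to convergence in
  fourth mean, and products of two such families converge in mean square again.\<close>

definition L6_bounded :: "('i \<Rightarrow> 'a \<Rightarrow> 'b::euclidean_space) \<Rightarrow> 'i filter \<Rightarrow> bool" where
  "L6_bounded X \<F> \<longleftrightarrow> (\<exists>C. \<forall>\<^sub>F i in \<F>. (\<integral>z. norm (X i z) ^ 6 \<partial>\<mu>) \<le> C)"

text \<open>Interpolation by the Cauchy-Schwarz inequality: \<open>E d\<^sup>4 = E (d d\<^sup>3) \<le> (E d\<^sup>2)\<^bsup>1/2\<^esup> (E d\<^sup>6)\<^bsup>1/2\<^esup>\<close>.\<close>

lemma L4_tendsto:
  fixes X :: "'i \<Rightarrow> 'a \<Rightarrow> 'b::euclidean_space"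
  assumes X: "L2_tendsto X Y \<F>" and bd: "L6_bounded X \<F>"
  shows "((\<lambda>i. L2norm (\<lambda>z. (norm (X i z - Y z))\<^sup>2)) \<longlongrightarrow> 0) \<F>"
proof -
  have Y: "dominated S Y" using X by (simp add: L2_tendsto_def)
  obtain C where C: "eventually (\<lambda>i. (\<integral>z. norm (X i z) ^ 6 \<partial>\<mu>) \<le> C) \<F>"
    using bd by (auto simp: L6_bounded_def)
  \<comment> \<open>The factor 32 comes from \<open>(a + b)\<^sup>6 \<le> 2\<^sup>5 (a\<^sup>6 + b\<^sup>6)\<close>.\<close>
  define M where "M = sqrt (32 * (C + (\<integral>z. norm (Y z) ^ 6 \<partial>\<mu>)))"
  have ev: "eventually (\<lambda>i. norm (L2norm (\<lambda>z. (norm (X i z - Y z))\<^sup>2))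
      \<le> sqrt (L2norm (\<lambda>z. X i z - Y z) * M)) \<F>"
    using C L2_tendsto_dominated[OF X]
  proof eventually_elim
    case (elim i)
    let ?d = "\<lambda>z. X i z - Y z"
    have d: "dominated S ?d" using elim Y by (auto intro: dominated_diff)
    have six: "norm (x - y) ^ 6 \<le> 32 * (norm x ^ 6 + norm y ^ 6)" for x y :: 'b
    proof -
      have "norm (x - y) ^ 6 \<le> (norm x + norm y) ^ 6"
        by (intro power_mono norm_triangle_ineq4) auto
      also have "\<dots> = 64 * ((1/2) * norm x + (1/2) * norm y) ^ 6"
        by (simp only: distrib_left[symmetric] power_mult_distrib) (simp add: power_divide)
      also have "((1/2) * norm x + (1/2) * norm y) ^ 6 \<le> (1/2) * norm x ^ 6 + (1/2) * norm y ^ 6"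
        using convex_onD[OF convex_power_even[of 6], of "1/2" "norm x" "norm y"] by simp
      finally show ?thesis by simp
    qed
    have "(L2norm (\<lambda>z. norm (?d z) ^ 3))\<^sup>2 = (\<integral>z. norm (?d z) ^ 6 \<partial>\<mu>)"
      by (simp add: L2norm_square flip: power_mult)
    also have "\<dots> \<le> (\<integral>z. 32 * (norm (X i z) ^ 6 + norm (Y z) ^ 6) \<partial>\<mu>)"
      using elim Y
      by (intro expectation_mono six dominated_mult dominated_const dominated_add dominated_norm_power d) auto
    also have "\<dots> = 32 * ((\<integral>z. norm (X i z) ^ 6 \<partial>\<mu>) + (\<integral>z. norm (Y z) ^ 6 \<partial>\<mu>))"
      using dominated_integrable[OF dominated_norm_power[OF elim(2), of 6]]
        dominated_integrable[OF dominated_norm_power[OF Y, of 6]] by simp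
    also have "\<dots> \<le> 32 * (C + (\<integral>z. norm (Y z) ^ 6 \<partial>\<mu>))" using elim(1) by simp
    finally have cube: "L2norm (\<lambda>z. norm (?d z) ^ 3) \<le> M" unfolding M_def by (rule real_le_rsqrt)
    have "(L2norm (\<lambda>z. (norm (?d z))\<^sup>2))\<^sup>2 = (\<integral>z. norm (?d z) * norm (norm (?d z) ^ 3) \<partial>\<mu>)"
      unfolding L2norm_square by (simp add: power2_eq_square power3_eq_cube mult.assoc)
    also have "\<dots> \<le> L2norm ?d * L2norm (\<lambda>z. norm (?d z) ^ 3)"
      by (intro integral_norm_mult_le d dominated_norm_power)
    also have "\<dots> \<le> L2norm ?d * M" by (intro mult_left_mono cube L2norm_nonneg)
    finally have "L2norm (\<lambda>z. (norm (?d z))\<^sup>2) \<le> sqrt (L2norm ?d * M)" by (rule real_le_rsqrt)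
    then show ?case by (simp add: L2norm_nonneg)
  qed
  have "((\<lambda>i. sqrt (L2norm (\<lambda>z. X i z - Y z) * M)) \<longlongrightarrow> sqrt (0 * M)) \<F>"
    using X unfolding L2_tendsto_def by (intro tendsto_intros) auto
  then have "((\<lambda>i. sqrt (L2norm (\<lambda>z. X i z - Y z) * M)) \<longlongrightarrow> 0) \<F>"
    by (simp only: mult_zero_left mult_zero_right add_0_left real_sqrt_zero)
  from Lim_null_comparison[OF ev this] show ?thesis .
qed

lemma L2norm_bilinear_le:
  assumes K: "\<And>x y. norm (B x y) \<le> norm x * norm y * K" and B: "bounded_bilinear B" and K0: "0 \<le> K"
    and F: "dominated S F" and G: "dominated S G"
  shows "L2norm (\<lambda>z. B (F z) (G z))
     \<le> K * sqrt (L2norm (\<lambda>z. (norm (F z))\<^sup>2) * L2norm (\<lambda>z. (norm (G z))\<^sup>2))"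
proof -
  have "L2norm (\<lambda>z. B (F z) (G z)) \<le> L2norm (\<lambda>z. K *\<^sub>R (norm (F z) * norm (G z)))"
    using K K0 by (intro L2norm_mono dominated_scaleR dominated_mult dominated_norm dominated_bounded_bilinear[OF B] F G)
      (simp add: mult_ac)
  also have "\<dots> = K * L2norm (\<lambda>z. norm (F z) * norm (G z))" using K0 by (simp only: L2norm_scaleR abs_of_nonneg)
  also have "L2norm (\<lambda>z. norm (F z) * norm (G z)) \<le> sqrt (L2norm (\<lambda>z. (norm (F z))\<^sup>2) * L2norm (\<lambda>z. (norm (G z))\<^sup>2))"
    unfolding L2norm_def[of "\<lambda>z. norm (F z) * norm (G z)"]
    using integral_norm_mult_le[OF dominated_norm_power[OF F] dominated_norm_power[OF G], of 2 2]
    by (intro real_sqrt_le_mono) (simp add: power_mult_distrib)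
  finally show ?thesis using K0 by (simp add: mult_left_mono)
qed

lemma L2_tendsto_bilinear:
  assumes B: "bounded_bilinear B" and X: "L2_tendsto X X0 \<F>" "L6_bounded X \<F>"
    and Y: "L2_tendsto Y Y0 \<F>" "L6_bounded Y \<F>"
  shows "L2_tendsto (\<lambda>i z. B (X i z) (Y i z)) (\<lambda>z. B (X0 z) (Y0 z)) \<F>"
  unfolding L2_tendsto_def
proof (intro conjI)
  obtain K where K: "K \<ge> 0" "\<And>x y. norm (B x y) \<le> norm x * norm y * K"
    using bounded_bilinear.nonneg_bounded[OF B] by metis
  have X0: "dominated S X0" and Y0: "dominated S Y0" using X Y by (auto simp: L2_tendsto_def)
  show "dominated S (\<lambda>z. B (X0 z) (Y0 z))" by (intro dominated_bounded_bilinear[OF B] X0 Y0)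
  show "\<forall>\<^sub>F i in \<F>. dominated S (\<lambda>z. B (X i z) (Y i z))"
    using L2_tendsto_dominated[OF X(1)] L2_tendsto_dominated[OF Y(1)]
    by eventually_elim (intro dominated_bounded_bilinear[OF B])
  let ?dX = "\<lambda>i z. X i z - X0 z" and ?dY = "\<lambda>i z. Y i z - Y0 z"
  let ?q = "\<lambda>F. L2norm (\<lambda>z. (norm (F z))\<^sup>2)"
  let ?b = "\<lambda>i. K * sqrt (?q (?dX i) * ?q (?dY i)) + K * sqrt (?q (?dX i) * ?q Y0) + K * sqrt (?q X0 * ?q (?dY i))"
  have ev: "eventually (\<lambda>i. norm (L2norm (\<lambda>z. B (X i z) (Y i z) - B (X0 z) (Y0 z)))
     \<le> ?b i) \<F>"
    using L2_tendsto_dominated[OF X(1)] L2_tendsto_dominated[OF Y(1)]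
  proof eventually_elim
    case (elim i)
    have dX: "dominated S (?dX i)" and dY: "dominated S (?dY i)"
      using elim X0 Y0 by (auto intro: dominated_diff)
    note dB = dominated_bounded_bilinear[OF B]
    have "L2norm (\<lambda>z. B (X i z) (Y i z) - B (X0 z) (Y0 z))
        = L2norm (\<lambda>z. B (?dX i z) (?dY i z) + B (?dX i z) (Y0 z) + B (X0 z) (?dY i z))"
      by (simp only: bilinear_diff_expand[OF B])
    also have "\<dots> \<le> L2norm (\<lambda>z. B (?dX i z) (?dY i z)) + L2norm (\<lambda>z. B (?dX i z) (Y0 z))
        + L2norm (\<lambda>z. B (X0 z) (?dY i z))"
      by (rule order_trans[OF L2norm_triangle add_right_mono[OF L2norm_triangle]])
         (intro dominated_add dB dX dY X0 Y0)+
    finally show ?case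
      using L2norm_bilinear_le[OF K(2) B K(1) dX dY] L2norm_bilinear_le[OF K(2) B K(1) dX Y0]
        L2norm_bilinear_le[OF K(2) B K(1) X0 dY]
      unfolding real_norm_def abs_of_nonneg[OF L2norm_nonneg] by linarith
  qed
  have "(?b
      \<longlongrightarrow> K * sqrt (0 * 0) + K * sqrt (0 * ?q Y0) + K * sqrt (?q X0 * 0)) \<F>"
    by (intro tendsto_intros L4_tendsto X Y)
  then have "(?b
      \<longlongrightarrow> 0) \<F>"
    by (simp only: mult_zero_left mult_zero_right add_0_left real_sqrt_zero)
  from Lim_null_comparison[OF ev this]
  show "((\<lambda>i. L2norm (\<lambda>z. B (X i z) (Y i z) - B (X0 z) (Y0 z))) \<longlongrightarrow> 0) \<F>" .
qed

end

context suitable_functions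
begin

section \<open>Curves along the semigroup\<close>

abbreviation pairing :: "('a \<Rightarrow> complex^'n^'n) \<Rightarrow> ('a \<Rightarrow> complex^'n^'n) \<Rightarrow> real" where
  "pairing F G \<equiv> \<integral>z. trace_form (F z) (G z) \<partial>\<mu>"

abbreviation triple :: "('a \<Rightarrow> complex^'n^'n) \<Rightarrow> ('a \<Rightarrow> complex^'n^'n) \<Rightarrow> ('a \<Rightarrow> complex^'n^'n) \<Rightarrow> real" where
  "triple u v w \<equiv> \<integral>z. trace_form (u z) (v z ** w z) \<partial>\<mu>"

text \<open>Jensen's inequality for the transition law. With stationarity it makes \<open>P\<^sub>t\<close> a contraction in every even moment.\<close>

lemma norm_P_power_le:
  assumes F: "dominated S F" and t: "0 \<le> t" and n: "even n"
  shows "norm (P t F z) ^ n \<le> P t (\<lambda>z. norm (F z) ^ n) z"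
proof -
  interpret prob_space "W z" by (rule prob_law)
  have "norm (P t F z) ^ n \<le> (P t (\<lambda>z. norm (F z)) z) ^ n"
    by (intro power_mono norm_P_le t) simp
  also have "\<dots> \<le> P t (\<lambda>z. norm (F z) ^ n) z"
    unfolding semigroup_op_def
    by (rule jensens_inequality[where I = UNIV and q = "\<lambda>x. x ^ n"])
       (use n in \<open>auto intro!: convex_power_even dominated_integrable_law[OF dominated_norm[OF F] t]
          dominated_integrable_law[OF dominated_norm_power[OF F] t]\<close>)
  finally show ?thesis .
qed

lemma integral_norm_P_power_le:
  assumes F: "dominated S F" and t: "0 \<le> t" and n: "even n"
  shows "(\<integral>z. norm (P t F z) ^ n \<partial>\<mu>) \<le> (\<integral>z. norm (F z) ^ n \<partial>\<mu>)"
  using expectation_mono[OF dominated_norm_power[OF dominated_P[OF F t]] dominated_P[OF dominated_norm_power[OF F] t]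
      norm_P_power_le[OF F t n]] expectation_P[OF dominated_norm_power[OF F] t]
  by simp

lemma L2norm_P_le: "dominated S F \<Longrightarrow> 0 \<le> t \<Longrightarrow> L2norm (P t F) \<le> L2norm F"
  unfolding L2norm_def by (intro real_sqrt_le_mono integral_norm_P_power_le) auto

lemma L2norm_components:
  assumes F: "dominated S F"
  shows "L2norm F = sqrt (\<Sum>b\<in>Basis. \<integral>z. (F z \<bullet> b)\<^sup>2 \<partial>\<mu>)"
proof -
  have "(\<integral>z. (norm (F z))\<^sup>2 \<partial>\<mu>) = (\<integral>z. (\<Sum>b\<in>Basis. (F z \<bullet> b)\<^sup>2) \<partial>\<mu>)"
  proof (intro Bochner_Integration.integral_cong refl)
    fix z
    have "F z \<bullet> F z = (\<Sum>b\<in>Basis. (F z \<bullet> b)\<^sup>2)"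
      by (subst euclidean_inner) (simp only: power2_eq_square)
    then show "(norm (F z))\<^sup>2 = (\<Sum>b\<in>Basis. (F z \<bullet> b)\<^sup>2)" by (simp only: power2_norm_eq_inner)
  qed
  also have "\<dots> = (\<Sum>b\<in>Basis. (\<integral>z. (F z \<bullet> b)\<^sup>2 \<partial>\<mu>))"
    by (intro Bochner_Integration.integral_sum dominated_integrable dominated_power dominated_inner F)
  finally show ?thesis by (simp only: L2norm_def)
qed

lemma generator_L2_tendsto:
  fixes F :: "'a \<Rightarrow> 'b::euclidean_space"
  assumes F: "components_in S F"
  shows "L2_tendsto (\<lambda>t z. (P t F z - F z) /\<^sub>R t) (L F) (at_right 0)"
  unfolding L2_tendsto_def
proof (intro conjI)
  have dF: "dominated S F" by (rule components_in_dominated[OF F])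
  show "dominated S (L F)" by (intro components_in_dominated components_in_L F)
  have dq: "dominated S (\<lambda>z. (P t F z - F z) /\<^sub>R t)" if "0 < t" for t
    using that by (intro dominated_scaleR dominated_diff dominated_P dF) simp
  then show "\<forall>\<^sub>F t in at_right 0. dominated S (\<lambda>z. (P t F z - F z) /\<^sub>R t)"
    by (auto simp: eventually_at_filter)
  let ?I = "\<lambda>b t. \<integral>z. ((P t (\<lambda>z. F z \<bullet> b) z - F z \<bullet> b) / t - L (\<lambda>z. F z \<bullet> b) z)\<^sup>2 \<partial>\<mu>"
  have "L2norm (\<lambda>z. (P t F z - F z) /\<^sub>R t - L F z) = sqrt (\<Sum>b\<in>Basis. ?I b t)" if t: "0 < t" for t
  proof -
    let ?D = "\<lambda>z. (P t F z - F z) /\<^sub>R t - L F z"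
    have D: "dominated S ?D"
      using t by (intro dominated_diff dq components_in_dominated components_in_L F)
    have comp: "?D z \<bullet> b = (P t (\<lambda>z. F z \<bullet> b) z - F z \<bullet> b) / t - L (\<lambda>z. F z \<bullet> b) z" if "b \<in> Basis" for b z
      using t that by (simp add: inner_diff_left P_inner[OF dF] generator_inner[OF _ F] divide_inverse mult.commute)
    have "(\<Sum>b\<in>Basis. \<integral>z. (?D z \<bullet> b)\<^sup>2 \<partial>\<mu>) = (\<Sum>b\<in>Basis. ?I b t)"
      by (intro sum.cong refl) (simp only: comp)
    then show ?thesis by (simp only: L2norm_components[OF D])
  qed
  then have ev: "eventually (\<lambda>t. sqrt (\<Sum>b\<in>Basis. ?I b t) = L2norm (\<lambda>z. (P t F z - F z) /\<^sub>R t - L F z)) (at_right 0)"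
    by (auto simp: eventually_at_filter)
  have "((\<lambda>t. sqrt (\<Sum>b\<in>Basis. ?I b t)) \<longlongrightarrow> sqrt (\<Sum>b\<in>(Basis::'b set). 0)) (at_right 0)"
    by (intro tendsto_real_sqrt tendsto_sum generator_limit_L2 components_in_inner F)
  then have "((\<lambda>t. sqrt (\<Sum>b\<in>Basis. ?I b t)) \<longlongrightarrow> 0) (at_right 0)"
    by (simp only: sum.neutral_const real_sqrt_zero)
  from Lim_transform_eventually[OF this ev]
  show "((\<lambda>t. L2norm (\<lambda>z. (P t F z - F z) /\<^sub>R t - L F z)) \<longlongrightarrow> 0) (at_right 0)" .
qed

lemma P_L2_tendsto_initial:
  assumes F: "components_in S F"
  shows "((\<lambda>t. L2norm (\<lambda>z. P t F z - F z)) \<longlongrightarrow> 0) (at_right 0)"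
proof -
  let ?v = "\<lambda>t z. (P t F z - F z) /\<^sub>R t"
  have dF: "dominated S F" and dL: "dominated S (L F)"
    by (intro components_in_dominated components_in_L F)+
  have "eventually (\<lambda>t. norm (L2norm (\<lambda>z. P t F z - F z)) \<le> t * (L2norm (\<lambda>z. ?v t z - L F z) + L2norm (L F))) (at_right 0)"
    unfolding eventually_at_filter
  proof (intro always_eventually allI impI)
    fix t :: real assume "t \<in> {0<..}"
    then have t: "0 < t" by simp
    have dv: "dominated S (?v t)" using t by (intro dominated_scaleR dominated_diff dominated_P dF) simp
    have 1: "L2norm (\<lambda>z. P t F z - F z) = L2norm (\<lambda>z. t *\<^sub>R ?v t z)" using t by simp
    have 2: "L2norm (\<lambda>z. t *\<^sub>R ?v t z) = t * L2norm (?v t)" using t by (simp only: L2norm_scaleR abs_of_pos)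
    have "L2norm (\<lambda>z. (?v t z - L F z) + L F z) \<le> L2norm (\<lambda>z. ?v t z - L F z) + L2norm (L F)"
      by (intro L2norm_triangle dominated_diff dv dL)
    then have 3: "L2norm (?v t) \<le> L2norm (\<lambda>z. ?v t z - L F z) + L2norm (L F)"
      by (simp only: diff_add_cancel)
    show "norm (L2norm (\<lambda>z. P t F z - F z)) \<le> t * (L2norm (\<lambda>z. ?v t z - L F z) + L2norm (L F))"
      unfolding real_norm_def abs_of_nonneg[OF L2norm_nonneg]
      unfolding 1 2
      using t 3 by (intro mult_left_mono) auto
  qed
  moreover have "((\<lambda>t. t * (L2norm (\<lambda>z. ?v t z - L F z) + L2norm (L F))) \<longlongrightarrow> 0 * (0 + L2norm (L F))) (at_right 0)"
    using generator_L2_tendsto[OF F] unfolding L2_tendsto_def by (intro tendsto_intros) auto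
  then have "((\<lambda>t. t * (L2norm (\<lambda>z. ?v t z - L F z) + L2norm (L F))) \<longlongrightarrow> 0) (at_right 0)"
    by (simp only: mult_zero_left)
  ultimately show ?thesis by (rule Lim_null_comparison)
qed

lemma P_diff_eq:
  assumes F: "dominated S F" and r: "0 \<le> r" and s: "0 \<le> s"
  shows "P (max r s) F z - P (min r s) F z = P (min r s) (\<lambda>z. P \<bar>r - s\<bar> F z - F z) z"
proof -
  have "P (max r s) F z = P (min r s) (P \<bar>r - s\<bar> F) z"
    using P_semigroup[OF F, of "min r s" "\<bar>r - s\<bar>" z] r s by (auto simp: min_def max_def)
  moreover have "P (min r s) (\<lambda>z. P \<bar>r - s\<bar> F z - F z) z = P (min r s) (P \<bar>r - s\<bar> F) z - P (min r s) F z"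
    using r s by (intro P_diff dominated_P F) auto
  ultimately show ?thesis by simp
qed

lemma L2norm_uminus_diff: "L2norm (\<lambda>z. F z - G z) = L2norm (\<lambda>z. G z - F z)"
  by (simp add: L2norm_def norm_minus_commute)

text \<open>By the semigroup law and contractivity, continuity at an arbitrary time reduces to continuity at time zero.\<close>

lemma L2norm_P_diff_le:
  assumes F: "dominated S F" and r: "0 \<le> r" and s: "0 \<le> s"
  shows "L2norm (\<lambda>z. P r F z - P s F z) \<le> L2norm (\<lambda>z. P \<bar>r - s\<bar> F z - F z)"
proof -
  have "L2norm (\<lambda>z. P r F z - P s F z) = L2norm (\<lambda>z. P (max r s) F z - P (min r s) F z)"
    by (cases "r \<le> s") (auto simp: L2norm_uminus_diff[of "P r F"] max_def min_def)
  also have "\<dots> = L2norm (P (min r s) (\<lambda>z. P \<bar>r - s\<bar> F z - F z))"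
    by (simp only: P_diff_eq[OF F r s])
  also have "\<dots> \<le> L2norm (\<lambda>z. P \<bar>r - s\<bar> F z - F z)"
    using r s by (intro L2norm_P_le dominated_diff dominated_P F) auto
  finally show ?thesis .
qed

lemma filterlim_abs_diff_at_right: "filterlim (\<lambda>r::real. \<bar>r - s\<bar>) (at_right 0) (at s within A)"
  unfolding filterlim_at
proof
  show "\<forall>\<^sub>F r in at s within A. \<bar>r - s\<bar> \<in> {0<..} \<and> \<bar>r - s\<bar> \<noteq> 0"
    by (auto simp: eventually_at_filter)
  have "((\<lambda>r. \<bar>r - s\<bar>) \<longlongrightarrow> \<bar>s - s\<bar>) (at s within A)" by (intro tendsto_intros)
  then show "((\<lambda>r. \<bar>r - s\<bar>) \<longlongrightarrow> 0) (at s within A)" by simp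
qed

text \<open>Differentiability in mean square at \<open>s\<close> within \<open>A\<close>, bundled with the continuity and the moment bound that
  product rules for expectations use.\<close>

definition L2_deriv :: "real set \<Rightarrow> (real \<Rightarrow> 'a \<Rightarrow> 'b::euclidean_space) \<Rightarrow> ('a \<Rightarrow> 'b) \<Rightarrow> real \<Rightarrow> bool" where
  "L2_deriv A X X' s \<longleftrightarrow> s \<in> A \<and> (\<forall>r\<in>A. dominated S (X r)) \<and>
     L2_tendsto X (X s) (at s within A) \<and> L6_bounded X (at s within A) \<and>
     L2_tendsto (\<lambda>r z. (X r z - X s z) /\<^sub>R (r - s)) X' (at s within A)"

text \<open>With \<open>m = min r s\<close> and \<open>\<delta> = |r - s|\<close> the difference quotient is \<open>P\<^sub>m ((P\<^sub>\<delta> F - F) / \<delta>)\<close> on both sides of \<open>s\<close>, so the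
  one-sided limit at time zero and contractivity give the two-sided derivative.\<close>

lemma L2_deriv_P:
  assumes F: "components_in S F" and s: "0 \<le> s"
  shows "L2_deriv {0..} (\<lambda>r. P r F) (P s (L F)) s"
proof -
  have dF: "dominated S F" and cL: "components_in S (L F)" and dL: "dominated S (L F)"
    by (intro components_in_dominated components_in_L F)+
  have ev: "\<forall>\<^sub>F r in at s within {0..}. 0 \<le> r \<and> r \<noteq> s" by (auto simp: eventually_at_filter)
  have cont: "((\<lambda>r. L2norm (\<lambda>z. P r G z - P s G z)) \<longlongrightarrow> 0) (at s within {0..})"
    if G: "components_in S G" for G :: "'a \<Rightarrow> 'b"
  proof (rule Lim_null_comparison)
    show "\<forall>\<^sub>F r in at s within {0..}. norm (L2norm (\<lambda>z. P r G z - P s G z)) \<le> L2norm (\<lambda>z. P \<bar>r - s\<bar> G z - G z)"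
      using ev by eventually_elim
        (use L2norm_P_diff_le[OF components_in_dominated[OF G] _ s] in \<open>simp add: L2norm_nonneg\<close>)
    show "((\<lambda>r. L2norm (\<lambda>z. P \<bar>r - s\<bar> G z - G z)) \<longlongrightarrow> 0) (at s within {0..})"
      by (rule filterlim_compose[OF P_L2_tendsto_initial[OF G] filterlim_abs_diff_at_right])
  qed
  have 1: "L2_tendsto (\<lambda>r. P r F) (P s F) (at s within {0..})"
    unfolding L2_tendsto_def
  proof (intro conjI cont F dominated_P dF s)
    show "\<forall>\<^sub>F r in at s within {0..}. dominated S (P r F)"
      using ev by eventually_elim (auto intro: dominated_P dF)
  qed
  have 2: "L6_bounded (\<lambda>r. P r F) (at s within {0..})"
    unfolding L6_bounded_def
    by (rule exI[of _ "\<integral>z. norm (F z) ^ 6 \<partial>\<mu>"], use ev in eventually_elim)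
       (auto intro: integral_norm_P_power_le[OF dF])
  let ?v = "\<lambda>t z. (P t F z - F z) /\<^sub>R t"
  have 3: "L2_tendsto (\<lambda>r z. (P r F z - P s F z) /\<^sub>R (r - s)) (P s (L F)) (at s within {0..})"
    unfolding L2_tendsto_def
  proof (intro conjI)
    show "dominated S (P s (L F))" by (intro dominated_P dL s)
    show "\<forall>\<^sub>F r in at s within {0..}. dominated S (\<lambda>z. (P r F z - P s F z) /\<^sub>R (r - s))"
      using ev by eventually_elim (intro dominated_scaleR dominated_diff dominated_P dF s, auto)
    show "((\<lambda>r. L2norm (\<lambda>z. (P r F z - P s F z) /\<^sub>R (r - s) - P s (L F) z)) \<longlongrightarrow> 0) (at s within {0..})"
    proof (rule Lim_null_comparison)
      show "\<forall>\<^sub>F r in at s within {0..}. norm (L2norm (\<lambda>z. (P r F z - P s F z) /\<^sub>R (r - s) - P s (L F) z))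
         \<le> L2norm (\<lambda>z. ?v \<bar>r - s\<bar> z - L F z) + L2norm (\<lambda>z. P r (L F) z - P s (L F) z)"
        using ev
      proof eventually_elim
        case (elim r)
        define m where "m = min r s"
        define \<delta> where "\<delta> = \<bar>r - s\<bar>"
        have m: "0 \<le> m" and \<delta>: "0 < \<delta>" using elim s by (auto simp: m_def \<delta>_def)
        have dv: "dominated S (?v \<delta>)" using \<delta> by (intro dominated_scaleR dominated_diff dominated_P dF) simp
        have quot: "(P r F z - P s F z) /\<^sub>R (r - s) = P m (?v \<delta>) z" for z
        proof -
          have 1: "P m (?v \<delta>) z = P m (\<lambda>z. P \<delta> F z - F z) z /\<^sub>R \<delta>"
            using m \<delta> by (intro P_bounded_linear[OF bounded_linear_scaleR_right] dominated_diff dominated_P dF) auto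
          have 2: "P m (\<lambda>z. P \<delta> F z - F z) z = P (max r s) F z - P (min r s) F z"
            unfolding m_def \<delta>_def by (rule P_diff_eq[symmetric, OF dF conjunct1[OF elim] s])
          have 3: "(P (max r s) F z - P (min r s) F z) /\<^sub>R \<delta> = (P r F z - P s F z) /\<^sub>R (r - s)"
          proof (cases "r \<le> s")
            case True
            have "(P s F z - P r F z) /\<^sub>R (s - r) = (P r F z - P s F z) /\<^sub>R (r - s)"
              by (metis minus_diff_eq inverse_minus_eq scaleR_minus_left scaleR_minus_right)
            moreover have "\<delta> = s - r" "max r s = s" "min r s = r" using True by (simp_all add: \<delta>_def)
            ultimately show ?thesis by metis
          qed (simp add: \<delta>_def max_def min_def)
          show ?thesis by (simp only: 1 2 3)
        qed
        have 1: "L2norm (\<lambda>z. (P r F z - P s F z) /\<^sub>R (r - s) - P s (L F) z)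
            = L2norm (\<lambda>z. P m (\<lambda>z. ?v \<delta> z - L F z) z + (P m (L F) z - P s (L F) z))"
          by (simp only: quot P_diff[OF dv dL m] add_diff_eq diff_add_cancel)
        have 2: "L2norm (\<lambda>z. P m (\<lambda>z. ?v \<delta> z - L F z) z + (P m (L F) z - P s (L F) z))
            \<le> L2norm (P m (\<lambda>z. ?v \<delta> z - L F z)) + L2norm (\<lambda>z. P m (L F) z - P s (L F) z)"
          by (intro L2norm_triangle dominated_P dominated_diff dv dL m s)
        have 3: "L2norm (P m (\<lambda>z. ?v \<delta> z - L F z)) \<le> L2norm (\<lambda>z. ?v \<delta> z - L F z)"
          by (intro L2norm_P_le dominated_diff dv dL m)
        have 4: "L2norm (\<lambda>z. P m (L F) z - P s (L F) z) \<le> L2norm (\<lambda>z. P r (L F) z - P s (L F) z)"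
        proof (cases "r \<le> s")
          case False
          then have "m = s" by (simp add: m_def)
          then have "L2norm (\<lambda>z. P m (L F) z - P s (L F) z) = 0" by (simp add: L2norm_def)
          then show ?thesis by (simp only: L2norm_nonneg)
        next
          case True
          then have "m = r" by (simp add: m_def)
          then show ?thesis by (simp only: order_refl)
        qed
        show ?case
          unfolding real_norm_def abs_of_nonneg[OF L2norm_nonneg] \<delta>_def[symmetric] using 1 2 3 4 by linarith
      qed
      have "((\<lambda>r. L2norm (\<lambda>z. ?v \<bar>r - s\<bar> z - L F z) + L2norm (\<lambda>z. P r (L F) z - P s (L F) z)) \<longlongrightarrow> 0 + 0) (at s within {0..})"
      proof (intro tendsto_add cont cL)
        have "((\<lambda>t. L2norm (\<lambda>z. ?v t z - L F z)) \<longlongrightarrow> 0) (at_right 0)"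
          using generator_L2_tendsto[OF F] by (simp only: L2_tendsto_def)
        then show "((\<lambda>r. L2norm (\<lambda>z. ?v \<bar>r - s\<bar> z - L F z)) \<longlongrightarrow> 0) (at s within {0..})"
          by (rule filterlim_compose[OF _ filterlim_abs_diff_at_right])
      qed
      then show "((\<lambda>r. L2norm (\<lambda>z. ?v \<bar>r - s\<bar> z - L F z) + L2norm (\<lambda>z. P r (L F) z - P s (L F) z)) \<longlongrightarrow> 0) (at s within {0..})"
        by (simp only: add_0)
    qed
  qed
  show ?thesis unfolding L2_deriv_def using 1 2 3 s by (auto intro: dominated_P dF)
qed

lemma L6_bounded_subst: "L6_bounded X \<F> \<Longrightarrow> filterlim h \<F> \<G> \<Longrightarrow> L6_bounded (\<lambda>i. X (h i)) \<G>"
  unfolding L6_bounded_def using eventually_compose_filterlim by blast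

lemma L2_deriv_subset:
  assumes "L2_deriv A X X' s" "s \<in> B" "B \<subseteq> A"
  shows "L2_deriv B X X' s"
proof -
  have f: "filterlim (\<lambda>r. r) (at s within A) (at s within B)"
    using assms(3) by (simp add: filterlim_def at_le)
  show ?thesis using assms L2_tendsto_subst[OF _ f] L6_bounded_subst[OF _ f]
    unfolding L2_deriv_def by blast
qed

lemma L2_tendsto_uminus: "L2_tendsto X Y \<F> \<Longrightarrow> L2_tendsto (\<lambda>i z. - X i z) (\<lambda>z. - Y z) \<F>"
proof -
  assume X: "L2_tendsto X Y \<F>"
  have "dominated S (\<lambda>z. - Y z)" using dominated_scaleR[of Y "-1"] X by (simp add: L2_tendsto_def)
  moreover have "\<forall>\<^sub>F i in \<F>. dominated S (\<lambda>z. - X i z)"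
    using L2_tendsto_dominated[OF X] by eventually_elim (use dominated_scaleR[of _ "-1"] in simp)
  moreover have "L2norm (\<lambda>z. - X i z - - Y z) = L2norm (\<lambda>z. X i z - Y z)" for i
    by (simp add: L2norm_def norm_minus_commute)
  ultimately show ?thesis using X by (simp add: L2_tendsto_def)
qed

lemma L2_deriv_P_reverse:
  assumes F: "components_in S F" and s: "s \<in> {0..t}"
  shows "L2_deriv {0..t} (\<lambda>r. P (t - r) F) (\<lambda>z. - P (t - s) (L F) z) s"
proof -
  have h: "filterlim (\<lambda>r. t - r) (at (t - s) within {0..}) (at s within {0..t})"
    unfolding filterlim_at
  proof
    show "\<forall>\<^sub>F r in at s within {0..t}. t - r \<in> {0..} \<and> t - r \<noteq> t - s"
      by (auto simp: eventually_at_filter)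
    show "((\<lambda>r. t - r) \<longlongrightarrow> t - s) (at s within {0..t})" by (intro tendsto_intros)
  qed
  have d: "L2_deriv {0..} (\<lambda>r. P r F) (P (t - s) (L F)) (t - s)"
    by (rule L2_deriv_P[OF F]) (use s in simp)
  have "L2_tendsto (\<lambda>r z. - ((P (t - r) F z - P (t - s) F z) /\<^sub>R ((t - r) - (t - s)))) (\<lambda>z. - P (t - s) (L F) z) (at s within {0..t})"
    using d unfolding L2_deriv_def by (intro L2_tendsto_uminus L2_tendsto_subst[OF _ h]) blast
  moreover have "- ((x - y) /\<^sub>R ((t - r) - (t - s))) = (x - y) /\<^sub>R (r - s)" for x y :: 'b and r
  proof -
    have "(t - r) - (t - s) = - (r - s)" by simp
    then show ?thesis by (simp only: inverse_minus_eq scaleR_minus_left minus_minus)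
  qed
  ultimately have "L2_tendsto (\<lambda>r z. (P (t - r) F z - P (t - s) F z) /\<^sub>R (r - s)) (\<lambda>z. - P (t - s) (L F) z) (at s within {0..t})"
    by (simp only:)
  moreover have "\<forall>r\<in>{0..t}. dominated S (P (t - r) F)"
    by (auto intro!: dominated_P components_in_dominated[OF F])
  ultimately show ?thesis
    using d s L2_tendsto_subst[OF _ h] L6_bounded_subst[OF _ h] unfolding L2_deriv_def by blast
qed

lemma has_derivative_integral_bilinear:
  fixes B :: "'b::euclidean_space \<Rightarrow> 'c::euclidean_space \<Rightarrow> real"
  assumes B: "bounded_bilinear B" and X: "L2_deriv A X X' s" and G: "dominated S G"
  shows "((\<lambda>r. \<integral>z. B (X r z) (G z) \<partial>\<mu>) has_real_derivative (\<integral>z. B (X' z) (G z) \<partial>\<mu>)) (at s within A)"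
  unfolding has_field_derivative_iff
proof (rule Lim_transform_eventually)
  show "((\<lambda>r. \<integral>z. B ((X r z - X s z) /\<^sub>R (r - s)) (G z) \<partial>\<mu>) \<longlongrightarrow> (\<integral>z. B (X' z) (G z) \<partial>\<mu>)) (at s within A)"
    using X unfolding L2_deriv_def
    by (intro tendsto_integral_bilinear[OF B] L2_tendsto_const G) blast
  show "\<forall>\<^sub>F r in at s within A. (\<integral>z. B ((X r z - X s z) /\<^sub>R (r - s)) (G z) \<partial>\<mu>)
      = ((\<integral>z. B (X r z) (G z) \<partial>\<mu>) - (\<integral>z. B (X s z) (G z) \<partial>\<mu>)) / (r - s)"
    unfolding eventually_at_filter
  proof (intro always_eventually allI impI)
    fix r assume "r \<in> A"
    then have d: "dominated S (X r)" "dominated S (X s)" using X by (auto simp: L2_deriv_def)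
    show "(\<integral>z. B ((X r z - X s z) /\<^sub>R (r - s)) (G z) \<partial>\<mu>)
      = ((\<integral>z. B (X r z) (G z) \<partial>\<mu>) - (\<integral>z. B (X s z) (G z) \<partial>\<mu>)) / (r - s)"
      using dominated_integrable[OF dominated_bounded_bilinear[OF B d(1) G]]
        dominated_integrable[OF dominated_bounded_bilinear[OF B d(2) G]]
      by (simp add: bounded_bilinear.scaleR_left[OF B] bounded_bilinear.diff_left[OF B] divide_inverse mult.commute)
  qed
qed

text \<open>Product rule. In each term only one factor is a difference quotient; by cyclicity of the trace it can be put
  first, and it is then paired with a product of two curves that converges in mean square.\<close>

lemma has_derivative_integral_trilinear:
  fixes X Y V :: "real \<Rightarrow> 'a \<Rightarrow> complex^'n^'n"
  assumes X: "L2_deriv A X X' s" and Y: "L2_deriv A Y Y' s" and V: "L2_deriv A V V' s"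
  shows "((\<lambda>r. triple (X r) (Y r) (V r)) has_real_derivative
    (triple X' (Y s) (V s)) + triple (X s) Y' (V s)
      + triple (X s) (Y s) V') (at s within A)"
  unfolding has_field_derivative_iff
proof (rule Lim_transform_eventually)
  let ?F = "at s within A"
  let ?q = "\<lambda>X r z. (X r z - X s z) /\<^sub>R (r - s)"
  note bb = bounded_bilinear_trace_form and mb = bounded_bilinear_matrix_mult
  have sA: "s \<in> A" using X by (simp add: L2_deriv_def)
  have const: "L2_tendsto (\<lambda>r. U s) (U s) ?F" "L6_bounded (\<lambda>r. U s) ?F" if "L2_deriv A U U' s"
    for U :: "real \<Rightarrow> 'a \<Rightarrow> complex^'n^'n" and U'
  proof -
    show "L2_tendsto (\<lambda>r. U s) (U s) ?F"
      using that by (intro L2_tendsto_const) (auto simp: L2_deriv_def)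
    show "L6_bounded (\<lambda>r. U s) ?F"
      unfolding L6_bounded_def by (rule exI[of _ "\<integral>z. norm (U s z) ^ 6 \<partial>\<mu>"]) simp
  qed
  have curve: "L2_tendsto U (U s) ?F" "L6_bounded U ?F" "L2_tendsto (?q U) U' ?F" if "L2_deriv A U U' s"
    for U :: "real \<Rightarrow> 'a \<Rightarrow> complex^'n^'n" and U'
    using that by (auto simp: L2_deriv_def)
  have cyc: "triple (X s) Y' (V s) = triple Y' (V s) (X s)"
    "triple (X s) (Y s) V' = triple V' (X s) (Y s)"
    by (intro Bochner_Integration.integral_cong refl trace_form_cyclic trace_form_cyclic[symmetric])+
  show "((\<lambda>r. triple (?q X r) (Y r) (V r) + triple (?q Y r) (V r) (X s)
      + triple (?q V r) (X s) (Y s)) \<longlongrightarrow>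
    triple X' (Y s) (V s) + triple (X s) Y' (V s)
      + triple (X s) (Y s) V') ?F"
    unfolding cyc
    by (intro tendsto_add tendsto_integral_bilinear[OF bb] L2_tendsto_bilinear[OF mb]
        curve[OF X] curve[OF Y] curve[OF V] const[OF X] const[OF Y])
  show "\<forall>\<^sub>F r in ?F. (triple (?q X r) (Y r) (V r)) + triple (?q Y r) (V r) (X s)
      + triple (?q V r) (X s) (Y s)
    = (triple (X r) (Y r) (V r) - triple (X s) (Y s) (V s)) / (r - s)"
    unfolding eventually_at_filter
  proof (intro always_eventually allI impI)
    fix r assume r: "r \<in> A"
    have dom: "dominated S (X u)" "dominated S (Y u)" "dominated S (V u)" if "u \<in> A" for u
      using X Y V that by (auto simp: L2_deriv_def)
    have int: "integrable \<mu> (\<lambda>z. trace_form (X u z) (Y v z ** V w z))" if "u \<in> A" "v \<in> A" "w \<in> A" for u v w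
      by (intro dominated_integrable dominated_bounded_bilinear[OF bb] dominated_bounded_bilinear[OF mb] dom that)
    have c1: "trace_form (Y u z) (V v z ** X w z) = trace_form (X w z) (Y u z ** V v z)" for u v w z
      by (rule trace_form_cyclic[symmetric])
    have c2: "trace_form (V u z) (X v z ** Y w z) = trace_form (X v z) (Y w z ** V u z)" for u v w z
      by (rule trace_form_cyclic)
    have "triple (?q X r) (Y r) (V r)
        = (triple (X r) (Y r) (V r) - triple (X s) (Y r) (V r)) / (r - s)"
      using int[OF r r r] int[OF sA r r]
      by (simp add: trace_form.scaleR_left trace_form.diff_left divide_inverse mult.commute)
    moreover have "triple (?q Y r) (V r) (X s)
        = (triple (X s) (Y r) (V r) - triple (X s) (Y s) (V r)) / (r - s)"
      using int[OF sA r r] int[OF sA sA r]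
      by (simp add: trace_form.scaleR_left trace_form.diff_left divide_inverse mult.commute c1)
    moreover have "triple (?q V r) (X s) (Y s)
        = (triple (X s) (Y s) (V r) - triple (X s) (Y s) (V s)) / (r - s)"
      using int[OF sA sA r] int[OF sA sA sA]
      by (simp add: trace_form.scaleR_left trace_form.diff_left divide_inverse mult.commute c2)
    ultimately show "triple (?q X r) (Y r) (V r) + triple (?q Y r) (V r) (X s)
        + triple (?q V r) (X s) (Y s)
      = (triple (X r) (Y r) (V r) - triple (X s) (Y s) (V s)) / (r - s)"
      by (simp only: add_divide_distrib[symmetric]) simp
  qed
qed

text \<open>Pass to the limit in the reversibility of the difference quotients.\<close>

lemma generator_symmetric:
  fixes B :: "'b::euclidean_space \<Rightarrow> 'c::euclidean_space \<Rightarrow> real"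
  assumes B: "bounded_bilinear B" and U: "components_in S U" and V: "components_in S V"
  shows "(\<integral>z. B (L U z) (V z) \<partial>\<mu>) = (\<integral>z. B (U z) (L V z) \<partial>\<mu>)"
proof (rule tendsto_unique)
  have dU: "dominated S U" and dV: "dominated S V" by (intro components_in_dominated U V)+
  show "((\<lambda>t. \<integral>z. B ((P t U z - U z) /\<^sub>R t) (V z) \<partial>\<mu>) \<longlongrightarrow> (\<integral>z. B (L U z) (V z) \<partial>\<mu>)) (at_right 0)"
    by (intro tendsto_integral_bilinear[OF B] L2_tendsto_const generator_L2_tendsto U dV)
  have "((\<lambda>t. \<integral>z. B (U z) ((P t V z - V z) /\<^sub>R t) \<partial>\<mu>) \<longlongrightarrow> (\<integral>z. B (U z) (L V z) \<partial>\<mu>)) (at_right 0)"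
    by (intro tendsto_integral_bilinear[OF B] L2_tendsto_const generator_L2_tendsto V dU)
  then show "((\<lambda>t. \<integral>z. B ((P t U z - U z) /\<^sub>R t) (V z) \<partial>\<mu>) \<longlongrightarrow> (\<integral>z. B (U z) (L V z) \<partial>\<mu>)) (at_right 0)"
  proof (rule Lim_transform_eventually)
    show "\<forall>\<^sub>F t in at_right 0. (\<integral>z. B (U z) ((P t V z - V z) /\<^sub>R t) \<partial>\<mu>) = (\<integral>z. B ((P t U z - U z) /\<^sub>R t) (V z) \<partial>\<mu>)"
      unfolding eventually_at_filter
    proof (intro always_eventually allI impI)
      fix t :: real assume "t \<in> {0<..}"
      then have t: "0 \<le> t" by simp
      note int = dominated_integrable[OF dominated_bounded_bilinear[OF B]]
      show "(\<integral>z. B (U z) ((P t V z - V z) /\<^sub>R t) \<partial>\<mu>) = (\<integral>z. B ((P t U z - U z) /\<^sub>R t) (V z) \<partial>\<mu>)"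
        using int[OF dU dV] int[OF dU dominated_P[OF dV t]] int[OF dominated_P[OF dU t] dV]
        by (simp add: bounded_bilinear.scaleR_left[OF B] bounded_bilinear.diff_left[OF B]
            bounded_bilinear.scaleR_right[OF B] bounded_bilinear.diff_right[OF B] reversible_bilinear[OF B dU dV t])
    qed
  qed
qed simp

end

section \<open>The carre du champ operators\<close>

lemma components_in_matrix_iff:
  fixes F :: "'a \<Rightarrow> complex^'n^'n"
  shows "components_in S F \<longleftrightarrow> (\<forall>i j. (\<lambda>z. Re (F z $ i $ j)) \<in> S \<and> (\<lambda>z. Im (F z $ i $ j)) \<in> S)"
proof -
  have "components_in S F \<longleftrightarrow> (\<forall>i j. \<forall>u\<in>{1, \<i>}. (\<lambda>z. F z \<bullet> axis i (axis j u)) \<in> S)"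
    unfolding components_in_def Basis_vec_def Basis_complex_def by blast
  then show ?thesis by (simp add: inner_axis inner_complex_def)
qed

lemma suitable_iff: "suitable S f \<longleftrightarrow> (\<forall>z. hermitian (f z)) \<and> components_in S f"
  by (simp add: suitable_def components_in_matrix_iff)

lemma pos_semidef_square: "hermitian A \<Longrightarrow> pos_semidef (A ** A)"
proof -
  assume "hermitian A"
  then obtain U l where U: "unitary U" "A = diagonalize U l" using spectral_decomposition by metis
  then show ?thesis by (simp add: diagonalize_mult pos_semidef_diagonalize)
qed

lemma hermitian_diff: "hermitian A \<Longrightarrow> hermitian B \<Longrightarrow> hermitian (A - B)"
  by (simp add: hermitian_def ctranspose_diff)

lemma bounded_linear_ctranspose: "bounded_linear (ctranspose :: complex^'n^'m \<Rightarrow> complex^'m^'n)"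
  by (simp add: linear_ctranspose linear_linear)

lemma bounded_linear_quadratic_form: "bounded_linear (\<lambda>A::complex^'n^'n. Re (cinner x (A *v x)))"
  by (simp add: linear_quadratic_form linear_linear)

lemma bounded_linear_Re_trace: "bounded_linear (\<lambda>A::complex^'n^'n. Re (trace A))"
  by (simp add: linear_Re_trace linear_linear)

lemma pos_semidef_tendsto:
  assumes lim: "(F \<longlongrightarrow> A) \<F>" and ev: "\<forall>\<^sub>F i in \<F>. pos_semidef (F i)" and nt: "\<F> \<noteq> bot"
  shows "pos_semidef A"
  unfolding pos_semidef_iff hermitian_def
proof safe
  have "((\<lambda>i. ctranspose (F i)) \<longlongrightarrow> ctranspose A) \<F>"
    by (rule bounded_linear.tendsto[OF bounded_linear_ctranspose lim])
  moreover have "\<forall>\<^sub>F i in \<F>. ctranspose (F i) = F i"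
    using ev by eventually_elim (simp add: pos_semidef_iff hermitian_def)
  ultimately have "(F \<longlongrightarrow> ctranspose A) \<F>" by (rule Lim_transform_eventually)
  then show "ctranspose A = A" by (rule tendsto_unique[OF nt _ lim])
  fix x
  show "0 \<le> Re (cinner x (A *v x))"
  proof (rule tendsto_lowerbound[OF bounded_linear.tendsto[OF bounded_linear_quadratic_form lim] _ nt])
    show "\<forall>\<^sub>F i in \<F>. 0 \<le> Re (cinner x (F i *v x))"
      using ev by eventually_elim (simp add: pos_semidef_iff)
  qed
qed

lemma pos_semidef_scaleR: "pos_semidef A \<Longrightarrow> 0 \<le> a \<Longrightarrow> pos_semidef (a *\<^sub>R A)"
  unfolding pos_semidef_iff hermitian_def
  by (simp add: ctranspose_scaleR linear_cmul[OF linear_quadratic_form])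

context suitable_functions
begin

abbreviation Gamma :: "('a \<Rightarrow> complex^'n^'n) \<Rightarrow> ('a \<Rightarrow> complex^'n^'n) \<Rightarrow> 'a \<Rightarrow> complex^'n^'n" where
  "Gamma f g \<equiv> carre_du_champ W Z f g"

abbreviation Gamma2 :: "('a \<Rightarrow> complex^'n^'n) \<Rightarrow> ('a \<Rightarrow> complex^'n^'n) \<Rightarrow> 'a \<Rightarrow> complex^'n^'n" where
  "Gamma2 f g \<equiv> carre_du_champ2 W Z f g"

lemmas dominated_matrix_mult = dominated_bounded_bilinear[OF bounded_bilinear_matrix_mult]
lemmas dominated_trace_form = dominated_bounded_bilinear[OF bounded_bilinear_trace_form]
lemmas components_in_matrix_mult = components_in_bounded_bilinear[OF bounded_bilinear_matrix_mult]
lemmas integrable_trace_form = dominated_integrable[OF dominated_trace_form]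

lemma components_in_Gamma:
  fixes f g :: "'a \<Rightarrow> complex^'n^'n"
  assumes "components_in S f" "components_in S g"
  shows "components_in S (Gamma f g)"
  unfolding carre_du_champ_def
  by (intro components_in_scaleR components_in_diff components_in_L components_in_matrix_mult assms)

lemma components_in_Gamma2:
  fixes f g :: "'a \<Rightarrow> complex^'n^'n"
  assumes "components_in S f" "components_in S g"
  shows "components_in S (Gamma2 f g)"
  unfolding carre_du_champ2_def
  by (intro components_in_scaleR components_in_diff components_in_L components_in_Gamma assms)

lemma P_hermitian:
  assumes F: "dominated S F" and t: "0 \<le> t" and h: "\<And>y. hermitian (F y)"
  shows "hermitian (P t F z)"
proof -
  have "ctranspose (P t F z) = P t (\<lambda>y. ctranspose (F y)) z"
    by (rule P_bounded_linear[OF bounded_linear_ctranspose F t, symmetric])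
  also have "(\<lambda>y. ctranspose (F y)) = F" using h by (simp add: hermitian_def)
  finally show ?thesis by (simp add: hermitian_def)
qed

lemma P_pos_semidef:
  assumes F: "dominated S F" and t: "0 \<le> t" and h: "\<And>y. pos_semidef (F y)"
  shows "pos_semidef (P t F z)"
  unfolding pos_semidef_iff
proof safe
  show "hermitian (P t F z)" using h by (intro P_hermitian F t) (simp add: pos_semidef_iff)
  fix x
  have "0 = P t (\<lambda>y. 0::real) z" by (simp only: P_const)
  also have "\<dots> \<le> P t (\<lambda>y. Re (cinner x (F y *v x))) z"
    using h by (intro P_mono dominated_const dominated_bounded_linear[OF bounded_linear_quadratic_form F] t)
      (simp add: pos_semidef_iff)
  also have "\<dots> = Re (cinner x (P t F z *v x))"
    by (rule P_bounded_linear[OF bounded_linear_quadratic_form F t])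
  finally show "0 \<le> Re (cinner x (P t F z *v x))" .
qed

lemma expectation_hermitian:
  assumes F: "dominated S F" and h: "\<And>y. hermitian (F y)"
  shows "hermitian (\<integral>z. F z \<partial>\<mu>)"
proof -
  have "ctranspose (\<integral>z. F z \<partial>\<mu>) = (\<integral>z. ctranspose (F z) \<partial>\<mu>)"
    by (rule integral_bounded_linear[OF bounded_linear_ctranspose dominated_integrable[OF F], symmetric])
  also have "(\<lambda>y. ctranspose (F y)) = F" using h by (simp add: hermitian_def)
  finally show ?thesis by (simp add: hermitian_def)
qed

text \<open>The conditional second moment \<open>E [(f(Z\<^sub>t) - f(Z\<^sub>0))\<^sup>2 | Z\<^sub>0 = z]\<close> of the increment, which is \<open>2 t \<Gamma>(f)(z)\<close> to first order
  in \<open>t\<close>.\<close>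

definition increment_square :: "real \<Rightarrow> ('a \<Rightarrow> complex^'n^'n) \<Rightarrow> 'a \<Rightarrow> complex^'n^'n" where
  "increment_square t f z = P t (\<lambda>y. (f y - f z) ** (f y - f z)) z"

lemma increment_square_eq:
  assumes f: "dominated S f" and t: "0 \<le> t"
  shows "increment_square t f z
    = P t (\<lambda>y. f y ** f y) z - f z ** P t f z - P t f z ** f z + f z ** f z"
proof -
  note lin = P_bounded_linear[OF matrix_mult.bounded_linear_left f t]
    P_bounded_linear[OF matrix_mult.bounded_linear_right f t]
  note dom = dominated_add dominated_diff dominated_matrix_mult f dominated_const
  show ?thesis
    unfolding increment_square_def
    by (simp add: matrix_mult.diff_left matrix_mult.diff_right P_add P_diff lin P_const dom t)
qed

lemma dominated_increment_square:
  assumes f: "dominated S f" and t: "0 \<le> t"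
  shows "dominated S (increment_square t f)"
proof -
  have "dominated S (\<lambda>z. P t (\<lambda>y. f y ** f y) z - f z ** P t f z - P t f z ** f z + f z ** f z)"
    by (intro dominated_add dominated_diff dominated_matrix_mult dominated_P f t)
  then show ?thesis by (simp only: increment_square_eq[OF f t, symmetric])
qed

lemma increment_square_quotient:
  assumes f: "dominated S f" and t: "0 < t"
  shows "increment_square t f z /\<^sub>R t
    = (P t (\<lambda>y. f y ** f y) z - f z ** f z) /\<^sub>R t - f z ** ((P t f z - f z) /\<^sub>R t) - ((P t f z - f z) /\<^sub>R t) ** f z"
  unfolding increment_square_eq[OF f less_imp_le[OF t]]
  by (simp add: matrix_mult.diff_left matrix_mult.diff_right matrix_mult.scaleR_left matrix_mult.scaleR_right
      scaleR_diff_right scaleR_add_right)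

lemma increment_square_tendsto:
  assumes f: "components_in S f"
  shows "((\<lambda>t. increment_square t f z /\<^sub>R t) \<longlongrightarrow> 2 *\<^sub>R Gamma f f z) (at_right 0)"
proof (rule Lim_transform_eventually)
  have "((\<lambda>t. (P t (\<lambda>y. f y ** f y) z - f z ** f z) /\<^sub>R t - f z ** ((P t f z - f z) /\<^sub>R t) - ((P t f z - f z) /\<^sub>R t) ** f z)
     \<longlongrightarrow> L (\<lambda>y. f y ** f y) z - f z ** L f z - L f z ** f z) (at_right 0)"
    by (intro tendsto_diff matrix_mult.tendsto tendsto_const generator_tendsto f components_in_matrix_mult)
  then show "((\<lambda>t. (P t (\<lambda>y. f y ** f y) z - f z ** f z) /\<^sub>R t - f z ** ((P t f z - f z) /\<^sub>R t) - ((P t f z - f z) /\<^sub>R t) ** f z)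
     \<longlongrightarrow> 2 *\<^sub>R Gamma f f z) (at_right 0)"
    by (simp add: carre_du_champ_def)
  show "\<forall>\<^sub>F t in at_right 0. (P t (\<lambda>y. f y ** f y) z - f z ** f z) /\<^sub>R t - f z ** ((P t f z - f z) /\<^sub>R t) - ((P t f z - f z) /\<^sub>R t) ** f z
      = increment_square t f z /\<^sub>R t"
    unfolding eventually_at_filter
    by (intro always_eventually allI impI increment_square_quotient[symmetric] components_in_dominated f) simp
qed

text \<open>A limit of conditional second moments of Hermitian increments.\<close>

lemma Gamma_pos_semidef:
  assumes f: "components_in S f" and h: "\<And>z. hermitian (f z)"
  shows "pos_semidef (Gamma f f z)"
proof -
  have "pos_semidef (2 *\<^sub>R Gamma f f z)"
  proof (rule pos_semidef_tendsto[OF increment_square_tendsto[OF f]])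
    show "\<forall>\<^sub>F t in at_right 0. pos_semidef (increment_square t f z /\<^sub>R t)"
      unfolding eventually_at_filter increment_square_def
    proof (intro always_eventually allI impI pos_semidef_scaleR P_pos_semidef pos_semidef_square hermitian_diff h)
      show "dominated S (\<lambda>y. (f y - f z) ** (f y - f z))"
        by (intro dominated_matrix_mult dominated_diff dominated_const components_in_dominated f)
    qed auto
  qed simp
  then have "pos_semidef ((1/2) *\<^sub>R (2 *\<^sub>R Gamma f f z))" by (rule pos_semidef_scaleR) simp
  then show ?thesis by simp
qed

text \<open>Moving the outer generator onto the test function turns the expectation of \<open>\<Gamma>\<close> into traces of threefold
  products, without a generator applied to a product. In this form it can be differentiated along the
  semigroup.\<close>

lemma integral_Gamma:
  fixes f g h :: "'a \<Rightarrow> complex^'n^'n"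
  assumes f: "components_in S f" and g: "components_in S g" and h: "components_in S h"
  shows "2 * pairing (Gamma f g) h
    = triple f g (L h) - triple f (L g) h
      - triple (L f) g h"
proof -
  note comp = f g h components_in_L components_in_matrix_mult
  have "2 * pairing (Gamma f g) h = pairing (L (\<lambda>y. f y ** g y)) h
      - pairing (\<lambda>z. f z ** L g z) h - pairing (\<lambda>z. L f z ** g z) h"
    unfolding carre_du_champ_def
    by (simp add: trace_form.scaleR_left trace_form.diff_left integrable_trace_form components_in_dominated comp)
  also have "pairing (L (\<lambda>y. f y ** g y)) h = pairing (\<lambda>z. f z ** g z) (L h)"
    by (intro generator_symmetric[OF bounded_bilinear_trace_form] comp)
  finally show ?thesis by (simp only: trace_form_assoc)
qed

lemma integral_Gamma2:
  fixes f h :: "'a \<Rightarrow> complex^'n^'n"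
  assumes f: "components_in S f" and h: "components_in S h"
  shows "2 * pairing (Gamma2 f f) h
    = pairing (Gamma f f) (L h) - pairing (Gamma f (L f)) h
      - pairing (Gamma (L f) f) h"
proof -
  note comp = f h components_in_L components_in_Gamma
  have "2 * pairing (Gamma2 f f) h = pairing (L (Gamma f f)) h
      - pairing (Gamma f (L f)) h - pairing (Gamma (L f) f) h"
    unfolding carre_du_champ2_def
    by (simp add: trace_form.scaleR_left trace_form.diff_left integrable_trace_form components_in_dominated comp)
  also have "pairing (L (Gamma f f)) h = pairing (Gamma f f) (L h)"
    by (intro generator_symmetric[OF bounded_bilinear_trace_form] comp)
  finally show ?thesis .
qed

text \<open>The product rule yields nine terms. They are the ones obtained by expanding \<open>\<Gamma>\<^sub>2\<close> by its definition and moving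
  every outer generator onto the test function.\<close>

lemma Gamma2_derivative:
  fixes f h :: "'a \<Rightarrow> complex^'n^'n"
  assumes f: "components_in S f" and h: "components_in S h" and s: "s \<in> {0..t}"
  shows "((\<lambda>r. pairing (Gamma (P (t - r) f) (P (t - r) f)) (P r h)) has_real_derivative
     2 * pairing (Gamma2 (P (t - s) f) (P (t - s) f)) (P s h)) (at s within {0..t})"
proof -
  define a where "a = P (t - s) f"
  define b where "b = P (t - s) (L f)"
  define e where "e = P (t - s) (L (L f))"
  define k0 where "k0 = P s h"
  define k1 where "k1 = P s (L h)"
  define k2 where "k2 = P s (L (L h))"
  have ts: "0 \<le> t - s" "0 \<le> s" using s by auto
  note cL = components_in_L
  have ca: "components_in S a" "components_in S b" "components_in S k0" "components_in S k1"
    unfolding a_def b_def k0_def k1_def by (intro components_in_P f h cL ts)+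
  have La: "L a = b" "L b = e" "L k0 = k1" "L k1 = k2"
    unfolding a_def b_def e_def k0_def k1_def k2_def by (intro L_P_commute f h cL ts)+
  have rev: "L2_deriv {0..t} (\<lambda>r. P (t - r) u) (\<lambda>z. - P (t - s) (L u) z) s"
    if "components_in S u" for u :: "'a \<Rightarrow> complex^'n^'n"
    by (rule L2_deriv_P_reverse[OF that s])
  have fwd: "L2_deriv {0..t} (\<lambda>r. P r u) (P s (L u)) s"
    if "components_in S u" for u :: "'a \<Rightarrow> complex^'n^'n"
    by (rule L2_deriv_subset[OF L2_deriv_P[OF that ts(2)]]) (use s in auto)
  have neg: "triple (\<lambda>z. - u z) v w = - triple u v w"
    "triple u (\<lambda>z. - v z) w = - triple u v w" for u v w :: "'a \<Rightarrow> complex^'n^'n"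
    by (simp_all add: trace_form.minus_left trace_form.minus_right matrix_mult.minus_left)
  let ?J = "\<lambda>r. triple (P (t - r) f) (P (t - r) f) (P r (L h)) - triple (P (t - r) f) (P (t - r) (L f)) (P r h)
         - triple (P (t - r) (L f)) (P (t - r) f) (P r h)"
  have J: "pairing (Gamma (P (t - r) f) (P (t - r) f)) (P r h) = ?J r / 2" if "r \<in> {0..t}" for r
  proof -
    have r: "0 \<le> t - r" "0 \<le> r" using that by auto
    show ?thesis
      using integral_Gamma[OF components_in_P[OF f r(1)] components_in_P[OF f r(1)] components_in_P[OF h r(2)]]
      by (simp only: L_P_commute[OF f r(1)] L_P_commute[OF h r(2)]) simp
  qed
  have d1: "((\<lambda>r. triple (P (t - r) f) (P (t - r) f) (P r (L h))) has_real_derivative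
      - triple b a k1 + - triple a b k1 + triple a a k2) (at s within {0..t})"
    using has_derivative_integral_trilinear[OF rev[OF f] rev[OF f] fwd[OF cL[OF h]]]
    unfolding neg a_def[symmetric] b_def[symmetric] k1_def[symmetric] k2_def[symmetric] .
  have d2: "((\<lambda>r. triple (P (t - r) f) (P (t - r) (L f)) (P r h)) has_real_derivative
      - triple b b k0 + - triple a e k0 + triple a b k1) (at s within {0..t})"
    using has_derivative_integral_trilinear[OF rev[OF f] rev[OF cL[OF f]] fwd[OF h]]
    unfolding neg a_def[symmetric] b_def[symmetric] e_def[symmetric] k0_def[symmetric] k1_def[symmetric] .
  have d3: "((\<lambda>r. triple (P (t - r) (L f)) (P (t - r) f) (P r h)) has_real_derivative
      - triple e a k0 + - triple b b k0 + triple b a k1) (at s within {0..t})"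
    using has_derivative_integral_trilinear[OF rev[OF cL[OF f]] rev[OF f] fwd[OF h]]
    unfolding neg a_def[symmetric] b_def[symmetric] e_def[symmetric] k0_def[symmetric] k1_def[symmetric] .
  have G2: "2 * (2 * pairing (Gamma2 a a) k0)
     = (- triple b a k1 + - triple a b k1 + triple a a k2) - (- triple b b k0 + - triple a e k0 + triple a b k1)
       - (- triple e a k0 + - triple b b k0 + triple b a k1)"
    using integral_Gamma2[OF ca(1,3)] integral_Gamma[OF ca(1,1,4)] integral_Gamma[OF ca(1,2,3)]
      integral_Gamma[OF ca(2,1,3)]
    unfolding La by linarith
  have "((\<lambda>r. ?J r / 2) has_real_derivative 2 * (2 * pairing (Gamma2 a a) k0) / 2) (at s within {0..t})"
    unfolding G2 by (intro DERIV_cdivide DERIV_diff d1 d2 d3)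
  then have "((\<lambda>r. ?J r / 2) has_real_derivative 2 * pairing (Gamma2 a a) k0) (at s within {0..t})"
    by simp
  then show ?thesis
    unfolding a_def k0_def
    by (rule has_field_derivative_transform_within[OF _ zero_less_one s]) (simp only: J)
qed

end

context suitable_functions
begin

section \<open>Gradient decay\<close>

text \<open>Interpolate between the two sides by \<open>J(r) = E \<langle>\<Gamma>(P\<^bsub>t-r\<^esub> f), P\<^sub>r h\<rangle>\<close>. The criterion, applied to the suitable function
  \<open>P\<^bsub>t-r\<^esub> f\<close> and tested against the positive semidefinite \<open>P\<^sub>r h\<close>, says \<open>J' \<ge> (2/c) J\<close>, so
  \<open>exp(-2r/c) J(r)\<close> increases.\<close>

lemma gradient_decay:
  fixes f h :: "'a \<Rightarrow> complex^'d^'d"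
  assumes c: "0 < c" and BE: "bakry_emery W Z \<mu> S TYPE('d) c" and f: "suitable S f"
    and h: "components_in S h" and h_pos: "\<And>z. pos_semidef (h z)" and t: "0 \<le> t"
  shows "pairing (Gamma (P t f) (P t f)) h
    \<le> exp (- (2 * t / c)) * pairing (P t (Gamma f f)) h"
proof -
  have cf: "components_in S f" and hf: "\<And>z. hermitian (f z)" using f by (auto simp: suitable_iff)
  define J where "J r = pairing (Gamma (P (t - r) f) (P (t - r) f)) (P r h)" for r
  define J' where "J' r = 2 * pairing (Gamma2 (P (t - r) f) (P (t - r) f)) (P r h)" for r
  have J: "(J has_real_derivative J' r) (at r within {0..t})" if "r \<in> {0..t}" for r
    unfolding J_def J'_def by (rule Gamma2_derivative[OF cf h that])
  have growth: "2 / c * J r \<le> J' r" if "r \<in> {0..t}" for r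
  proof -
    have r: "0 \<le> t - r" "0 \<le> r" using that by auto
    let ?a = "P (t - r) f"
    have ca: "components_in S ?a" by (intro components_in_P cf r)
    have "suitable S ?a" unfolding suitable_iff
      using ca P_hermitian[OF components_in_dominated[OF cf] r(1) hf] by blast
    then have "AE z in \<mu>. psd_le (Gamma ?a ?a z) (c *\<^sub>R Gamma2 ?a ?a z)"
      using BE unfolding bakry_emery_def by blast
    then have ae: "AE z in \<mu>. trace_form (Gamma ?a ?a z) (P r h z) \<le> c * trace_form (Gamma2 ?a ?a z) (P r h z)"
    proof eventually_elim
      case (elim z)
      have "0 \<le> trace_form (c *\<^sub>R Gamma2 ?a ?a z - Gamma ?a ?a z) (P r h z)"
        using elim unfolding psd_le_def
        by (intro trace_form_nonneg P_pos_semidef components_in_dominated h h_pos r)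
      then show ?case by (simp add: trace_form.diff_left trace_form.scaleR_left)
    qed
    have dh: "dominated S (P r h)" by (intro dominated_P components_in_dominated h r)
    have "J r \<le> (\<integral>z. c * trace_form (Gamma2 ?a ?a z) (P r h z) \<partial>\<mu>)"
      unfolding J_def
      by (intro integral_mono_AE ae integrable_mult_right integrable_trace_form dh
          components_in_dominated components_in_Gamma components_in_Gamma2 ca)
    also have "\<dots> = c / 2 * J' r" by (simp add: J'_def)
    finally show ?thesis using c by (simp add: field_simps)
  qed
  define K where "K r = exp (- (2 * r / c)) * J r" for r
  have K: "(K has_real_derivative exp (- (2 * r / c)) * (J' r - 2 / c * J r)) (at r within {0..t})"
    if "r \<in> {0..t}" for r
    unfolding K_def using J[OF that] c
    by (auto intro!: derivative_eq_intros simp: algebra_simps)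
  have "K 0 \<le> K t"
  proof (rule DERIV_nonneg_imp_increasing_open[OF t])
    show "continuous_on {0..t} K" using K by (rule DERIV_continuous_on)
    fix r assume r: "0 < r" "r < t"
    then have "at r within {0..t} = at r" by (intro at_within_interior) simp
    then show "\<exists>y. (K has_real_derivative y) (at r) \<and> 0 \<le> y"
      using K[of r] growth[of r] r by (intro exI[of _ "exp (- (2 * r / c)) * (J' r - 2 / c * J r)"]) simp
  qed
  moreover have "K 0 = pairing (Gamma (P t f) (P t f)) h"
    by (simp add: K_def J_def P_zero[OF dominated_measurable[OF components_in_dominated[OF h]]])
  moreover have "J t = pairing (P t (Gamma f f)) h"
    using reversible_bilinear[OF bounded_bilinear_trace_form components_in_dominated components_in_dominated,
        OF components_in_Gamma[OF cf cf] h t]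
    by (simp add: J_def P_zero[OF dominated_measurable[OF components_in_dominated[OF cf]]])
  ultimately show ?thesis by (simp add: K_def)
qed

section \<open>The chain rule inequality\<close>

text \<open>The left-hand side is the expectation of \<open>\<langle>g(Z\<^sub>t) - g(Z\<^sub>0), \<Phi>(Z\<^sub>t) - \<Phi>(Z\<^sub>0)\<rangle>\<close> for the stationary process. Of the
  four terms, the two diagonal ones agree by stationarity and the two mixed ones by reversibility.\<close>

lemma integral_P_increment_product:
  fixes g \<Phi> :: "'a \<Rightarrow> complex^'n^'n"
  assumes g: "dominated S g" and \<Phi>: "dominated S \<Phi>" and t: "0 \<le> t"
  shows "dominated S (\<lambda>z. P t (\<lambda>y. trace_form (g y - g z) (\<Phi> y - \<Phi> z)) z)" (is "dominated S ?F")
    and "(\<integral>z. P t (\<lambda>y. trace_form (g y - g z) (\<Phi> y - \<Phi> z)) z \<partial>\<mu>)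
      = 2 * pairing (\<lambda>z. g z - P t g z) \<Phi>"
proof -
  note dom = dominated_add dominated_diff dominated_trace_form g \<Phi> dominated_const
  note lin = P_bounded_linear[OF trace_form.bounded_linear_left g t]
    P_bounded_linear[OF trace_form.bounded_linear_right \<Phi> t]
  have eq: "?F z = P t (\<lambda>y. trace_form (g y) (\<Phi> y)) z - trace_form (P t g z) (\<Phi> z)
      - trace_form (g z) (P t \<Phi> z) + trace_form (g z) (\<Phi> z)" for z
    by (simp add: trace_form.diff_left trace_form.diff_right P_add P_diff lin P_const dom t)
  show "dominated S ?F" unfolding eq by (intro dom dominated_P t)
  have "(\<integral>z. ?F z \<partial>\<mu>) = (\<integral>z. P t (\<lambda>y. trace_form (g y) (\<Phi> y)) z \<partial>\<mu>) - pairing (P t g) \<Phi>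
     - pairing g (P t \<Phi>) + pairing g \<Phi>"
    unfolding eq by (simp add: dominated_integrable dom dominated_P t)
  also have "(\<integral>z. P t (\<lambda>y. trace_form (g y) (\<Phi> y)) z \<partial>\<mu>) = pairing g \<Phi>"
    by (intro expectation_P dom t)
  also have "pairing g (P t \<Phi>) = pairing (P t g) \<Phi>"
    by (rule reversible_bilinear[OF bounded_bilinear_trace_form g \<Phi> t, symmetric])
  finally show "(\<integral>z. ?F z \<partial>\<mu>) = 2 * pairing (\<lambda>z. g z - P t g z) \<Phi>"
    by (simp add: trace_form.diff_left dominated_integrable dom dominated_P t)
qed

text \<open>Under stationarity and reversibility \<open>(Z\<^sub>0, Z\<^sub>t)\<close> is exchangeable and the squared increment is symmetric, so testing it
  against \<open>\<Psi>(Z\<^sub>t)\<close> or \<open>\<Psi>(Z\<^sub>0)\<close> gives the same expectation.\<close>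

lemma integral_P_increment_square:
  fixes u \<Psi> :: "'a \<Rightarrow> complex^'n^'n"
  assumes u: "dominated S u" and \<Psi>: "dominated S \<Psi>" and t: "0 \<le> t"
  shows "dominated S (\<lambda>z. P t (\<lambda>y. trace_form ((u y - u z) ** (u y - u z)) (\<Psi> y + \<Psi> z)) z)" (is "dominated S ?F")
    and "(\<integral>z. P t (\<lambda>y. trace_form ((u y - u z) ** (u y - u z)) (\<Psi> y + \<Psi> z)) z \<partial>\<mu>)
      = 2 * pairing (increment_square t u) \<Psi>"
proof -
  note dom = dominated_add dominated_diff dominated_trace_form dominated_matrix_mult u \<Psi> dominated_const
  let ?uu = "\<lambda>y. u y ** u y"
  let ?A = "\<lambda>z. P t (\<lambda>y. trace_form (?uu y) (\<Psi> y)) z - trace_form (u z) (P t (\<lambda>y. \<Psi> y ** u y) z)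
      - trace_form (u z) (P t (\<lambda>y. u y ** \<Psi> y) z) + trace_form (?uu z) (P t \<Psi> z)"
  have eq: "?F z = ?A z + trace_form (increment_square t u z) (\<Psi> z)" for z
  proof -
    have 1: "P t (\<lambda>y. trace_form ((u y - u z) ** (u y - u z)) (\<Psi> z)) z = trace_form (increment_square t u z) (\<Psi> z)"
      unfolding increment_square_def by (intro P_bounded_linear[OF trace_form.bounded_linear_left] dom t)
    have 2: "trace_form ((u y - u z) ** (u y - u z)) (\<Psi> y)
        = ((trace_form (?uu y) (\<Psi> y) - trace_form (u z) (\<Psi> y ** u y)) - trace_form (u z) (u y ** \<Psi> y)) + trace_form (?uu z) (\<Psi> y)" for y
    proof -
      have "trace_form (u y ** u z) (\<Psi> y) = trace_form (u z) (\<Psi> y ** u y)"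
        by (metis trace_form_assoc trace_form_cyclic)
      then show ?thesis
        by (simp add: matrix_mult.diff_left matrix_mult.diff_right trace_form.diff_left trace_form_assoc[of "u z" "u y"])
    qed
    have 3: "P t (\<lambda>y. trace_form ((u y - u z) ** (u y - u z)) (\<Psi> y)) z = ?A z"
      unfolding 2 by (simp add: P_add P_diff P_bounded_linear[OF trace_form.bounded_linear_right] dom t)
    have "?F z = P t (\<lambda>y. trace_form ((u y - u z) ** (u y - u z)) (\<Psi> y)) z
        + P t (\<lambda>y. trace_form ((u y - u z) ** (u y - u z)) (\<Psi> z)) z"
      unfolding trace_form.add_right by (intro P_add dom t)
    then show ?thesis unfolding 1 3 .
  qed
  have dA: "dominated S ?A" and dV: "dominated S (\<lambda>z. trace_form (increment_square t u z) (\<Psi> z))"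
    by (intro dom dominated_P dominated_increment_square t)+
  show "dominated S ?F" unfolding eq by (rule dominated_add[OF dA dV])
  note rev = reversible_bilinear[OF bounded_bilinear_trace_form _ _ t]
  have "(\<integral>z. ?A z \<partial>\<mu>) = (\<integral>z. P t (\<lambda>y. trace_form (?uu y) (\<Psi> y)) z \<partial>\<mu>) - pairing u (P t (\<lambda>y. \<Psi> y ** u y))
     - pairing u (P t (\<lambda>y. u y ** \<Psi> y)) + pairing ?uu (P t \<Psi>)"
    by (simp add: dominated_integrable dom dominated_P t)
  also have "\<dots> = pairing ?uu \<Psi> - pairing (P t u) (\<lambda>z. \<Psi> z ** u z)
     - pairing (P t u) (\<lambda>z. u z ** \<Psi> z) + pairing (P t ?uu) \<Psi>"
    by (simp only: expectation_P[OF dominated_trace_form[OF dominated_matrix_mult[OF u u] \<Psi>] t]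
        rev[OF u dominated_matrix_mult[OF \<Psi> u]] rev[OF u dominated_matrix_mult[OF u \<Psi>]]
        rev[OF dominated_matrix_mult[OF u u] \<Psi>])
  also have "\<dots> = (\<integral>z. trace_form (?uu z) (\<Psi> z) - trace_form (P t u z) (\<Psi> z ** u z)
     - trace_form (P t u z) (u z ** \<Psi> z) + trace_form (P t ?uu z) (\<Psi> z) \<partial>\<mu>)"
    by (simp add: dominated_integrable dom dominated_P t)
  also have "\<dots> = pairing (increment_square t u) \<Psi>"
  proof (intro Bochner_Integration.integral_cong refl)
    fix z
    have "trace_form (u z ** P t u z) (\<Psi> z) = trace_form (P t u z) (\<Psi> z ** u z)"
      by (metis trace_form_assoc trace_form_cyclic)
    then show "trace_form (?uu z) (\<Psi> z) - trace_form (P t u z) (\<Psi> z ** u z)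
        - trace_form (P t u z) (u z ** \<Psi> z) + trace_form (P t ?uu z) (\<Psi> z) = trace_form (increment_square t u z) (\<Psi> z)"
      by (simp add: increment_square_eq[OF u t] trace_form.diff_left trace_form.add_left trace_form_assoc[of "P t u z"])
  qed
  finally have A: "(\<integral>z. ?A z \<partial>\<mu>) = pairing (increment_square t u) \<Psi>" .
  have "(\<integral>z. ?F z \<partial>\<mu>) = (\<integral>z. ?A z \<partial>\<mu>) + pairing (increment_square t u) \<Psi>"
    unfolding eq by (rule Bochner_Integration.integral_add[OF dominated_integrable[OF dA] dominated_integrable[OF dV]])
  then show "(\<integral>z. ?F z \<partial>\<mu>) = 2 * pairing (increment_square t u) \<Psi>"
    unfolding A by simp
qed

text \<open>Cyclicity of the trace isolates each difference quotient, and mean-square convergence applies to it.\<close>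

lemma tendsto_integral_increment_square:
  fixes f \<Psi> :: "'a \<Rightarrow> complex^'n^'n"
  assumes f: "components_in S f" and \<Psi>: "dominated S \<Psi>"
  shows "((\<lambda>t. pairing (increment_square t f) \<Psi> / t)
    \<longlongrightarrow> 2 * pairing (Gamma f f) \<Psi>) (at_right 0)"
proof (rule Lim_transform_eventually)
  have df: "dominated S f" by (rule components_in_dominated[OF f])
  let ?ff = "\<lambda>y. f y ** f y"
  let ?q = "\<lambda>u t z. (P t u z - u z) /\<^sub>R t"
  let ?A = "\<lambda>t. pairing (?q ?ff t) \<Psi> - pairing (?q f t) (\<lambda>z. \<Psi> z ** f z) - pairing (?q f t) (\<lambda>z. f z ** \<Psi> z)"
  let ?B = "pairing (L ?ff) \<Psi> - pairing (L f) (\<lambda>z. \<Psi> z ** f z) - pairing (L f) (\<lambda>z. f z ** \<Psi> z)"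
  have swap: "trace_form (f z ** A) (\<Psi> z) = trace_form A (\<Psi> z ** f z)" "trace_form (A ** f z) (\<Psi> z) = trace_form A (f z ** \<Psi> z)" for A z
    by (metis trace_form_assoc trace_form_cyclic) (rule trace_form_assoc)
  have cff: "components_in S ?ff" by (intro components_in_matrix_mult f)
  note tl = tendsto_integral_bilinear[OF bounded_bilinear_trace_form]
  have "(?A \<longlongrightarrow> ?B) (at_right 0)"
    by (intro tendsto_diff tl L2_tendsto_const generator_L2_tendsto f cff \<Psi> dominated_matrix_mult df)
  moreover have "?B = 2 * pairing (Gamma f f) \<Psi>"
  proof -
    have "?B = (\<integral>z. trace_form (L ?ff z) (\<Psi> z) - trace_form (L f z) (\<Psi> z ** f z) - trace_form (L f z) (f z ** \<Psi> z) \<partial>\<mu>)"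
      by (simp add: integrable_trace_form dominated_matrix_mult \<Psi> df components_in_dominated[OF components_in_L] f cff)
    also have "\<dots> = (\<integral>z. 2 * trace_form (Gamma f f z) (\<Psi> z) \<partial>\<mu>)"
      by (intro Bochner_Integration.integral_cong refl)
        (simp add: carre_du_champ_def trace_form.scaleR_left trace_form.diff_left swap)
    finally show ?thesis by simp
  qed
  ultimately show "(?A \<longlongrightarrow> 2 * pairing (Gamma f f) \<Psi>) (at_right 0)" by (simp only:)
  show "\<forall>\<^sub>F t in at_right 0. ?A t = pairing (increment_square t f) \<Psi> / t"
    unfolding eventually_at_filter
  proof (intro always_eventually allI impI)
    fix t :: real assume "t \<in> {0<..}"
    then have t: "0 < t" by simp
    have dq: "dominated S (?q u t)" if "components_in S u" for u :: "'a \<Rightarrow> complex^'n^'n"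
      using t by (intro dominated_scaleR dominated_diff dominated_P components_in_dominated that) simp
    have "?A t = (\<integral>z. trace_form (?q ?ff t z) (\<Psi> z) - trace_form (?q f t z) (\<Psi> z ** f z) - trace_form (?q f t z) (f z ** \<Psi> z) \<partial>\<mu>)"
      by (simp add: integrable_trace_form dominated_matrix_mult \<Psi> df dq[OF f] dq[OF cff])
    also have "\<dots> = pairing (\<lambda>z. increment_square t f z /\<^sub>R t) \<Psi>"
      by (simp only: increment_square_quotient[OF df t] trace_form.diff_left swap)
    also have "\<dots> = pairing (increment_square t f) \<Psi> / t"
      by (simp add: trace_form.scaleR_left divide_inverse mult.commute)
    finally show "?A t = pairing (increment_square t f) \<Psi> / t" .
  qed
qed

text \<open>For fixed \<open>z\<close>, integrate the trace mean value inequality for \<open>f(y)\<close> and \<open>f(z)\<close> over \<open>y\<close> with respect to the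
  transition law, then over \<open>z\<close>; divide by \<open>t\<close> and let \<open>t\<close> tend to zero.\<close>

lemma chain_rule_inequality:
  fixes f g :: "'a \<Rightarrow> complex^'n^'n"
  assumes f: "components_in S f" "\<And>z. hermitian (f z)" and g: "components_in S g" "\<And>z. hermitian (g z)"
    and \<phi>: "\<And>x y. \<bar>\<phi> x - \<phi> y\<bar> \<le> \<bar>x - y\<bar> * ((\<psi> x + \<psi> y) / 2)" and \<psi>: "\<And>x. 0 \<le> \<psi> x"
    and d\<phi>: "dominated S (\<lambda>z. mat_fun \<phi> (f z))" and d\<psi>: "dominated S (\<lambda>z. mat_fun \<psi> (f z))"
    and s: "0 < s"
  shows "- pairing (L g) (\<lambda>z. mat_fun \<phi> (f z))
    \<le> (s * pairing (Gamma f f) (\<lambda>z. mat_fun \<psi> (f z))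
        + (1/s) * pairing (Gamma g g) (\<lambda>z. mat_fun \<psi> (f z))) / 2"
proof -
  define \<Phi> where "\<Phi> z = mat_fun \<phi> (f z)" for z
  define \<Psi> where "\<Psi> z = mat_fun \<psi> (f z)" for z
  have d: "dominated S \<Phi>" "dominated S \<Psi>" using d\<phi> d\<psi> by (simp_all add: \<Phi>_def[abs_def] \<Psi>_def[abs_def])
  have df: "dominated S f" and dg: "dominated S g" by (intro components_in_dominated f g)+
  let ?I = "\<lambda>t u. (pairing (increment_square t u) \<Psi>)"
  have lhs: "((\<lambda>t. - pairing (\<lambda>z. (P t g z - g z) /\<^sub>R t) \<Phi>) \<longlongrightarrow> - pairing (L g) \<Phi>) (at_right 0)"
    by (intro tendsto_minus tendsto_integral_bilinear[OF bounded_bilinear_trace_form] L2_tendsto_const generator_L2_tendsto g d)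
  have rhs: "((\<lambda>t. (s * (?I t f / t) + (1/s) * (?I t g / t)) / 4)
     \<longlongrightarrow> (s * (2 * pairing (Gamma f f) \<Psi>) + (1/s) * (2 * pairing (Gamma g g) \<Psi>)) / 4) (at_right 0)"
    by (intro tendsto_divide tendsto_add tendsto_mult tendsto_const tendsto_integral_increment_square f g d) simp
  have "- pairing (L g) \<Phi>
     \<le> (s * (2 * pairing (Gamma f f) \<Psi>) + (1/s) * (2 * pairing (Gamma g g) \<Psi>)) / 4"
  proof (rule tendsto_le[OF _ rhs lhs])
    show "\<forall>\<^sub>F t in at_right 0. - pairing (\<lambda>z. (P t g z - g z) /\<^sub>R t) \<Phi>
        \<le> (s * (?I t f / t) + (1/s) * (?I t g / t)) / 4"
      unfolding eventually_at_filter
    proof (intro always_eventually allI impI)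
      fix t :: real assume "t \<in> {0<..}"
      then have t: "0 < t" "0 \<le> t" by auto
      let ?X = "\<lambda>z y. trace_form (g y - g z) (\<Phi> y - \<Phi> z)"
      let ?Y = "\<lambda>u z y. trace_form ((u y - u z) ** (u y - u z)) (\<Psi> y + \<Psi> z)"
      note dom = dominated_add dominated_diff dominated_trace_form dominated_matrix_mult df dg d dominated_const dominated_mult
      have le: "P t (?X z) z \<le> (s/4) * P t (?Y f z) z + (1/(4 * s)) * P t (?Y g z) z" for z
      proof -
        have "P t (?X z) z \<le> P t (\<lambda>y. (s/4) * ?Y f z y + (1/(4 * s)) * ?Y g z y) z"
        proof (rule P_mono[OF _ _ t(2)])
          show "dominated S (?X z)" "dominated S (\<lambda>y. (s/4) * ?Y f z y + (1/(4 * s)) * ?Y g z y)"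
            by (intro dom)+
          fix y
          show "?X z y \<le> (s/4) * ?Y f z y + (1/(4 * s)) * ?Y g z y"
            using trace_mean_value_inequality[OF f(2) f(2) hermitian_diff[OF g(2) g(2)] s \<psi> \<phi>, of y z y z]
            by (simp add: \<Phi>_def \<Psi>_def trace_form.add_left trace_form.scaleR_left add_divide_distrib)
        qed
        also have "\<dots> = P t (\<lambda>y. (s/4) * ?Y f z y) z + P t (\<lambda>y. (1/(4 * s)) * ?Y g z y) z"
          by (intro P_add dom t(2))
        also have "P t (\<lambda>y. (s/4) * ?Y f z y) z = (s/4) * P t (?Y f z) z"
          by (intro P_bounded_linear[OF bounded_linear_mult_right] dom t(2))
        also have "P t (\<lambda>y. (1/(4 * s)) * ?Y g z y) z = (1/(4 * s)) * P t (?Y g z) z"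
          by (intro P_bounded_linear[OF bounded_linear_mult_right] dom t(2))
        finally show ?thesis .
      qed
      note X = integral_P_increment_product[OF dg d(1) t(2)]
      note Yf = integral_P_increment_square[OF df d(2) t(2)]
      note Yg = integral_P_increment_square[OF dg d(2) t(2)]
      have "(\<integral>z. P t (?X z) z \<partial>\<mu>) \<le> (\<integral>z. (s/4) * P t (?Y f z) z + (1/(4 * s)) * P t (?Y g z) z \<partial>\<mu>)"
        by (rule expectation_mono[OF X(1) _ le])
           (intro dominated_add dominated_mult dominated_const Yf(1) Yg(1))
      also have "\<dots> = (s/4) * (\<integral>z. P t (?Y f z) z \<partial>\<mu>) + (1/(4 * s)) * (\<integral>z. P t (?Y g z) z \<partial>\<mu>)"
        using dominated_integrable[OF Yf(1)] dominated_integrable[OF Yg(1)] by simp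
      finally have main: "2 * pairing (\<lambda>z. g z - P t g z) \<Phi>
          \<le> (s/4) * (2 * ?I t f) + (1/(4 * s)) * (2 * ?I t g)"
        unfolding X(2) Yf(2) Yg(2) .
      have "- pairing (\<lambda>z. (P t g z - g z) /\<^sub>R t) \<Phi> = pairing (\<lambda>z. g z - P t g z) \<Phi> / t"
      proof -
        have "- trace_form ((P t g z - g z) /\<^sub>R t) (\<Phi> z) = trace_form (g z - P t g z) (\<Phi> z) / t" for z
          by (simp add: trace_form.scaleR_left trace_form.diff_left divide_inverse algebra_simps)
        then show ?thesis by (simp flip: integral_minus)
      qed
      also have "\<dots> \<le> ((s/4) * ?I t f + (1/(4 * s)) * ?I t g) / t"
        using main t by (intro divide_right_mono) auto
      also have "\<dots> = (s * (?I t f / t) + (1/s) * (?I t g / t)) / 4"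
        using t s by (simp add: field_simps)
      finally show "- pairing (\<lambda>z. (P t g z - g z) /\<^sub>R t) \<Phi>
        \<le> (s * (?I t f / t) + (1/s) * (?I t g / t)) / 4" .
    qed
  qed simp
  then show ?thesis by (simp add: \<Phi>_def \<Psi>_def)
qed

end

section \<open>The moment inequality\<close>

lemma powr_moment_identity:
  fixes x q :: real
  assumes "q = 1 \<and> g = (\<lambda>_. 1) \<or> 3/2 \<le> q \<and> g = (\<lambda>x. \<bar>x\<bar> powr (2 * q - 2))"
  shows "x * (x * g x) = \<bar>x\<bar> powr (2 * q)"
proof (cases "x = 0")
  case False
  have "\<bar>x\<bar> powr 2 = x * x" using False by (simp add: powr_numeral power2_eq_square)
  then show ?thesis using assms False
  proof (elim disjE conjE)
    assume "g = (\<lambda>x. \<bar>x\<bar> powr (2 * q - 2))" "\<bar>x\<bar> powr 2 = x * x"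
    then show ?thesis using powr_add[of "\<bar>x\<bar>" 2 "2 * q - 2"] by simp
  qed simp
qed simp

text \<open>Young's inequality with exponents \<open>q\<close> and \<open>q/(q-1)\<close> for \<open>a x\<close> and \<open>|y|\<^bsup>2q-2\<^esup>\<close>. The constant \<open>a\<close> is kept with \<open>x\<close> so that
  the coefficient of \<open>|y|\<^bsup>2q\<^esup>\<close> is exactly \<open>1 - 1/q\<close> and the corresponding moment can be absorbed later.\<close>

lemma weighted_Young:
  fixes a x y q :: real
  assumes g: "q = 1 \<and> g = (\<lambda>_. 1) \<or> 3/2 \<le> q \<and> g = (\<lambda>x. \<bar>x\<bar> powr (2 * q - 2))"
    and x: "0 \<le> x" and a: "0 < a"
  shows "x * (a * g y) \<le> (a powr q / q) * \<bar>x\<bar> powr q + (1 - 1 / q) * \<bar>y\<bar> powr (2 * q)"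
  using g
proof (elim disjE conjE)
  assume q: "3/2 \<le> q" and g: "g = (\<lambda>x. \<bar>x\<bar> powr (2 * q - 2))"
  have "(a * x) * (\<bar>y\<bar> powr (2 * q - 2)) \<le> (a * x) powr q / q + (\<bar>y\<bar> powr (2 * q - 2)) powr (q / (q - 1)) / (q / (q - 1))"
    by (rule Youngs_inequality) (use q a x in \<open>auto simp: field_simps\<close>)
  also have "(\<bar>y\<bar> powr (2 * q - 2)) powr (q / (q - 1)) = \<bar>y\<bar> powr (2 * q)"
  proof -
    have "(2 * q - 2) * (q / (q - 1)) = 2 * q" using q by (simp add: field_simps)
    then show ?thesis by (simp only: powr_powr)
  qed
  also have "\<bar>y\<bar> powr (2 * q) / (q / (q - 1)) = (1 - 1 / q) * \<bar>y\<bar> powr (2 * q)"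
    using q by (simp add: field_simps)
  also have "(a * x) powr q / q = (a powr q / q) * \<bar>x\<bar> powr q" using a x by (simp add: powr_mult)
  finally show ?thesis by (simp add: g mult_ac)
qed (use x a in \<open>simp add: mult.commute\<close>)

text \<open>Conditions on \<open>g\<close> under which \<open>g(|f|)\<close> is a dominated limit of suitable functions.\<close>

definition moderate_growth :: "(real \<Rightarrow> real) \<Rightarrow> bool" where
  "moderate_growth g \<longleftrightarrow> continuous_on {0..} g \<and> mono_on {0..} g \<and> 0 \<le> g 0 \<and>
     (\<exists>k::nat. \<forall>x\<ge>0. g x \<le> 1 + x ^ k)"

lemma moderate_growth_const: "moderate_growth (\<lambda>_. 1)"
  by (auto simp: moderate_growth_def mono_on_def)

lemma moderate_growth_powr:
  assumes r: "0 < r"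
  shows "moderate_growth (\<lambda>x. x powr r)"
  unfolding moderate_growth_def
proof (intro conjI exI allI impI)
  show "continuous_on {0..} (\<lambda>x::real. x powr r)"
    using r by (intro continuous_on_powr' continuous_intros) auto
  show "mono_on {0..} (\<lambda>x::real. x powr r)"
    using r by (auto simp: mono_on_def intro: powr_mono2)
  fix x :: real assume x: "0 \<le> x"
  show "x powr r \<le> 1 + x ^ nat \<lceil>r\<rceil>"
  proof (cases "x \<le> 1")
    case True
    then have "x powr r \<le> 1" using x r by (simp add: powr_le1)
    then show ?thesis using x by (simp add: add_increasing2)
  next
    case False
    then have "x powr r \<le> x powr real (nat \<lceil>r\<rceil>)"
      by (intro powr_mono real_nat_ceiling_ge) auto
    then show ?thesis using False by (simp add: powr_realpow)
  qed
qed simp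

abbreviation abs_fun :: "(real \<Rightarrow> real) \<Rightarrow> complex^'n^'n \<Rightarrow> complex^'n^'n" where
  "abs_fun g \<equiv> mat_fun (\<lambda>x. g \<bar>x\<bar>)"

context suitable_functions
begin

text \<open>The smooth approximants of \<open>g\<close> preserve suitability, and their uniform growth bound provides one dominating
  function for all of them.\<close>

lemma mat_fun_approximation:
  fixes f :: "'a \<Rightarrow> complex^'d^'d"
  assumes f: "suitable S f" and g: "moderate_growth g"
  obtains H s where "\<And>n. components_in S (H n)" "\<And>n z. pos_semidef (H n z)"
    "\<And>z. (\<lambda>n. H n z) \<longlonglongrightarrow> abs_fun g (f z)"
    "dominated S s" "\<And>n z. norm (H n z) \<le> (s z :: real)" "\<And>z. norm (abs_fun g (f z)) \<le> s z"
proof -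
  have cf: "components_in S f" and hf: "\<And>z. hermitian (f z)" using f by (auto simp: suitable_iff)
  obtain \<phi> where \<phi>: "\<And>n. smooth_bounded_derivs (\<phi> n)" "\<And>n x. 0 \<le> \<phi> n x"
    "\<And>n x. \<phi> n x \<le> g \<bar>x\<bar> + 2" "\<And>x. (\<lambda>n. \<phi> n x) \<longlonglongrightarrow> g \<bar>x\<bar>"
    using smooth_approximation[of g] g unfolding moderate_growth_def by blast
  obtain k :: nat where growth: "\<And>x. 0 \<le> x \<Longrightarrow> g x \<le> 1 + x ^ k"
    using g by (auto simp: moderate_growth_def)
  define H where "H n z = mat_fun (\<phi> n) (f z)" for n z
  define s where "s z = real CARD('d) * (3 + norm (f z) ^ k)" for z
  have lim: "(\<lambda>n. H n z) \<longlonglongrightarrow> abs_fun g (f z)" for z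
    unfolding H_def by (rule tendsto_mat_fun[OF hf \<phi>(4)])
  have bd: "norm (H n z) \<le> s z" for n z
    unfolding H_def s_def
  proof (rule norm_mat_fun_le[OF hf])
    fix x assume "\<bar>x\<bar> \<le> norm (f z)"
    then have "\<bar>x\<bar> ^ k \<le> norm (f z) ^ k" by (intro power_mono) auto
    then show "\<bar>\<phi> n x\<bar> \<le> 3 + norm (f z) ^ k"
      using \<phi>(2)[of n x] \<phi>(3)[of n x] growth[of "\<bar>x\<bar>"] by simp
  qed
  show ?thesis
  proof (rule that[of H s])
    fix n
    have "suitable S (\<lambda>z. mat_fun (\<phi> n) (f z))"
      using suitable_mat_fun f \<phi>(1) unfolding closed_under_mat_fun_def by blast
    then show "components_in S (H n)" unfolding suitable_iff H_def[abs_def] by blast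
    show "pos_semidef (H n z)" for z unfolding H_def by (rule pos_semidef_mat_fun[OF hf \<phi>(2)])
    show "dominated S s" unfolding s_def
      by (intro dominated_mult dominated_add dominated_const dominated_norm_power components_in_dominated cf)
    show "norm (abs_fun g (f z)) \<le> s z" for z
      by (rule LIMSEQ_le_const2[OF tendsto_norm[OF lim]]) (use bd in blast)
  qed (fact lim bd)+
qed

lemma dominated_mat_fun:
  fixes f :: "'a \<Rightarrow> complex^'d^'d"
  assumes f: "suitable S f" and g: "moderate_growth g"
  shows "dominated S (\<lambda>z. abs_fun g (f z))"
proof -
  obtain H s where H: "\<And>n. components_in S (H n)" "\<And>z. (\<lambda>n. H n z) \<longlonglongrightarrow> abs_fun g (f z)"
    and s: "dominated S s" "\<And>z. norm (abs_fun g (f z)) \<le> (s z :: real)"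
    using mat_fun_approximation[OF assms] by metis
  have "(\<lambda>z. abs_fun g (f z)) \<in> borel_measurable borel"
    by (rule borel_measurable_LIMSEQ_metric[OF dominated_measurable[OF components_in_dominated[OF H(1)]] H(2)])
  then show ?thesis
    by (rule dominated_mono[OF s(1)]) (unfold real_norm_def, rule order_trans[OF s(2) abs_ge_self])
qed

lemma gradient_decay_mat_fun:
  fixes f h :: "'a \<Rightarrow> complex^'d^'d"
  assumes c: "0 < c" and BE: "bakry_emery W Z \<mu> S TYPE('d) c" and f: "suitable S f" and h: "suitable S h"
    and g: "moderate_growth g" and t: "0 \<le> t"
  shows "pairing (Gamma (P t f) (P t f)) (\<lambda>z. abs_fun g (h z))
    \<le> exp (- (2 * t / c)) * pairing (P t (Gamma f f)) (\<lambda>z. abs_fun g (h z))"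
proof -
  have cf: "components_in S f" using f by (simp add: suitable_iff)
  obtain H s where H: "\<And>n. components_in S (H n)" "\<And>n z. pos_semidef (H n z)"
    "\<And>z. (\<lambda>n. H n z) \<longlonglongrightarrow> abs_fun g (h z)"
    and s: "dominated S s" "\<And>n z. norm (H n z) \<le> (s z :: real)"
    using mat_fun_approximation[OF h g] by metis
  obtain K where K: "0 \<le> K" "\<And>x y :: complex^'d^'d. norm (trace_form x y) \<le> norm x * norm y * K"
    using trace_form.nonneg_bounded by metis
  have lim: "(\<lambda>n. pairing A (H n)) \<longlonglongrightarrow> pairing A (\<lambda>z. abs_fun g (h z))"
    if A: "dominated S A" for A
  proof (rule integral_dominated_convergence[where w = "\<lambda>z. norm (A z) * s z * K"])
    show "(\<lambda>z. trace_form (A z) (abs_fun g (h z))) \<in> borel_measurable \<mu>"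
      by (intro measurable_mu dominated_measurable dominated_trace_form A dominated_mat_fun[OF h g])
    show "(\<lambda>z. trace_form (A z) (H n z)) \<in> borel_measurable \<mu>" for n
      by (intro measurable_mu dominated_measurable dominated_trace_form A components_in_dominated H)
    show "integrable \<mu> (\<lambda>z. norm (A z) * s z * K)"
      by (intro dominated_integrable dominated_mult dominated_norm dominated_const A s)
    show "AE z in \<mu>. (\<lambda>n. trace_form (A z) (H n z)) \<longlonglongrightarrow> trace_form (A z) (abs_fun g (h z))"
      by (intro AE_I2 trace_form.tendsto tendsto_const H)
    show "AE z in \<mu>. norm (trace_form (A z) (H n z)) \<le> norm (A z) * s z * K" for n
    proof (intro AE_I2)
      fix z
      have "norm (A z) * norm (H n z) * K \<le> norm (A z) * s z * K"
        by (intro mult_right_mono mult_left_mono s K) auto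
      then show "norm (trace_form (A z) (H n z)) \<le> norm (A z) * s z * K"
        using K(2)[of "A z" "H n z"] by (rule order_trans[rotated])
    qed
  qed
  have dG: "dominated S (Gamma (P t f) (P t f))"
    by (intro components_in_dominated components_in_Gamma components_in_P cf t)
  have dP: "dominated S (P t (Gamma f f))"
    by (intro dominated_P components_in_dominated components_in_Gamma cf t)
  show ?thesis
  proof (rule LIMSEQ_le[OF lim[OF dG] tendsto_mult_left[OF lim[OF dP]]], intro exI allI impI)
    fix n
    show "pairing (Gamma (P t f) (P t f)) (H n)
      \<le> exp (- (2 * t / c)) * pairing (P t (Gamma f f)) (H n)"
      by (rule gradient_decay[OF c BE f H(1,2) t])
  qed
qed

text \<open>Integrate the hypothesis over the joint law of \<open>Z\<^sub>t\<close> and \<open>Z\<^sub>0\<close>; both marginals are \<open>\<mu>\<close>, so the bound does not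
  depend on \<open>t\<close>.\<close>

lemma integral_trace_form_P_le:
  fixes F G :: "'a \<Rightarrow> complex^'n^'n"
  assumes F: "dominated S F" and G: "dominated S G" and \<alpha>: "dominated S \<alpha>" and \<beta>: "dominated S \<beta>" and t: "0 \<le> t"
    and le: "\<And>y z. trace_form (F y) (G z) \<le> \<alpha> y + (\<beta> z :: real)"
  shows "pairing (P t F) G \<le> (\<integral>z. \<alpha> z \<partial>\<mu>) + (\<integral>z. \<beta> z \<partial>\<mu>)"
proof -
  have "trace_form (P t F z) (G z) \<le> P t \<alpha> z + \<beta> z" for z
  proof -
    have "trace_form (P t F z) (G z) = P t (\<lambda>y. trace_form (F y) (G z)) z"
      by (rule P_bounded_linear[OF trace_form.bounded_linear_left F t, symmetric])
    also have "\<dots> \<le> P t (\<lambda>y. \<alpha> y + \<beta> z) z"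
      by (intro P_mono le dominated_trace_form F dominated_const dominated_add \<alpha> t)
    also have "\<dots> = P t \<alpha> z + P t (\<lambda>y. \<beta> z) z" by (intro P_add \<alpha> dominated_const t)
    finally show ?thesis by (simp only: P_const)
  qed
  then have "pairing (P t F) G \<le> (\<integral>z. P t \<alpha> z + \<beta> z \<partial>\<mu>)"
    by (intro expectation_mono dominated_trace_form dominated_P dominated_add F G \<alpha> \<beta> t)
  also have "\<dots> = (\<integral>z. P t \<alpha> z \<partial>\<mu>) + (\<integral>z. \<beta> z \<partial>\<mu>)"
    by (intro Bochner_Integration.integral_add dominated_integrable dominated_P \<alpha> \<beta> t)
  finally show ?thesis by (simp only: expectation_P[OF \<alpha> t])
qed

lemma P_L2_tendsto_zero:
  fixes F :: "'a \<Rightarrow> 'b::euclidean_space"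
  assumes F: "dominated S F" and mean: "(\<integral>z. F z \<partial>\<mu>) = 0"
  shows "((\<lambda>t. L2norm (P t F)) \<longlongrightarrow> 0) at_top"
proof -
  let ?I = "\<lambda>b t. \<integral>z. (P t (\<lambda>z. F z \<bullet> b) z - (\<integral>y. F y \<bullet> b \<partial>\<mu>))\<^sup>2 \<partial>\<mu>"
  have mean': "(\<integral>y. F y \<bullet> b \<partial>\<mu>) = 0" for b
    using integral_bounded_linear[OF bounded_linear_inner_left dominated_integrable[OF F], of b] mean by simp
  have "((\<lambda>t. sqrt (\<Sum>b\<in>Basis. ?I b t)) \<longlongrightarrow> sqrt (\<Sum>b\<in>(Basis::'b set). 0)) at_top"
    by (intro tendsto_real_sqrt tendsto_sum ergodic square_integrable_dominated dominated_inner F)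
  then have "((\<lambda>t. sqrt (\<Sum>b\<in>Basis. ?I b t)) \<longlongrightarrow> 0) at_top"
    by (simp only: sum.neutral_const real_sqrt_zero)
  moreover have "\<forall>\<^sub>F t in at_top. sqrt (\<Sum>b\<in>Basis. ?I b t) = L2norm (P t F)"
    using eventually_ge_at_top[of 0]
  proof eventually_elim
    case (elim t)
    show ?case unfolding mean' by (simp only: L2norm_components[OF dominated_P[OF F elim]] P_inner[OF F elim] diff_0_right)
  qed
  ultimately show ?thesis by (rule Lim_transform_eventually)
qed

text \<open>The terms that are linear in \<open>f\<close> cancel, so centring \<open>f\<close> leaves \<open>\<Gamma>(f)\<close> unchanged.\<close>

lemma Gamma_diff_const:
  fixes f :: "'a \<Rightarrow> complex^'n^'n"
  assumes f: "components_in S f"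
  shows "Gamma (\<lambda>y. f y - C) (\<lambda>y. f y - C) z = Gamma f f z"
proof -
  note comp = components_in_diff components_in_add components_in_matrix_mult f components_in_const
  have sq: "(\<lambda>y. (f y - C) ** (f y - C)) = (\<lambda>y. ((f y ** f y - C ** f y) - f y ** C) + C ** C)"
    by (simp add: matrix_mult.diff_left matrix_mult.diff_right fun_eq_iff algebra_simps)
  show ?thesis
    unfolding carre_du_champ_def sq
    by (simp add: L_add L_diff L_const L_bounded_linear[OF matrix_mult.bounded_linear_left f]
        L_bounded_linear[OF matrix_mult.bounded_linear_right f] matrix_mult.diff_left matrix_mult.diff_right comp)
qed

text \<open>Here \<open>F\<close> decays from the central moment \<open>M\<close> to zero at a rate of at most \<open>K exp(-t/c)\<close>, so \<open>M \<le> c K\<close>. The bound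
  \<open>c K\<close> contains \<open>M\<close> itself with the factor \<open>1 - 1/q < 1\<close>, and absorbing it leaves the claim.\<close>

theorem moment_inequality:
  fixes f :: "'a \<Rightarrow> complex^'d^'d"
  assumes c: "0 < c" and BE: "bakry_emery W Z \<mu> S TYPE('d) c" and f: "suitable S f" and q: "q = 1 \<or> 3/2 \<le> q"
  shows "central_moment \<mu> (2 * q) f \<le> (c * (2 * q - 1)) powr q * carre_du_champ_moment W Z \<mu> q f"
proof -
  define f0 where "f0 z = f z - (\<integral>y. f y \<partial>\<mu>)" for z
  define g0 :: "real \<Rightarrow> real" where "g0 = (if q = 1 then (\<lambda>_. 1) else (\<lambda>x. x powr (2 * q - 2)))"
  define g where "g x = g0 \<bar>x\<bar>" for x
  define p where "p = 2 * q - 1"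
  define \<Psi> where "\<Psi> z = mat_fun g (f0 z)" for z
  define \<Phi> where "\<Phi> z = mat_fun (\<lambda>x. x * g x) (f0 z)" for z
  define \<alpha> where "\<alpha> z = Re (trace (mat_fun (\<lambda>x. \<bar>x\<bar> powr q) (Gamma f f z)))" for z
  define \<beta> where "\<beta> z = Re (trace (mat_fun (\<lambda>x. \<bar>x\<bar> powr (2 * q)) (f0 z)))" for z
  have q1: "1 \<le> q" using q by auto
  have p: "0 < p" "p = (2 * q - 2) + 1" using q1 by (auto simp: p_def)
  have g_cases: "q = 1 \<and> g = (\<lambda>_. 1) \<or> 3/2 \<le> q \<and> g = (\<lambda>x. \<bar>x\<bar> powr (2 * q - 2))"
    using q by (auto simp: g_def g0_def)
  have g_nonneg: "0 \<le> g x" for x using g_cases by auto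
  have g0: "moderate_growth g0"
    using q moderate_growth_const moderate_growth_powr[of "2 * q - 2"] by (auto simp: g0_def)
  have cf: "components_in S f" and hf: "\<And>z. hermitian (f z)" using f by (auto simp: suitable_iff)
  have df: "dominated S f" by (rule components_in_dominated[OF cf])
  have cf0: "components_in S f0" unfolding f0_def[abs_def] by (intro components_in_diff components_in_const cf)
  have hf0: "hermitian (f0 z)" for z
    unfolding f0_def by (intro hermitian_diff hf expectation_hermitian df)
  have f0: "suitable S f0" using cf0 hf0 by (simp add: suitable_iff)
  have df0: "dominated S f0" by (rule components_in_dominated[OF cf0])
  have mean: "(\<integral>z. f0 z \<partial>\<mu>) = 0"
    using dominated_integrable[OF df] by (simp add: f0_def mu.prob_space)
  have \<Gamma>: "Gamma f0 f0 = Gamma f f" unfolding f0_def[abs_def] by (intro ext Gamma_diff_const cf)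
  have c\<Gamma>: "components_in S (Gamma f f)" by (intro components_in_Gamma cf)
  have d\<Gamma>: "dominated S (Gamma f f)" by (rule components_in_dominated[OF c\<Gamma>])
  have p\<Gamma>: "pos_semidef (Gamma f f z)" for z by (rule Gamma_pos_semidef[OF cf hf])
  have s\<Gamma>: "suitable S (Gamma f f)"
    using c\<Gamma> p\<Gamma> pos_semidef_hermitian by (auto simp: suitable_iff)
  have d\<Psi>: "dominated S \<Psi>"
    using dominated_mat_fun[OF f0 g0] by (simp add: \<Psi>_def[abs_def] g_def[abs_def])
  have \<Phi>_eq: "\<Phi> z = f0 z ** \<Psi> z" for z
    using mat_fun_mult[OF hf0[of z], of "\<lambda>x. x" g] by (simp add: \<Phi>_def \<Psi>_def mat_fun_id[OF hf0])
  have d\<Phi>: "dominated S \<Phi>"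
    using dominated_matrix_mult[OF df0 d\<Psi>] by (simp add: \<Phi>_eq[abs_def])
  have d\<alpha>: "dominated S \<alpha>" unfolding \<alpha>_def[abs_def]
    using dominated_bounded_linear[OF bounded_linear_Re_trace dominated_mat_fun[OF s\<Gamma> moderate_growth_powr[of q]]] q1 by simp
  have d\<beta>: "dominated S \<beta>" unfolding \<beta>_def[abs_def]
    using dominated_bounded_linear[OF bounded_linear_Re_trace dominated_mat_fun[OF f0 moderate_growth_powr[of "2 * q"]]] q1 by simp
  define G where "G = (\<integral>z. \<alpha> z \<partial>\<mu>)"
  define M where "M = (\<integral>z. \<beta> z \<partial>\<mu>)"
  define K where "K = ((c * p) powr q / q * G + (1 - 1 / q) * M) / c"

  have Young: "c * p * pairing (P t (Gamma f f)) \<Psi> \<le> c * K" if t: "0 \<le> t" for t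
  proof -
    have cp: "0 < c * p" using c p by simp
    have "pairing (P t (Gamma f f)) (\<lambda>z. (c * p) *\<^sub>R \<Psi> z)
        \<le> (\<integral>z. (c * p) powr q / q * \<alpha> z \<partial>\<mu>) + (\<integral>z. (1 - 1 / q) * \<beta> z \<partial>\<mu>)"
    proof (rule integral_trace_form_P_le[OF d\<Gamma> dominated_scaleR[OF d\<Psi>] dominated_mult[OF dominated_const d\<alpha>]
          dominated_mult[OF dominated_const d\<beta>] t])
      fix y z
      have "trace_form (Gamma f f y) (mat_fun (\<lambda>x. c * p * g x) (f0 z))
          \<le> Re (trace (mat_fun (\<lambda>x. (c * p) powr q / q * \<bar>x\<bar> powr q) (Gamma f f y)))
            + Re (trace (mat_fun (\<lambda>x. (1 - 1 / q) * \<bar>x\<bar> powr (2 * q)) (f0 z)))"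
        by (intro trace_form_le_of_scalar p\<Gamma> hf0 weighted_Young g_cases cp)
      then show "trace_form (Gamma f f y) ((c * p) *\<^sub>R \<Psi> z) \<le> (c * p) powr q / q * \<alpha> y + (1 - 1 / q) * \<beta> z"
        by (simp only: \<alpha>_def \<beta>_def \<Psi>_def mat_fun_scale[OF hf0]
            mat_fun_scale[OF pos_semidef_hermitian[OF p\<Gamma>]] linear_cmul[OF linear_Re_trace] real_scaleR_def)
    qed
    then show ?thesis using c by (simp add: trace_form.scaleR_right K_def G_def M_def)
  qed

  define F where "F t = pairing (P t f0) \<Phi>" for t
  define F' where "F' t = pairing (P t (L f0)) \<Phi>" for t
  have F: "(F has_real_derivative F' t) (at t within {0..})" if "0 \<le> t" for t
    unfolding F_def F'_def
    by (rule has_derivative_integral_bilinear[OF bounded_bilinear_trace_form L2_deriv_P[OF cf0 that] d\<Phi>])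
  have F'_lower: "- (K * exp (- t / c)) \<le> F' t" if t: "0 \<le> t" for t
  proof -
    \<comment> \<open>This weight balances \<open>\<Gamma>(f)\<close> against \<open>\<Gamma>(P\<^sub>t f)\<close>, for which gradient decay provides the factor \<open>s\<^sup>2\<close>.\<close>
    define s where "s = exp (- t / c)"
    have s: "0 < s" "exp (- (2 * t / c)) = s * s" by (simp_all add: s_def flip: exp_add)
    have ct: "components_in S (P t f0)" by (intro components_in_P cf0 t)
    have ht: "hermitian (P t f0 z)" for z by (intro P_hermitian df0 hf0 t)
    let ?\<psi> = "\<lambda>x. p * g x"
    have \<psi>_eq: "mat_fun ?\<psi> (f0 z) = p *\<^sub>R \<Psi> z" for z
      by (simp add: \<Psi>_def mat_fun_scale[OF hf0])
    have signed: "\<bar>x * g x - y * g y\<bar> \<le> \<bar>x - y\<bar> * ((?\<psi> x + ?\<psi> y) / 2)" for x y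
      unfolding p(2) by (rule signed_powr_diff_le) (use g_cases in auto)
    have "- pairing (L (P t f0)) (\<lambda>z. mat_fun (\<lambda>x. x * g x) (f0 z))
      \<le> (s * pairing (Gamma f0 f0) (\<lambda>z. mat_fun ?\<psi> (f0 z))
        + (1/s) * pairing (Gamma (P t f0) (P t f0)) (\<lambda>z. mat_fun ?\<psi> (f0 z))) / 2"
    proof (rule chain_rule_inequality[OF cf0 hf0 ct ht signed])
      show "0 \<le> p * g x" for x using p g_nonneg by simp
      show "dominated S (\<lambda>z. mat_fun (\<lambda>x. x * g x) (f0 z))" using d\<Phi> by (simp add: \<Phi>_def[abs_def])
      show "dominated S (\<lambda>z. mat_fun ?\<psi> (f0 z))" unfolding \<psi>_eq by (intro dominated_scaleR d\<Psi>)
    qed (rule s)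
    then have "- F' t \<le> (s * (p * pairing (Gamma f f) \<Psi>)
        + (1/s) * (p * pairing (Gamma (P t f0) (P t f0)) \<Psi>)) / 2"
      by (simp add: F'_def \<Phi>_def L_P_commute[OF cf0 t] \<psi>_eq \<Gamma> trace_form.scaleR_right)
    also have "\<dots> \<le> (s * K + s * K) / 2"
    proof -
      have Young': "p * pairing (P u (Gamma f f)) \<Psi> \<le> K" if "0 \<le> u" for u
        using Young[OF that] c by (simp add: mult.assoc)
      have 1: "p * pairing (Gamma f f) \<Psi> \<le> K"
        using Young'[of 0] by (simp add: P_zero[OF dominated_measurable[OF d\<Gamma>]])
      have "pairing (Gamma (P t f0) (P t f0)) \<Psi>
          \<le> s * s * pairing (P t (Gamma f f)) \<Psi>"
        using gradient_decay_mat_fun[OF c BE f0 f0 g0 t] unfolding s(2) \<Gamma> by (simp add: \<Psi>_def g_def[abs_def])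
      then have "p * pairing (Gamma (P t f0) (P t f0)) \<Psi>
          \<le> p * (s * s * pairing (P t (Gamma f f)) \<Psi>)"
        using p(1) by (intro mult_left_mono) auto
      also have "\<dots> = s * s * (p * pairing (P t (Gamma f f)) \<Psi>)" by simp
      also have "\<dots> \<le> s * s * K" using Young'[OF t] s(1) by (intro mult_left_mono) auto
      finally have "(1/s) * (p * pairing (Gamma (P t f0) (P t f0)) \<Psi>) \<le> (1/s) * (s * s * K)"
        using s(1) by (intro mult_left_mono) auto
      also have "\<dots> = s * K" using s(1) by simp
      finally show ?thesis using mult_left_mono[OF 1, of s] s(1) by (intro divide_right_mono add_mono) auto
    qed
    finally show ?thesis by (simp add: s_def mult.commute)
  qed

  \<comment> \<open>The lower bound on \<open>F'\<close> says that \<open>h\<close> is nondecreasing; it tends to zero.\<close>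
  define h where "h t = F t - c * K * exp (- t / c)" for t
  have h: "(h has_real_derivative F' t + K * exp (- t / c)) (at t within {0..})" if "0 \<le> t" for t
    unfolding h_def using F[OF that] c by (auto intro!: derivative_eq_intros)
  have h_mono: "h 0 \<le> h t" if t: "0 \<le> t" for t
  proof (rule DERIV_nonneg_imp_increasing_open[OF t])
    have "continuous_on {0..} h" using h by (intro DERIV_continuous_on) auto
    then show "continuous_on {0..t} h" by (rule continuous_on_subset) auto
    fix r assume r: "0 < r" "r < t"
    then have "at r within {0..} = at r" by (intro at_within_interior) (simp add: interior_real_atLeast)
    then show "\<exists>y. (h has_real_derivative y) (at r) \<and> 0 \<le> y"
      using h[of r] F'_lower[of r] r by (intro exI[of _ "F' r + K * exp (- r / c)"]) simp
  qed
  have F_lim: "(F \<longlongrightarrow> 0) at_top"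
  proof -
    obtain C where C: "0 \<le> C" "\<And>A B :: 'a \<Rightarrow> complex^'d^'d. dominated S A \<Longrightarrow> dominated S B \<Longrightarrow>
        \<bar>pairing A B\<bar> \<le> C * (L2norm A * L2norm B)"
      using abs_integral_bilinear_le[OF bounded_bilinear_trace_form] by blast
    have "\<forall>\<^sub>F t in at_top. norm (F t) \<le> C * (L2norm (P t f0) * L2norm \<Phi>)"
      using eventually_ge_at_top[of 0]
      by eventually_elim (unfold F_def real_norm_def, intro C dominated_P df0 d\<Phi>)
    moreover have "((\<lambda>t. C * (L2norm (P t f0) * L2norm \<Phi>)) \<longlongrightarrow> C * (0 * L2norm \<Phi>)) at_top"
      by (intro tendsto_intros P_L2_tendsto_zero df0 mean)
    then have "((\<lambda>t. C * (L2norm (P t f0) * L2norm \<Phi>)) \<longlongrightarrow> 0) at_top"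
      by (simp only: mult_zero_left mult_zero_right)
    ultimately show ?thesis by (rule Lim_null_comparison)
  qed
  have "((\<lambda>t. exp (- t / c)) \<longlongrightarrow> 0) at_top"
  proof (rule filterlim_compose[OF exp_at_bot])
    have "filterlim (\<lambda>t. (1 / c) * t) at_top at_top"
      using c by (intro filterlim_tendsto_pos_mult_at_top[OF tendsto_const] filterlim_ident) auto
    then show "filterlim (\<lambda>t. - t / c) at_bot at_top"
      by (simp add: filterlim_uminus_at_bot)
  qed
  then have "(h \<longlongrightarrow> 0 - c * K * 0) at_top"
    unfolding h_def by (intro tendsto_intros F_lim)
  moreover have "\<forall>\<^sub>F t in at_top. h 0 \<le> h t"
    using eventually_ge_at_top[of 0] by eventually_elim (rule h_mono)
  ultimately have "h 0 \<le> 0 - c * K * 0"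
    by (rule tendsto_lowerbound) simp
  moreover have "F 0 = M"
  proof -
    have "trace_form (f0 z) (\<Phi> z) = \<beta> z" for z
    proof -
      have "f0 z ** \<Phi> z = mat_fun (\<lambda>x. x * (x * g x)) (f0 z)"
        using mat_fun_mult[OF hf0[of z], of "\<lambda>x. x" "\<lambda>x. x * g x"] by (simp add: \<Phi>_def mat_fun_id[OF hf0])
      also have "(\<lambda>x. x * (x * g x)) = (\<lambda>x. \<bar>x\<bar> powr (2 * q))"
        by (intro ext powr_moment_identity g_cases)
      finally show ?thesis by (simp add: trace_form_def \<beta>_def)
    qed
    then show ?thesis by (simp add: F_def M_def P_zero[OF dominated_measurable[OF df0]])
  qed
  ultimately have "M \<le> c * K" by (simp add: h_def)
  then have "M \<le> (c * p) powr q / q * G + (1 - 1 / q) * M" using c by (simp add: K_def)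
  then have "M / q \<le> (c * p) powr q * G / q" by (simp add: algebra_simps)
  then have "M \<le> (c * p) powr q * G" using q1 by (simp add: divide_le_cancel)
  moreover have "central_moment \<mu> (2 * q) f = M"
    by (simp add: central_moment_def M_def \<beta>_def f0_def)
  moreover have "carre_du_champ_moment W Z \<mu> q f = G"
  proof -
    have "mat_fun (\<lambda>x. x powr q) (Gamma f f z) = mat_fun (\<lambda>x. \<bar>x\<bar> powr q) (Gamma f f z)" for z
      by (rule mat_fun_cong_nonneg[OF p\<Gamma>]) simp
    then show ?thesis by (simp add: carre_du_champ_moment_def G_def \<alpha>_def)
  qed
  ultimately show ?thesis by (simp add: p_def)
qed

text \<open>An essential supremum is an almost sure bound, and it is nonnegative because \<open>\<mu>\<close> is a probability measure. It bounds
  every eigenvalue of \<open>\<Gamma>(f)\<close>.\<close>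

lemma carre_du_champ_moment_le_variance_proxy:
  fixes f :: "'a \<Rightarrow> complex^'d^'d"
  assumes f: "suitable S f" and q: "1 \<le> q" and fin: "variance_proxy W Z \<mu> f < \<infinity>"
  defines "v \<equiv> real_of_ereal (variance_proxy W Z \<mu> f)"
  shows "0 \<le> v" and "carre_du_champ_moment W Z \<mu> q f \<le> real CARD('d) * v powr q"
proof -
  have cf: "components_in S f" and hf: "\<And>z. hermitian (f z)" using f by (auto simp: suitable_iff)
  have p\<Gamma>: "pos_semidef (Gamma f f z)" for z by (rule Gamma_pos_semidef[OF cf hf])
  have op0: "0 \<le> op_norm (Gamma f f z)" for z
    unfolding op_norm_def by (rule onorm_pos_le[OF matrix_vector_mul_bounded_linear])
  have ae: "AE z in \<mu>. ereal (op_norm (Gamma f f z)) \<le> variance_proxy W Z \<mu> f"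
    unfolding variance_proxy_def by (rule esssup_AE)
  have "0 \<le> variance_proxy W Z \<mu> f"
  proof (rule ccontr)
    assume "\<not> 0 \<le> variance_proxy W Z \<mu> f"
    then have "\<not> ereal (op_norm (Gamma f f z)) \<le> variance_proxy W Z \<mu> f" for z
      using op0[of z] by (metis ereal_less_eq(5) order_trans)
    then have "AE z in \<mu>. False" using ae by simp
    then show False by (simp add: mu.AE_False)
  qed
  then have v: "variance_proxy W Z \<mu> f = ereal v" "0 \<le> v"
    using fin by (auto simp: v_def ereal_real real_of_ereal_pos)
  then show "0 \<le> v" by simp
  have s\<Gamma>: "suitable S (Gamma f f)"
    using components_in_Gamma[OF cf cf] pos_semidef_hermitian[OF p\<Gamma>] by (simp add: suitable_iff)
  have eq: "mat_fun (\<lambda>x. x powr q) (Gamma f f z) = abs_fun (\<lambda>x. x powr q) (Gamma f f z)" for z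
    by (rule mat_fun_cong_nonneg[OF p\<Gamma>]) simp
  have "carre_du_champ_moment W Z \<mu> q f \<le> (\<integral>z. real CARD('d) * v powr q \<partial>\<mu>)"
    unfolding carre_du_champ_moment_def
  proof (rule integral_mono_AE)
    show "integrable \<mu> (\<lambda>z. Re (trace (mat_fun (\<lambda>x. x powr q) (Gamma f f z))))"
      using q unfolding eq by (intro dominated_integrable dominated_bounded_linear[OF bounded_linear_Re_trace]
          dominated_mat_fun s\<Gamma> moderate_growth_powr) simp
    show "AE z in \<mu>. Re (trace (mat_fun (\<lambda>x. x powr q) (Gamma f f z))) \<le> real CARD('d) * v powr q"
      using ae
    proof eventually_elim
      case (elim z)
      then have "op_norm (Gamma f f z) powr q \<le> v powr q"
        using q op0 by (intro powr_mono2) (auto simp: v)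
      then have "real CARD('d) * op_norm (Gamma f f z) powr q \<le> real CARD('d) * v powr q"
        by (intro mult_left_mono) auto
      then show ?case using trace_powr_le_op_norm[OF p\<Gamma>[of z], of q] q by linarith
    qed
  qed simp
  then show "carre_du_champ_moment W Z \<mu> q f \<le> real CARD('d) * v powr q" by (simp add: mu.prob_space)
qed

end

theorem theorem3p2:
  fixes W :: "'a::polish_space \<Rightarrow> 'w measure" and Z :: "real \<Rightarrow> 'w \<Rightarrow> 'a"
    and \<mu> :: "'a measure" and S :: "('a \<Rightarrow> real) set" and c q :: real
    and f :: "'a \<Rightarrow> complex^'d::finite^'d"
  assumes "suitable_functions W Z \<mu> S TYPE('d)"
    and "c > 0"
    and "bakry_emery W Z \<mu> S TYPE('d) c"
    and "suitable S f"
    and "q = 1 \<or> q \<ge> 3/2"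
  shows "central_moment \<mu> (2 * q) f powr (1 / (2 * q))
           \<le> sqrt (c * (2 * q - 1)) * carre_du_champ_moment W Z \<mu> q f powr (1 / (2 * q)) \<and>
         (variance_proxy W Z \<mu> f < \<infinity> \<longrightarrow>
           central_moment \<mu> (2 * q) f powr (1 / (2 * q))
             \<le> real CARD('d) powr (1 / (2 * q))
                 * sqrt (c * (2 * q - 1) * real_of_ereal (variance_proxy W Z \<mu> f)))"
proof -
  interpret suitable_functions W Z \<mu> S "TYPE('d)" by fact
  have cf: "components_in S f" and hf: "\<And>z. hermitian (f z)" using assms(4) by (auto simp: suitable_iff)
  define M where "M = central_moment \<mu> (2 * q) f"
  define G where "G = carre_du_champ_moment W Z \<mu> q f"
  define a where "a = c * (2 * q - 1)"
  have q: "1 \<le> q" and a: "0 < a" using assms(2,5) by (auto simp: a_def)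
  have p\<Gamma>: "pos_semidef (carre_du_champ W Z f f z)" for z by (rule Gamma_pos_semidef[OF cf hf])
  have "hermitian (f z - (\<integral>y. f y \<partial>\<mu>))" for z
    by (intro hermitian_diff hf expectation_hermitian components_in_dominated cf)
  then have M0: "0 \<le> M" unfolding M_def central_moment_def
    by (intro Bochner_Integration.integral_nonneg trace_mat_fun_nonneg) auto
  have G0: "0 \<le> G" unfolding G_def carre_du_champ_moment_def
    by (intro Bochner_Integration.integral_nonneg trace_mat_fun_nonneg pos_semidef_hermitian p\<Gamma>) auto
  have "M powr (1 / (2 * q)) \<le> (a powr q * G) powr (1 / (2 * q))"
    using moment_inequality[OF assms(2,3,4,5)] q M0
    by (intro powr_mono2) (auto simp: M_def G_def a_def)
  also have "\<dots> = sqrt a * G powr (1 / (2 * q))"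
    using a q G0 by (simp add: powr_mult powr_powr powr_half_sqrt)
  finally have first: "M powr (1 / (2 * q)) \<le> sqrt a * G powr (1 / (2 * q))" .
  have "M powr (1 / (2 * q)) \<le> real CARD('d) powr (1 / (2 * q)) * sqrt (a * v)"
    if "variance_proxy W Z \<mu> f < \<infinity>" and v: "v = real_of_ereal (variance_proxy W Z \<mu> f)" for v
  proof -
    have v0: "0 \<le> v" and "G \<le> real CARD('d) * v powr q"
      using carre_du_champ_moment_le_variance_proxy[OF assms(4) q that(1)] by (simp_all add: G_def v)
    then have "G powr (1 / (2 * q)) \<le> (real CARD('d) * v powr q) powr (1 / (2 * q))"
      using q G0 by (intro powr_mono2) auto
    also have "\<dots> = real CARD('d) powr (1 / (2 * q)) * sqrt v"
      using q v0 by (simp add: powr_mult powr_powr powr_half_sqrt)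
    finally have "sqrt a * G powr (1 / (2 * q)) \<le> sqrt a * (real CARD('d) powr (1 / (2 * q)) * sqrt v)"
      using a by (intro mult_left_mono) auto
    with first show ?thesis by (simp add: real_sqrt_mult mult_ac)
  qed
  with first show ?thesis by (simp add: M_def G_def a_def)
qed

end
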